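(* Let $\varphi$ be a ring automorphism of $\Bbbk=\mathbb Z[X,Y,Z^{\pm1}]/(X^2=Y^2=1)$ preserving its $\mathbb Z_2\times\mathbb Z$-grading, and assume $\varphi(XY)=XY$. Then for any link diagram $D$ the complexes of $\Bbbk$-modules $\mathcal FKh(D)$ and $\mathcal F_\varphi Kh_\varphi(D)$ are isomorphic.
   Context: **Ring.** $\Bbbk=\mathbb Z[X,Y,Z^{\pm1}]/(X^2=Y^2=1)$ is graded by $\mathbb Z_2\times\mathbb Z$ via $\mathrm{sdeg}X=\mathrm{sdeg}Y=(1,0)$, $\mathrm{sdeg}Z=(0,-1)$. Put $\lambda(a,b,a',b')=X^{aa'}Y^{bb'}Z^{ab'-a'b}$. **Chronological cobordisms.** A chronological cobordism is a 2-dimensional cobordism $W$ with a Morse function $h:W\to[0,1]$, $h^{-1}(0)$ the input, $h^{-1}(1)$ the output, critical points at distinct levels, and an orientation of the unstable space at each critical point (drawn as an arrow), up to equivalence. Objects are finite ordered families of circles. All are generated, under composition and disjoint union with vertical tubes, by: the merge $\mu:2\to1$ (arrow pointing from the second = right circle to the first = left circle), the split $\Delta:1\to2$ (arrow pointing to the back, i.e. the first output lies to the left of the arrow), the birth $\iota$, the positive death $\epsilon_+$, the negative death $\epsilon_-$, and the twist $P$. Reversing the arrow of $\mu$, $\Delta$ gives $\mu P$, $P\Delta$. $\deg W=(\#\text{births}-\#\text{merges},\#\text{deaths}-\#\text{splits})$. $\Bbbk\mathbf{ChCob}$ is the $\Bbbk$-linear category of these cobordisms modulo: $\mu P=X\mu$;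 $P\Delta=Y\Delta$; $\epsilon_-=Y\epsilon_+$; $\mu(\iota\sqcup\mathrm{id})=\mathrm{id}$; $(\mathrm{id}\sqcup\epsilon_+)\Delta=\mathrm{id}=(\epsilon_-\sqcup\mathrm{id})\Delta$; $\mu(\mu\sqcup\mathrm{id})=X\mu(\mathrm{id}\sqcup\mu)$; $(\Delta\sqcup\mathrm{id})\Delta=Y(\mathrm{id}\sqcup\Delta)\Delta$; $(\mathrm{id}\sqcup\mu)(\Delta\sqcup\mathrm{id})=Z\Delta\mu=(\mu\sqcup\mathrm{id})(\mathrm{id}\sqcup\Delta)$; $(\mathrm{id}\sqcup W)(W'\sqcup\mathrm{id})=\lambda(\deg W,\deg W')(W'\sqcup\mathrm{id})(\mathrm{id}\sqcup W)$. **The complex $Kh(D)$.** Let $D$ have $n$ enumerated crossings, each decorated by an arrow joining the two arcs of its type 0 resolution. At a crossing whose overstrand runs NW–SE, type 0 joins NW–NE and SW–SE, type 1 joins NW–SW and NE–SE. For $\xi\in\{0,1\}^n$, $D_\xi$ is the resolved family of circles (ordered arbitrarily). An edge $\zeta:\xi\to\xi'$ of the cube carries the saddle cobordism $D_\zeta$ oriented by the arrow. It is known that there is a cubical 2-cocycle $\psi$ with values in $\Bbbk^*$ with $W_{1\star}W_{\star0}=\psi(S)W_{\star1}W_{0\star}$ on each face $S$; fix it. (It is determined by the chronological relations except on faces where a circle is split and then merged back, where both $1$ and $XY$ satisfy the identity and the value is fixed by a local rule: the circle carries two arrows with alternating endpoints, $a$ inside and $b$ outside, and $\psi(S)$ is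 $1$ or $XY$ according to whether the first endpoint of $b$ met counterclockwise from the tail of $a$ is a tail or a head.) A sign assignment is a $\Bbbk^*$-valued 1-cochain $\epsilon$ with $\epsilon_{1\star}\epsilon_{\star0}\psi(S)=-\epsilon_{\star1}\epsilon_{0\star}$ on each face. $Kh(D)$ is the complex in the additive closure of $\Bbbk\mathbf{ChCob}$ with $Kh(D)^i=\bigoplus_{|\xi|=i+n_-}D_\xi$ ($n_-$ = number of negative crossings), differential $\sum_\zeta\epsilon(\zeta)D_\zeta$. **The functor $\mathcal F$.** $\mathcal F:\Bbbk\mathbf{ChCob}\to\mathbf{Mod}_\Bbbk$ sends $k$ circles to $A^{\otimes k}$, $A=\Bbbk v_+\oplus\Bbbk v_-$, $\deg v_+=(1,0)$, $\deg v_-=(0,-1)$; it sends $(W\sqcup\mathrm{id})(\mathrm{id}\sqcup W')$ to $\mathcal F(W)\otimes\mathcal F(W')$, where $(f\otimes g)(m\otimes n)=\lambda(\deg g,\deg m)f(m)\otimes g(n)$, the twist to $m\otimes n\mapsto\lambda(\deg m,\deg n)n\otimes m$, and: $\mu$: $v_+v_+\mapsto v_+$, $v_+v_-\mapsto v_-$, $v_-v_+\mapsto XZv_-$, $v_-v_-\mapsto0$; $\Delta$: $v_+\mapsto v_-\otimes v_++YZv_+\otimes v_-$, $v_-\mapsto v_-\otimes v_-$; $\iota$: $1\mapsto v_+$; $\epsilon_-$: $v_+\mapsto0$, $v_-\mapsto1$. **Twisted versions.** $\Bbbk_\varphi\mathbf{ChCob}$, $Kh_\varphi(D)$ and $\mathcal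 F_\varphi$ are obtained by the same constructions with the parameters $X,Y,Z$ replaced everywhere (in the chronological relations, in $\lambda$, in $\psi$ and the sign assignment, and in the formulas defining $\mathcal F$) by $\varphi(X),\varphi(Y),\varphi(Z)$. *)

theory Defs
  imports "HOL-Library.Z2" "HOL-Library.Poly_Mapping" "HOL-Library.Product_Plus"
begin

section \<open>The ring\<close>

text \<open>
  \<open>\<int>[X, Y, Z\<^sup>\<plusminus>\<^sup>1] / (X\<^sup>2 = Y\<^sup>2 = 1)\<close> is the group ring of \<open>\<int>\<^sub>2 \<times> \<int>\<^sub>2 \<times> \<int>\<close>: the key \<open>(a, b, c)\<close> stands
  for the monomial \<open>X\<^sup>a Y\<^sup>b Z\<^sup>c\<close>, and multiplication in \<open>poly_mapping\<close> is convolution.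
\<close>

type_synonym kring = "(bit \<times> bit \<times> int) \<Rightarrow>\<^sub>0 int"

definition kX :: kring where "kX = Poly_Mapping.single (1, 0, 0) 1"
definition kY :: kring where "kY = Poly_Mapping.single (0, 1, 0) 1"
definition kZ :: kring where "kZ = Poly_Mapping.single (0, 0, 1) 1"

definition mono_sdeg :: "bit \<times> bit \<times> int \<Rightarrow> bit \<times> int" where
  "mono_sdeg = (\<lambda>(a, b, c). (a + b, - c))"

definition homogeneous :: "bit \<times> int \<Rightarrow> kring set" where
  "homogeneous d = {f. \<forall>m \<in> Poly_Mapping.keys f. mono_sdeg m = d}"

definition ring_automorphism :: "('k::comm_ring_1 \<Rightarrow> 'k) \<Rightarrow> bool" where
  "ring_automorphism \<phi> \<longleftrightarrow> bij \<phi> \<and> \<phi> 1 = 1 \<and>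
     (\<forall>a b. \<phi> (a + b) = \<phi> a + \<phi> b) \<and> (\<forall>a b. \<phi> (a * b) = \<phi> a * \<phi> b)"

definition grading_preserving :: "(kring \<Rightarrow> kring) \<Rightarrow> bool" where
  "grading_preserving \<phi> \<longleftrightarrow> (\<forall>d. \<phi> ` homogeneous d \<subseteq> homogeneous d)"

text \<open>
  Everything below is parametrised by the values of \<open>X\<close>, \<open>Y\<close>, \<open>Z\<close>; the twisted versions are obtained
  by using \<open>\<phi> X\<close>, \<open>\<phi> Y\<close>, \<open>\<phi> Z\<close> instead.
\<close>

datatype 'k params = Params (pX: 'k) (pY: 'k) (pZ: 'k)

text \<open>Integer powers of a unit.\<close>

definition upow :: "'k::comm_ring_1 \<Rightarrow> int \<Rightarrow> 'k" where
  "upow u k = (if k \<ge> 0 then u ^ nat k else (THE v. u * v = 1) ^ nat (- k))"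

definition lam :: "'k::comm_ring_1 params \<Rightarrow> int \<times> int \<Rightarrow> int \<times> int \<Rightarrow> 'k" where
  "lam p = (\<lambda>(a, b) (a', b').
     upow (pX p) (a * a') * upow (pY p) (b * b') * upow (pZ p) (a * b' - a' * b))"


section \<open>Chronological cobordisms\<close>

text \<open>
  An object is a number of circles.  A cobordism is presented by a word in the elementary layers
  \<open>id\<^sub>a \<squnion> g \<squnion> id\<^sub>b\<close>, written \<open>(a, g, b)\<close>.  A word lists its layers in chronological order, from the
  input to the output, so the composite of \<open>w\<close> followed by \<open>w'\<close> is \<open>w @ w'\<close>.  \<open>Mu\<close> has its arrow
  pointing from the second to the first input; the first output of \<open>Delta\<close> lies to the left of its
  arrow.
\<close>

datatype gen = Mu | Delta | Iota | EpsP | EpsM | Twist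

fun gin :: "gen \<Rightarrow> nat" where
  "gin Mu = 2" | "gin Delta = 1" | "gin Iota = 0" | "gin EpsP = 1" | "gin EpsM = 1" | "gin Twist = 2"

fun gout :: "gen \<Rightarrow> nat" where
  "gout Mu = 1" | "gout Delta = 2" | "gout Iota = 1" | "gout EpsP = 0" | "gout EpsM = 0" | "gout Twist = 2"

fun gdeg :: "gen \<Rightarrow> int \<times> int" where
  "gdeg Mu = (-1, 0)" | "gdeg Delta = (0, -1)" | "gdeg Iota = (1, 0)"
| "gdeg EpsP = (0, 1)" | "gdeg EpsM = (0, 1)" | "gdeg Twist = (0, 0)"

type_synonym word = "(nat \<times> gen \<times> nat) list"

fun cob :: "word \<Rightarrow> nat \<Rightarrow> nat \<Rightarrow> bool" where
  "cob [] m n \<longleftrightarrow> m = n"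
| "cob ((a, g, b) # w) m n \<longleftrightarrow> m = a + gin g + b \<and> cob w (a + gout g + b) n"

definition cdeg :: "word \<Rightarrow> int \<times> int" where
  "cdeg w = sum_list (map (\<lambda>(a, g, b). gdeg g) w)"

text \<open>\<open>tubes a w b\<close> is \<open>id\<^sub>a \<squnion> w \<squnion> id\<^sub>b\<close>.\<close>

definition tubes :: "nat \<Rightarrow> word \<Rightarrow> nat \<Rightarrow> word" where
  "tubes a w b = map (\<lambda>(a', g, b'). (a + a', g, b' + b)) w"

text \<open>The permutation of \<open>k + 1\<close> circles that moves the last one to the front.\<close>

definition last_to_front :: "nat \<Rightarrow> word" where
  "last_to_front k = map (\<lambda>i. (i, Twist, k - 1 - i)) (rev [0..<k])"

text \<open>
  \<open>chron_rel p m n w c w'\<close> is the relation \<open>w = c w'\<close> between cobordisms from \<open>m\<close> to \<open>n\<close> circles.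
  The first three rules (symmetric group relations and naturality of the twist) account for the
  equivalence of chronological cobordisms; they do not change the chronology.  The remaining rules
  are the chronological relations.
\<close>

inductive chron_rel :: "'k::comm_ring_1 params \<Rightarrow> nat \<Rightarrow> nat \<Rightarrow> word \<Rightarrow> 'k \<Rightarrow> word \<Rightarrow> bool"
  for p :: "'k params" where
  twist_twist: "chron_rel p 2 2 [(0, Twist, 0), (0, Twist, 0)] 1 []"
| twist_braid: "chron_rel p 3 3 [(0, Twist, 1), (1, Twist, 0), (0, Twist, 1)] 1
                                [(1, Twist, 0), (0, Twist, 1), (1, Twist, 0)]"
| twist_natural: "chron_rel p (gin g + 1) (gout g + 1)
                    ((0, g, 1) # last_to_front (gout g)) 1 (last_to_front (gin g) @ [(1, g, 0)])"
| mu_twist: "chron_rel p 2 1 [(0, Twist, 0), (0, Mu, 0)] (pX p) [(0, Mu, 0)]"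
| twist_delta: "chron_rel p 1 2 [(0, Delta, 0), (0, Twist, 0)] (pY p) [(0, Delta, 0)]"
| death: "chron_rel p 1 0 [(0, EpsM, 0)] (pY p) [(0, EpsP, 0)]"
| unit: "chron_rel p 1 1 [(0, Iota, 1), (0, Mu, 0)] 1 []"
| counit_right: "chron_rel p 1 1 [(0, Delta, 0), (1, EpsP, 0)] 1 []"
| counit_left: "chron_rel p 1 1 [(0, Delta, 0), (0, EpsM, 1)] 1 []"
| mu_assoc: "chron_rel p 3 1 [(0, Mu, 1), (0, Mu, 0)] (pX p) [(1, Mu, 0), (0, Mu, 0)]"
| delta_coassoc: "chron_rel p 1 3 [(0, Delta, 0), (0, Delta, 1)] (pY p) [(0, Delta, 0), (1, Delta, 0)]"
| frobenius_left: "chron_rel p 2 2 [(0, Delta, 1), (1, Mu, 0)] (pZ p) [(0, Mu, 0), (0, Delta, 0)]"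
| frobenius_right: "chron_rel p 2 2 [(1, Delta, 0), (0, Mu, 1)] (pZ p) [(0, Mu, 0), (0, Delta, 0)]"
| disjoint: "\<lbrakk>cob w m n; cob w' m' n'\<rbrakk> \<Longrightarrow>
     chron_rel p (m' + m) (n' + n)
       (tubes 0 w' m @ tubes n' w 0) (lam p (cdeg w) (cdeg w')) (tubes m' w 0 @ tubes 0 w' n)"

text \<open>
  The submodule, spanned by all relations put into context, of the free module on the cobordisms from
  \<open>m\<close> to \<open>n\<close> circles.
\<close>

inductive_set null_combs :: "'k::comm_ring_1 params \<Rightarrow> nat \<Rightarrow> nat \<Rightarrow> (word \<Rightarrow>\<^sub>0 'k) set"
  for p :: "'k params" and m n :: nat where
  zero: "0 \<in> null_combs p m n"
| step: "\<lbrakk>f \<in> null_combs p m n; chron_rel p k l w c w';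
          cob u m (a + k + b); cob v (a + l + b) n\<rbrakk> \<Longrightarrow>
     f + (Poly_Mapping.single (u @ tubes a w b @ v) r
          - Poly_Mapping.single (u @ tubes a w' b @ v) (r * c)) \<in> null_combs p m n"

text \<open>
  The morphism \<open>c w\<close> from \<open>m\<close> to \<open>n\<close> in the linear category of chronological cobordisms modulo the
  relations, as a coset in the quotient of the free module.
\<close>

definition mor :: "'k::comm_ring_1 params \<Rightarrow> nat \<Rightarrow> nat \<Rightarrow> 'k \<Rightarrow> word \<Rightarrow> (word \<Rightarrow>\<^sub>0 'k) set" where
  "mor p m n c w = {f. Poly_Mapping.keys f \<subseteq> {u. cob u m n}
                       \<and> f - Poly_Mapping.single w c \<in> null_combs p m n}"


section \<open>Link diagrams\<close>

text \<open>
  The crossings of a diagram are \<open>0, \<dots>, n - 1\<close>.  The four ends of the crossing \<open>c\<close> are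
  \<open>(c, 0), (c, 1), (c, 2), (c, 3)\<close> in counterclockwise order, the understrand having the ends 0 and 2
  and the overstrand the ends 1 and 3.  When the overstrand is drawn NW--SE with 1 = NW, the ends
  0, 2, 3 are NE, SW, SE.  The involution \<open>arcs\<close> pairs the ends joined by an arc of the diagram,
  \<open>incoming\<close> (the orientation) is the set of ends directed towards their crossing, and \<open>free_loops\<close>
  counts the components without crossings.

  The arrow at \<open>c\<close> joins the two arcs of the type 0 resolution, which are \<open>{0, 1}\<close> and \<open>{2, 3}\<close>.  It
  starts at \<open>{0, 1}\<close> if \<open>arrow c\<close> holds and at \<open>{2, 3}\<close> otherwise.
\<close>

type_synonym cend = "nat \<times> nat"

record link_diag =
  crossings :: nat
  free_loops :: nat
  arcs :: "cend \<Rightarrow> cend"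
  incoming :: "cend set"
  arrow :: "nat \<Rightarrow> bool"

definition ends :: "link_diag \<Rightarrow> cend set" where
  "ends D = {..<crossings D} \<times> {..<4}"

definition rot :: "cend \<Rightarrow> cend" where
  "rot = (\<lambda>(c, k). (c, (k + 1) mod 4))"

text \<open>Faces and connected components of the underlying 4-valent graph embedded in a surface.\<close>

definition faces :: "link_diag \<Rightarrow> cend set set" where
  "faces D = (\<lambda>e. {(x, rot (arcs D x)) |x. True}\<^sup>* `` {e}) ` ends D"

definition components :: "link_diag \<Rightarrow> cend set set" where
  "components D = (\<lambda>e. ({(x, rot x) |x. True} \<union> {(x, arcs D x) |x. True})\<^sup>* `` {e}) ` ends D"

text \<open>
  The last condition says that each component lies on a sphere: the graph has \<open>n\<close> vertices and
  \<open>2 n\<close> edges, so its Euler characteristic \<open>n - 2 n + card (faces D)\<close> must be twice the number of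
  components.
\<close>

definition link_diagram :: "link_diag \<Rightarrow> bool" where
  "link_diagram D \<longleftrightarrow>
     (\<forall>e \<in> ends D. arcs D e \<in> ends D \<and> arcs D e \<noteq> e \<and> arcs D (arcs D e) = e) \<and>
     (\<forall>e \<in> ends D. arcs D e \<in> incoming D \<longleftrightarrow> e \<notin> incoming D) \<and>
     (\<forall>e \<in> ends D. rot (rot e) \<in> incoming D \<longleftrightarrow> e \<notin> incoming D) \<and>
     card (faces D) = crossings D + 2 * card (components D)"

text \<open>
  With the understrand directed from 0 to 2, the crossing is positive iff the overstrand is directed
  from 3 to 1.
\<close>

definition n_minus :: "link_diag \<Rightarrow> nat" where
  "n_minus D = card {c. c < crossings D \<and> \<not> ((c, 0) \<in> incoming D \<longleftrightarrow> (c, 3) \<in> incoming D)}"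


section \<open>The cube of resolutions\<close>

text \<open>
  A vertex \<open>\<xi>\<close> of the cube is given by the set of crossings resolved with type 1.  The edge
  \<open>(\<xi>, c)\<close>, with \<open>c \<notin> \<xi>\<close>, goes from \<open>\<xi>\<close> to \<open>insert c \<xi>\<close>.  The face \<open>(\<xi>, i, j)\<close>, with \<open>i < j\<close>
  and \<open>i, j \<notin> \<xi>\<close>, has first vertex \<open>\<xi>\<close> and directions \<open>i\<close>, \<open>j\<close>.
\<close>

definition vertex :: "link_diag \<Rightarrow> nat set \<Rightarrow> bool" where
  "vertex D \<xi> \<longleftrightarrow> \<xi> \<subseteq> {..<crossings D}"

definition edge :: "link_diag \<Rightarrow> nat set \<Rightarrow> nat \<Rightarrow> bool" where
  "edge D \<xi> c \<longleftrightarrow> vertex D \<xi> \<and> c < crossings D \<and> c \<notin> \<xi>"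

definition face :: "link_diag \<Rightarrow> nat set \<Rightarrow> nat \<Rightarrow> nat \<Rightarrow> bool" where
  "face D \<xi> i j \<longleftrightarrow> edge D \<xi> i \<and> edge D \<xi> j \<and> i < j"

text \<open>Type 0 joins the ends 0--1 and 2--3 of a crossing, type 1 joins 1--2 and 0--3.\<close>

definition smooth :: "nat set \<Rightarrow> cend \<Rightarrow> cend" where
  "smooth \<xi> = (\<lambda>(c, k). if c \<in> \<xi> then (c, 3 - k)
                        else (c, if even k then k + 1 else k - 1))"

text \<open>A resolved circle through crossings is represented by the set of all ends on it.\<close>

datatype circle = Circle "cend set" | Loop nat

definition circle_at :: "link_diag \<Rightarrow> nat set \<Rightarrow> cend \<Rightarrow> circle" where
  "circle_at D \<xi> e =
     Circle (({(x, arcs D x) |x. True} \<union> {(x, smooth \<xi> x) |x. True})\<^sup>* `` {e})"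

definition circles :: "link_diag \<Rightarrow> nat set \<Rightarrow> circle set" where
  "circles D \<xi> = circle_at D \<xi> ` ends D \<union> Loop ` {..<free_loops D}"

text \<open>An ordering of the circles in each resolution, making \<open>D\<^sub>\<xi>\<close> an object.\<close>

definition circle_order :: "link_diag \<Rightarrow> (nat set \<Rightarrow> circle list) \<Rightarrow> bool" where
  "circle_order D ord \<longleftrightarrow>
     (\<forall>\<xi>. vertex D \<xi> \<longrightarrow> distinct (ord \<xi>) \<and> set (ord \<xi>) = circles D \<xi>)"

text \<open>
  The permutation from the family \<open>xs\<close> to the family \<open>ys\<close>, as a composite of twists: the first circle
  of \<open>ys\<close> is moved to the front, and so on.  The argument \<open>a\<close> counts circles already in place.
\<close>

fun permute :: "nat \<Rightarrow> circle list \<Rightarrow> circle list \<Rightarrow> word" where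
  "permute a xs [] = []"
| "permute a xs (y # ys) =
     tubes a (last_to_front (length (takeWhile (\<lambda>x. x \<noteq> y) xs)))
             (length xs - Suc (length (takeWhile (\<lambda>x. x \<noteq> y) xs)))
     @ permute (Suc a) (remove1 y xs) ys"

text \<open>Ends on the arc of the type 0 resolution where the arrow starts, and where it ends.\<close>

definition tail_end :: "link_diag \<Rightarrow> nat \<Rightarrow> cend" where
  "tail_end D c = (if arrow D c then (c, 0) else (c, 2))"

definition head_end :: "link_diag \<Rightarrow> nat \<Rightarrow> cend" where
  "head_end D c = (if arrow D c then (c, 2) else (c, 0))"

text \<open>
  Ends on the arcs of the type 1 resolution to the left and to the right of the arrow: an arrow from
  \<open>{0, 1}\<close> (top) to \<open>{2, 3}\<close> (bottom) has \<open>{0, 3}\<close> (east) on its left.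
\<close>

definition left_end :: "link_diag \<Rightarrow> nat \<Rightarrow> cend" where
  "left_end D c = (if arrow D c then (c, 0) else (c, 1))"

definition right_end :: "link_diag \<Rightarrow> nat \<Rightarrow> cend" where
  "right_end D c = (if arrow D c then (c, 1) else (c, 0))"

definition is_merge :: "link_diag \<Rightarrow> nat set \<Rightarrow> nat \<Rightarrow> bool" where
  "is_merge D \<xi> c \<longleftrightarrow> circle_at D \<xi> (tail_end D c) \<noteq> circle_at D \<xi> (head_end D c)"

text \<open>
  The saddle cobordism of an edge.  A merge takes the circle at the head of the arrow as first input
  of \<open>Mu\<close> and the one at the tail as second; a split has the circle to the left of the arrow as first
  output of \<open>Delta\<close>.
\<close>

definition saddle :: "link_diag \<Rightarrow> (nat set \<Rightarrow> circle list) \<Rightarrow> nat set \<Rightarrow> nat \<Rightarrow> word" where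
  "saddle D ord \<xi> c =
     (let \<xi>' = insert c \<xi>;
          t = circle_at D \<xi> (tail_end D c); h = circle_at D \<xi> (head_end D c);
          l = circle_at D \<xi>' (left_end D c); r = circle_at D \<xi>' (right_end D c);
          rest = filter (\<lambda>C. C \<noteq> t \<and> C \<noteq> h) (ord \<xi>)
      in if is_merge D \<xi> c
         then permute 0 (ord \<xi>) (h # t # rest) @ [(0, Mu, length rest)]
              @ permute 0 (l # rest) (ord \<xi>')
         else permute 0 (ord \<xi>) (t # rest) @ [(0, Delta, length rest)]
              @ permute 0 (l # r # rest) (ord \<xi>'))"

text \<open>Faces on which a circle is split and then merged back.\<close>

definition ladybug :: "link_diag \<Rightarrow> nat set \<Rightarrow> nat \<Rightarrow> nat \<Rightarrow> bool" where
  "ladybug D \<xi> i j \<longleftrightarrow>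
     \<not> is_merge D \<xi> i \<and> \<not> is_merge D \<xi> j \<and> is_merge D (insert i \<xi>) j"

text \<open>
  The local rule.  Let \<open>a\<close> be the arrow at \<open>i\<close> and \<open>b\<close> the one at \<open>j\<close>.  We start at the tail of \<open>a\<close> and
  walk along the circle with \<open>a\<close> on the left-hand side (at a type 0 resolution this means passing from
  the end 0 to 1, or from 2 to 3), until the crossing \<open>j\<close> is first met.  If \<open>a\<close> is inside the circle,
  this is the counterclockwise direction.  If \<open>a\<close> is outside, it is the clockwise direction, and the
  answer is the same as for the inner arrow: the counterclockwise order
  \<open>a\<close>-tail, \<open>b\<close>-tail, \<open>a\<close>-head, \<open>b\<close>-head becomes clockwise, read from the tail of \<open>b\<close>,
  \<open>b\<close>-tail, \<open>a\<close>-tail, \<open>b\<close>-head, \<open>a\<close>-head.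
\<close>

definition walk :: "link_diag \<Rightarrow> nat set \<Rightarrow> nat \<Rightarrow> nat \<Rightarrow> cend" where
  "walk D \<xi> i k = ((\<lambda>e. smooth \<xi> (arcs D e)) ^^ k) (if arrow D i then (i, 1) else (i, 3))"

definition tail_first :: "link_diag \<Rightarrow> nat set \<Rightarrow> nat \<Rightarrow> nat \<Rightarrow> bool" where
  "tail_first D \<xi> i j \<longleftrightarrow>
     (let e = walk D \<xi> i (LEAST k. fst (walk D \<xi> i k) = j)
      in e = tail_end D j \<or> e = smooth \<xi> (tail_end D j))"

text \<open>The cocycle \<open>\<psi>\<close>: a unit on each face satisfying the face identity, the local rule, and \<open>d \<psi> = 1\<close>.\<close>

definition chron_cocycle ::
  "'k::comm_ring_1 params \<Rightarrow> link_diag \<Rightarrow> (nat set \<Rightarrow> circle list) \<Rightarrow> (nat set \<Rightarrow> nat \<Rightarrow> nat \<Rightarrow> 'k) \<Rightarrow> bool"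
where
  "chron_cocycle p D ord \<psi> \<longleftrightarrow>
     (\<forall>\<xi> i j. face D \<xi> i j \<longrightarrow>
        \<psi> \<xi> i j dvd 1 \<and>
        (let m = length (ord \<xi>); n = length (ord (insert i (insert j \<xi>)))
         in mor p m n 1 (saddle D ord \<xi> i @ saddle D ord (insert i \<xi>) j)
            = mor p m n (\<psi> \<xi> i j) (saddle D ord \<xi> j @ saddle D ord (insert j \<xi>) i)) \<and>
        (ladybug D \<xi> i j \<longrightarrow> \<psi> \<xi> i j = (if tail_first D \<xi> i j then 1 else pX p * pY p))) \<and>
     (\<forall>\<xi> i j k. face D \<xi> i j \<and> face D \<xi> j k \<longrightarrow>
        \<psi> (insert i \<xi>) j k * \<psi> \<xi> i k * \<psi> (insert k \<xi>) i j
        = \<psi> \<xi> j k * \<psi> (insert j \<xi>) i k * \<psi> \<xi> i j)"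

definition sign_assignment ::
  "link_diag \<Rightarrow> (nat set \<Rightarrow> nat \<Rightarrow> nat \<Rightarrow> 'k::comm_ring_1) \<Rightarrow> (nat set \<Rightarrow> nat \<Rightarrow> 'k) \<Rightarrow> bool" where
  "sign_assignment D \<psi> \<epsilon> \<longleftrightarrow>
     (\<forall>\<xi> c. edge D \<xi> c \<longrightarrow> \<epsilon> \<xi> c dvd 1) \<and>
     (\<forall>\<xi> i j. face D \<xi> i j \<longrightarrow>
        \<epsilon> (insert i \<xi>) j * \<epsilon> \<xi> i * \<psi> \<xi> i j = - (\<epsilon> (insert j \<xi>) i * \<epsilon> \<xi> j))"


section \<open>Complexes\<close>

text \<open>
  Sequences of objects and morphisms in the additive closure.  The object in degree \<open>i\<close> is the formal
  direct sum over \<open>x \<in> cidx C i\<close> of \<open>cobj C x\<close> circles; \<open>cdiff C i x' x\<close> is the matrix entry of the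
  differential from the summand \<open>x\<close> in degree \<open>i\<close> to the summand \<open>x'\<close> in degree \<open>i + 1\<close>.
\<close>

record (overloaded) ('x, 'k) cob_complex =
  cidx :: "int \<Rightarrow> 'x set"
  cobj :: "'x \<Rightarrow> nat"
  cdiff :: "int \<Rightarrow> 'x \<Rightarrow> 'x \<Rightarrow> (word \<Rightarrow>\<^sub>0 'k) set"

definition Kh ::
  "'k::comm_ring_1 params \<Rightarrow> link_diag \<Rightarrow> (nat set \<Rightarrow> circle list) \<Rightarrow> (nat set \<Rightarrow> nat \<Rightarrow> 'k)
   \<Rightarrow> (nat set, 'k) cob_complex" where
  "Kh p D ord \<epsilon> = \<lparr>
     cidx = (\<lambda>i. {\<xi>. vertex D \<xi> \<and> int (card \<xi>) = i + int (n_minus D)}),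
     cobj = (\<lambda>\<xi>. length (ord \<xi>)),
     cdiff = (\<lambda>i \<xi>' \<xi>.
       if \<exists>c. edge D \<xi> c \<and> \<xi>' = insert c \<xi>
       then let c = (THE c. edge D \<xi> c \<and> \<xi>' = insert c \<xi>)
            in mor p (length (ord \<xi>)) (length (ord \<xi>')) (\<epsilon> \<xi> c) (saddle D ord \<xi> c)
       else mor p (length (ord \<xi>)) (length (ord \<xi>')) 0 []) \<rparr>"

text \<open>
  \<open>A\<^sup>\<otimes>\<^sup>k\<close> is the free module on the words of length \<open>k\<close> in \<open>v\<^sub>+, v\<^sub>-\<close>; a tensor is given by its
  coefficients.
\<close>

datatype vgen = Vp | Vm

type_synonym 'k tensor = "vgen list \<Rightarrow> 'k"

definition tpow :: "nat \<Rightarrow> 'k::comm_ring_1 tensor set" where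
  "tpow k = {v. \<forall>s. length s \<noteq> k \<longrightarrow> v s = 0}"

definition basis :: "vgen list \<Rightarrow> 'k::comm_ring_1 tensor" where
  "basis s = (\<lambda>t. if t = s then 1 else 0)"

fun vdeg :: "vgen \<Rightarrow> int \<times> int" where
  "vdeg Vp = (1, 0)" | "vdeg Vm = (0, -1)"

definition tdeg :: "vgen list \<Rightarrow> int \<times> int" where
  "tdeg s = sum_list (map vdeg s)"

text \<open>
  The values on basis tensors.  The value of \<open>EpsP\<close> is forced by \<open>\<epsilon>\<^sub>- = Y \<epsilon>\<^sub>+\<close> and \<open>Y\<^sup>2 = 1\<close>.
\<close>

fun Fgen :: "'k::comm_ring_1 params \<Rightarrow> gen \<Rightarrow> vgen list \<Rightarrow> 'k tensor" where
  "Fgen p Mu [Vp, Vp] = basis [Vp]"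
| "Fgen p Mu [Vp, Vm] = basis [Vm]"
| "Fgen p Mu [Vm, Vp] = (\<lambda>t. pX p * pZ p * basis [Vm] t)"
| "Fgen p Delta [Vp] = (\<lambda>t. basis [Vm, Vp] t + pY p * pZ p * basis [Vp, Vm] t)"
| "Fgen p Delta [Vm] = basis [Vm, Vm]"
| "Fgen p Iota [] = basis [Vp]"
| "Fgen p EpsM [Vm] = basis []"
| "Fgen p EpsP [Vm] = (\<lambda>t. pY p * basis [] t)"
| "Fgen p Twist [u, v] = (\<lambda>t. lam p (vdeg u) (vdeg v) * basis [v, u] t)"
| "Fgen p _ _ = (\<lambda>t. 0)"

text \<open>
  \<open>id\<^sub>a \<squnion> g \<squnion> id\<^sub>b\<close> acts by
  \<open>m \<otimes> s \<otimes> n \<mapsto> \<lambda>(deg g, deg m) m \<otimes> F(g)(s) \<otimes> n\<close>.  The coefficient of a basis tensor \<open>t\<close> in the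
  image of \<open>v\<close> only involves those \<open>m\<close>, \<open>n\<close> with \<open>m = take a t\<close> and \<open>n = drop (a + gout g) t\<close>.
\<close>

definition Flayer :: "'k::comm_ring_1 params \<Rightarrow> nat \<times> gen \<times> nat \<Rightarrow> 'k tensor \<Rightarrow> 'k tensor" where
  "Flayer p = (\<lambda>(a, g, b) v t.
     if length t = a + gout g + b
     then \<Sum>s | length s = gin g.
            lam p (gdeg g) (tdeg (take a t))
            * Fgen p g s (take (gout g) (drop a t))
            * v (take a t @ s @ drop (a + gout g) t)
     else 0)"

definition Fword :: "'k::comm_ring_1 params \<Rightarrow> word \<Rightarrow> 'k tensor \<Rightarrow> 'k tensor" where
  "Fword p w = fold (Flayer p) w"

definition Fcomb :: "'k::comm_ring_1 params \<Rightarrow> (word \<Rightarrow>\<^sub>0 'k) \<Rightarrow> 'k tensor \<Rightarrow> 'k tensor" where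
  "Fcomb p f v = (\<lambda>t. \<Sum>w \<in> Poly_Mapping.keys f. Poly_Mapping.lookup f w * Fword p w v t)"

text \<open>
  The value of the functor on a morphism, that is, on a coset \<open>M\<close>, applied to a vector of the source
  module: the common value at the vector of all representatives of \<open>M\<close>.
\<close>

definition Fmor :: "'k::comm_ring_1 params \<Rightarrow> (word \<Rightarrow>\<^sub>0 'k) set \<Rightarrow> 'k tensor \<Rightarrow> 'k tensor" where
  "Fmor p M v = the_elem ((\<lambda>f. Fcomb p f v) ` M)"

text \<open>
  Sequences of modules and maps.  Vectors are families of tensors, with pointwise operations.
\<close>

record (overloaded) ('x, 'k) mod_complex =
  mcarrier :: "int \<Rightarrow> ('x \<Rightarrow> 'k tensor) set"
  mdiff :: "int \<Rightarrow> ('x \<Rightarrow> 'k tensor) \<Rightarrow> ('x \<Rightarrow> 'k tensor)"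

definition Fcomplex ::
  "'k::comm_ring_1 params \<Rightarrow> ('x, 'k) cob_complex \<Rightarrow> ('x, 'k) mod_complex" where
  "Fcomplex p C = \<lparr>
     mcarrier = (\<lambda>i. {v. (\<forall>x \<in> cidx C i. v x \<in> tpow (cobj C x)) \<and>
                         (\<forall>x. x \<notin> cidx C i \<longrightarrow> v x = (\<lambda>s. 0))}),
     mdiff = (\<lambda>i v x' s. if x' \<in> cidx C (i + 1)
                         then \<Sum>x \<in> cidx C i. Fmor p (cdiff C i x' x) (v x) s
                         else 0) \<rparr>"

definition complex_iso :: "('x, 'k::comm_ring_1) mod_complex \<Rightarrow> ('x, 'k) mod_complex \<Rightarrow> bool" where
  "complex_iso C C' \<longleftrightarrow>
     (\<exists>f. \<forall>i.
        bij_betw (f i) (mcarrier C i) (mcarrier C' i) \<and>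
        (\<forall>u \<in> mcarrier C i. \<forall>v \<in> mcarrier C i.
           f i (\<lambda>x s. u x s + v x s) = (\<lambda>x s. f i u x s + f i v x s)) \<and>
        (\<forall>c. \<forall>v \<in> mcarrier C i. f i (\<lambda>x s. c * v x s) = (\<lambda>x s. c * f i v x s)) \<and>
        (\<forall>v \<in> mcarrier C i. f (i + 1) (mdiff C i v) = mdiff C' i (f i v)))"

end

theory Submission
  imports Defs
begin

text \<open>
  A grading-preserving automorphism fixing \<open>X Y\<close> has the form \<open>X, Y, Z \<mapsto> t X, t Y, u Z\<close> with
  \<open>t\<^sup>2 = u\<^sup>2 = 1\<close>.  Put \<open>r = t u\<close> and multiply a basis tensor by \<open>r\<close> once for each pair of a letter
  \<open>v\<^sub>-\<close> and a letter to its right.  This diagonal map intertwines the two functors on twists, merges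
  and splits up to monomials in \<open>t\<close> and \<open>u\<close> that depend only on the layer.  So the edge maps of the two
  cubes agree up to units, and it remains to see that the ratio of these units and of the sign
  assignments is a cocycle, hence a coboundary on the cube, whose primitive rescales the vertices.
  On a face where one composite has a unit coefficient this follows by comparing coefficients.  The
  other faces are those with the local rule: there both cocycles take the same value, and one has to
  see that the two paths contain the same number of twists modulo 2.  This follows by specialising to
  \<open>X = Y = 1, Z = 1\<close> and to \<open>X = Y = -1, Z = 1\<close> over the integers.  Planarity guarantees that a saddle
  within a single circle splits it.
\<close>

section \<open>The functor on chronological cobordisms\<close>

text \<open>The constant r is dictated by the twist. Exchanging two equal letters costs X or Y, so
  the twisted functor differs by t; exchanging v_+ and v_- costs Z or its inverse, so it differs by
  u. An exchange of unequal letters changes the number of pairs (v_-, letter to its right) by one,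
  and the weight t u per pair turns u into t in every case. The obstacle is a circle split and
  merged back. There \<mu>\<Delta> sends v_+ to Z (X + Y) v_-, and X + Y is annihilated by 1 - X Y,
  so comparing coefficients cannot determine a ratio of scalars. Both integer specialisations send X
  Y to 1, which removes the cocycle value from the face identity, and X + Y to 2 or -2, which can be
  cancelled. Moreover (-1, -1, 1) is itself a twist of (1, 1, 1), with t = -1 and u = 1, so over the
  integers the intertwining formula counts twists modulo 2.\<close>

lemma upow_inverse:
  fixes u :: "'k::comm_ring_1"
  assumes "u * v = 1"
  shows "upow u k = (if k \<ge> 0 then u ^ nat k else v ^ nat (- k))"
proof -
  \<comment> \<open>Inverses in a commutative ring are unique, so the description in
    \<open>upow\<close> denotes any given inverse.\<close>
  have "(THE w. u * w = 1) = v"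
  proof (rule the_equality)
    fix w assume "u * w = 1"
    then have "v * (u * w) = v" by simp
    then show "w = v" using assms by (metis mult.assoc mult.commute mult_1_left)
  qed fact
  then show ?thesis by (simp add: upow_def)
qed

lemma upow_0 [simp]: "upow u 0 = 1"
  by (simp add: upow_def)

lemma upow_1 [simp]: "upow u 1 = u"
  by (simp add: upow_def)

lemma upow_minus_1: "u * v = 1 \<Longrightarrow> upow u (- 1) = v"
  by (simp add: upow_inverse)

lemma upow_add_1:
  fixes u :: "'k::comm_ring_1"
  assumes "u dvd 1"
  shows "upow u (k + 1) = upow u k * u"
proof -
  obtain v where v: "u * v = 1" using assms by (metis dvdE)
  show ?thesis
  proof (cases "k \<ge> 0")
    case True
    then show ?thesis by (simp add: upow_inverse[OF v] nat_add_distrib)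
  next
    case False
    then have "nat (- k) = Suc (nat (- (k + 1)))" by simp
    then have "v ^ nat (- k) * u = (u * v) * v ^ nat (- (k + 1))"
      by (simp add: mult_ac)
    then have "v ^ nat (- k) * u = v ^ nat (- (k + 1))"
      using v by simp
    moreover have "k + 1 \<ge> 0 \<Longrightarrow> k = - 1" using False by simp
    ultimately show ?thesis using False v by (auto simp: upow_inverse[OF v] mult.commute)
  qed
qed

text \<open>Two-sided induction on \<open>l\<close>: the upward step is \<open>upow_add_1\<close>,
  and the downward step cancels the unit \<open>u\<close> after multiplying by it.\<close>

lemma upow_add:
  fixes u :: "'k::comm_ring_1"
  assumes "u dvd 1"
  shows "upow u (k + l) = upow u k * upow u l"
proof (induction l rule: int_induct[where k = 0])
  case (step1 i)
  then show ?case using upow_add_1[OF assms, of "k + i"] upow_add_1[OF assms, of i]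
    by (simp add: algebra_simps)
next
  case (step2 i)
  obtain v where v: "u * v = 1" using assms by (metis dvdE)
  have "upow u (k + (i - 1)) * u = upow u k * upow u (i - 1) * u"
    using step2 upow_add_1[OF assms, of "k + (i - 1)"] upow_add_1[OF assms, of "i - 1"]
    by (simp add: algebra_simps)
  then have "upow u (k + (i - 1)) * (u * v) = upow u k * upow u (i - 1) * (u * v)"
    by (metis mult.assoc)
  then show ?case using v by simp
qed simp

lemma upow_dvd_1:
  fixes u :: "'k::comm_ring_1"
  shows "u dvd 1 \<Longrightarrow> upow u k dvd 1"
  by (metis add.right_inverse dvd_triv_left upow_0 upow_add)

lemma upow_one [simp]: "upow 1 k = (1 :: 'k::comm_ring_1)"
  by (simp add: upow_inverse[of 1 1])

text \<open>Makes the powers of X and Y in \<open>lam\<close> depend only on parities.\<close>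

lemma upow_involution:
  fixes u :: "'k::comm_ring_1"
  assumes "u * u = 1"
  shows "upow u k = (if even k then 1 else u)"
proof -
  have *: "u ^ n = (if even n then 1 else u)" for n
    using assms by (induction n) auto
  show ?thesis by (auto simp: upow_inverse[OF assms] * even_nat_iff)
qed

lemma mult_dvd_1: "a dvd 1 \<Longrightarrow> b dvd 1 \<Longrightarrow> a * b dvd (1 :: 'k::comm_ring_1)"
  using mult_dvd_mono[of a 1 b 1] by simp

section \<open>Units and the bimultiplicative form \<lambda>\<close>

locale chron_params =
  fixes p :: "'k::comm_ring_1 params"
  assumes X_square: "pX p * pX p = 1"
    and Y_square: "pY p * pY p = 1"
    and Z_dvd_1: "pZ p dvd 1"
begin

lemma X_dvd_1: "pX p dvd 1"
  by (metis X_square dvd_triv_left)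

lemma Y_dvd_1: "pY p dvd 1"
  by (metis Y_square dvd_triv_left)

text \<open>The group of units generated by the three parameters. Coefficients on basis tensors are
  tracked only up to this group, which suffices for invertibility; when X = Y = Z = 1 it is trivial,
  which later excludes cancellation in a sum of two coefficients.\<close>

definition monomials :: "'k set" where
  "monomials = {upow (pX p) a * upow (pY p) b * upow (pZ p) c |a b c. True}"

lemma one_in_monomials: "1 \<in> monomials"
  unfolding monomials_def by (rule CollectI, intro exI[of _ 0]) simp

lemma mult_in_monomials:
  assumes "c \<in> monomials" "d \<in> monomials"
  shows "c * d \<in> monomials"
proof -
  obtain i j k i' j' k' where "c = upow (pX p) i * upow (pY p) j * upow (pZ p) k"
    "d = upow (pX p) i' * upow (pY p) j' * upow (pZ p) k'"
    using assms by (auto simp: monomials_def)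
  then have "c * d = upow (pX p) (i + i') * upow (pY p) (j + j') * upow (pZ p) (k + k')"
    by (simp add: upow_add X_dvd_1 Y_dvd_1 Z_dvd_1 mult_ac)
  then show ?thesis unfolding monomials_def by blast
qed

lemma X_in_monomials: "pX p \<in> monomials"
  unfolding monomials_def
  by (rule CollectI, rule exI[of _ 1], rule exI[of _ 0], rule exI[of _ 0]) simp

lemma Y_in_monomials: "pY p \<in> monomials"
  unfolding monomials_def
  by (rule CollectI, rule exI[of _ 0], rule exI[of _ 1], rule exI[of _ 0]) simp

lemma Z_in_monomials: "pZ p \<in> monomials"
  unfolding monomials_def
  by (rule CollectI, rule exI[of _ 0], rule exI[of _ 0], rule exI[of _ 1]) simp

lemma monomials_dvd_1: "c \<in> monomials \<Longrightarrow> c dvd 1"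
  unfolding monomials_def
  by (auto intro!: mult_dvd_1 upow_dvd_1 X_dvd_1 Y_dvd_1 Z_dvd_1)

lemma lam_in_monomials: "lam p d e \<in> monomials"
  unfolding monomials_def lam_def by (auto split: prod.splits)

text \<open>The three exponents in \<open>lam\<close> are bilinear in the degrees, so adding degrees
  multiplies the scalars.\<close>

lemma lam_add_left: "lam p (d + d') e = lam p d e * lam p d' e"
proof -
  have "fst (d + d') * fst e = fst d * fst e + fst d' * fst e"
    "snd (d + d') * snd e = snd d * snd e + snd d' * snd e"
    "fst (d + d') * snd e - fst e * snd (d + d')
      = (fst d * snd e - fst e * snd d) + (fst d' * snd e - fst e * snd d')"
    by (simp_all add: algebra_simps)
  then show ?thesis
    by (simp add: lam_def split_beta upow_add X_dvd_1 Y_dvd_1 Z_dvd_1 mult_ac)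
qed

lemma lam_add_right: "lam p e (d + d') = lam p e d * lam p e d'"
proof -
  have "fst e * fst (d + d') = fst e * fst d + fst e * fst d'"
    "snd e * snd (d + d') = snd e * snd d + snd e * snd d'"
    "fst e * snd (d + d') - fst (d + d') * snd e
      = (fst e * snd d - fst d * snd e) + (fst e * snd d' - fst d' * snd e)"
    by (simp_all add: algebra_simps)
  then show ?thesis
    by (simp add: lam_def split_beta upow_add X_dvd_1 Y_dvd_1 Z_dvd_1 mult_ac)
qed

end

lemma lam_zero_left [simp]: "lam p (0, 0) e = 1" and lam_zero_right [simp]: "lam p e (0, 0) = 1"
  by (simp_all add: lam_def split_beta)

section \<open>Words, tubes and sums over basis tensors\<close>

lemma cdeg_Nil [simp]: "cdeg [] = (0, 0)"
  and cdeg_Cons [simp]: "cdeg ((a, g, b) # w) = gdeg g + cdeg w"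
  and cdeg_append [simp]: "cdeg (w @ w') = cdeg w + cdeg w'"
  by (simp_all add: cdeg_def zero_prod_def)

lemma tdeg_Nil [simp]: "tdeg [] = (0, 0)"
  and tdeg_Cons [simp]: "tdeg (x # s) = vdeg x + tdeg s"
  and tdeg_append [simp]: "tdeg (s @ s') = tdeg s + tdeg s'"
  by (simp_all add: tdeg_def zero_prod_def)

lemma tubes_Nil [simp]: "tubes a [] b = []"
  and tubes_Cons [simp]: "tubes a ((a', g, b') # w) b = (a + a', g, b' + b) # tubes a w b"
  and tubes_append [simp]: "tubes a (w @ w') b = tubes a w b @ tubes a w' b"
  by (simp_all add: tubes_def)

lemma cdeg_tubes [simp]: "cdeg (tubes a w b) = cdeg w"
  by (induction w) auto

lemma cob_append: "cob (w @ w') m n \<longleftrightarrow> (\<exists>k. cob w m k \<and> cob w' k n)"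
  by (induction w arbitrary: m) auto

lemma cob_tubes: "cob w m n \<Longrightarrow> cob (tubes a w b) (a + m + b) (a + n + b)"
proof (induction w arbitrary: m)
  case (Cons l w)
  obtain a' g b' where l: "l = (a', g, b')" by (cases l)
  show ?case using Cons.IH[of "a' + gout g + b'"] Cons.prems by (simp add: l add.assoc)
qed simp

lemma finite_lists_length: "finite {s :: vgen list. length s = n}"
proof -
  have "finite (UNIV :: vgen set)"
    by (rule finite_subset[of _ "{Vp, Vm}"]) (use vgen.exhaust in auto)
  then show ?thesis using finite_lists_length_eq[of "UNIV :: vgen set" n] by simp
qed

text \<open>Unrolls the sums in \<open>Flayer\<close> into explicit terms, so that a layer on
  boundedly many circles can be evaluated by rewriting.\<close>

lemma sum_lists_length_Suc:
  "(\<Sum>s | length (s :: vgen list) = Suc n. f s)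
    = (\<Sum>s | length s = n. f (Vp # s)) + (\<Sum>s | length s = n. f (Vm # s))"
proof -
  have "{s :: vgen list. length s = Suc n}
      = (#) Vp ` {s. length s = n} \<union> (#) Vm ` {s. length s = n}"
    by (auto simp: length_Suc_conv image_iff) (metis vgen.exhaust)
  moreover have "(#) Vp ` {s. length s = n} \<inter> (#) Vm ` {s. length s = n} = {}" by auto
  ultimately show ?thesis
    by (simp add: sum.union_disjoint finite_lists_length sum.reindex inj_on_def)
qed

lemma Flayer_append:
  assumes "length x = a" "length y = gout g" "length z = b"
  shows "Flayer p (a, g, b) v (x @ y @ z)
    = (\<Sum>s | length s = gin g. lam p (gdeg g) (tdeg x) * Fgen p g s y * v (x @ s @ z))"
  using assms by (simp add: Flayer_def)

lemma Flayer_sum: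
  "Flayer p l (\<lambda>x. \<Sum>i\<in>I. c i * V i x) t = (\<Sum>i\<in>I. c i * Flayer p l (V i) t)"
proof -
  obtain a g b where l: "l = (a, g, b)" by (cases l)
  show ?thesis unfolding l Flayer_def
    by (auto simp: sum_distrib_left mult_ac intro!: sum.swap)
qed

lemma Fword_Nil [simp]: "Fword p [] v = v"
  and Fword_Cons: "Fword p (l # w) v = Fword p w (Flayer p l v)"
  and Fword_append: "Fword p (w @ w') v = Fword p w' (Fword p w v)"
  by (simp_all add: Fword_def)

lemma Fword_sum:
  "Fword p w (\<lambda>x. \<Sum>i\<in>I. c i * V i x) t = (\<Sum>i\<in>I. c i * Fword p w (V i) t)"
proof (induction w arbitrary: V)
  case (Cons l w)
  have "Flayer p l (\<lambda>x. \<Sum>i\<in>I. c i * V i x) = (\<lambda>t. \<Sum>i\<in>I. c i * Flayer p l (V i) t)"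
    by (rule ext) (rule Flayer_sum)
  then show ?case by (simp add: Fword_Cons Cons)
qed simp

lemma Fword_scale: "Fword p w (\<lambda>x. c * v x) = (\<lambda>t. c * Fword p w v t)"
  using Fword_sum[where I = "{()}" and c = "\<lambda>_. c" and V = "\<lambda>_. v"] by fastforce

lemma Fword_add: "Fword p w (\<lambda>x. v x + v' x) = (\<lambda>t. Fword p w v t + Fword p w v' t)"
  using Fword_sum[where I = "UNIV :: bool set" and c = "\<lambda>_. 1" and V = "\<lambda>i. if i then v else v'"]
  by (fastforce simp: UNIV_bool add.commute)

lemma Flayer_tpow: "Flayer p (a, g, b) v \<in> tpow (a + gout g + b)"
  by (simp add: tpow_def Flayer_def)

lemma Fword_tpow: "cob w m n \<Longrightarrow> v \<in> tpow m \<Longrightarrow> Fword p w v \<in> tpow n"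
proof (induction w arbitrary: m v)
  case (Cons l w)
  then show ?case by (cases l) (auto simp: Fword_Cons Flayer_tpow)
qed simp

text \<open>Only the first layer reads the tensor, and it does so at lists of length
  \<open>m\<close>; the length of \<open>t\<close> matters when the word is empty.\<close>

lemma Fword_cong:
  assumes "cob w m n" "length t = n" "\<And>s. length s = m \<Longrightarrow> v s = v' s"
  shows "Fword p w v t = Fword p w v' t"
proof (cases w)
  case Nil
  then show ?thesis using assms by simp
next
  case (Cons l w')
  obtain a g b where l: "l = (a, g, b)" by (cases l)
  have "Flayer p l v = Flayer p l v'"
    using assms(1,3) by (intro ext) (auto simp: Cons l Flayer_def intro!: sum.cong)
  then show ?thesis by (simp add: Cons Fword_Cons)
qed

section \<open>Tubes, degrees and the exchange law\<close>

context chron_params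
begin

text \<open>A layer passing the fixed left part \<open>x\<close> contributes \<lambda>(deg g, deg
  x), and by bimultiplicativity these scalars multiply up to the one for the total degree of
  \<open>w\<close>. The right part \<open>z\<close> is never passed and contributes nothing.\<close>

lemma Fword_tubes:
  assumes "cob w m n" "length x = a" "length y = n" "length z = b"
  shows "Fword p (tubes a w b) v (x @ y @ z)
    = lam p (cdeg w) (tdeg x) * Fword p w (\<lambda>s. v (x @ s @ z)) y"
  using assms(1)
proof (induction w arbitrary: m v)
  case (Cons l w)
  obtain a' g b' where l: "l = (a', g, b')" by (cases l)
  have *: "(\<lambda>s. Flayer p (a + a', g, b' + b) v (x @ s @ z))
      = (\<lambda>s. lam p (gdeg g) (tdeg x) * Flayer p (a', g, b') (\<lambda>s. v (x @ s @ z)) s)"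
    using assms(2,4)
    by (intro ext) (auto simp: Flayer_def lam_add_right sum_distrib_left mult_ac intro!: sum.cong)
  have "cob w (a' + gout g + b') n" using Cons.prems by (simp add: l)
  from Cons.IH[OF this, of "Flayer p (a + a', g, b' + b) v"]
  show ?case unfolding * by (simp add: l Fword_Cons Fword_scale lam_add_left mult_ac)
qed simp

text \<open>Homogeneity of the generators; this is what lets a scalar \<lambda>(d, -) be moved from
  outputs to inputs.\<close>

lemma Fgen_tdeg: "Fgen p g s t \<noteq> 0 \<Longrightarrow> tdeg t = gdeg g + tdeg s"
  by (induction p g s rule: Fgen.induct) (auto simp: basis_def zero_prod_def split: if_splits)

text \<open>Terms with a vanishing entry of the generator vanish on both sides; in the remaining
  ones homogeneity relates the degree of the output to that of the input.\<close>

lemma Flayer_degree: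
  "lam p d (tdeg t) * Flayer p (a, g, b) v t
    = lam p d (gdeg g) * Flayer p (a, g, b) (\<lambda>s. lam p d (tdeg s) * v s) t"
proof (cases "length t = a + gout g + b")
  case True
  define x y z where "x = take a t" and "y = take (gout g) (drop a t)" and "z = drop (a + gout g) t"
  have t: "t = x @ y @ z" unfolding x_def y_def z_def
    by (metis append_take_drop_id drop_drop add.commute)
  have len: "length x = a" "length y = gout g" "length z = b"
    using True by (auto simp: x_def y_def z_def)
  have "lam p d (tdeg t) * (lam p (gdeg g) (tdeg x) * Fgen p g s y * v (x @ s @ z))
      = lam p d (gdeg g) * (lam p (gdeg g) (tdeg x) * Fgen p g s y
          * (lam p d (tdeg (x @ s @ z)) * v (x @ s @ z)))" for s
  proof (cases "Fgen p g s y = 0")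
    case False
    then show ?thesis using Fgen_tdeg[OF False] by (simp add: t lam_add_right mult_ac)
  qed simp
  then show ?thesis unfolding t Flayer_append[OF len] sum_distrib_left by (simp add: t)
qed (simp add: Flayer_def)

lemma Fword_degree:
  "lam p d (tdeg t) * Fword p w v t
    = lam p d (cdeg w) * Fword p w (\<lambda>s. lam p d (tdeg s) * v s) t"
proof (induction w arbitrary: v)
  case (Cons l w)
  obtain a g b where l: "l = (a, g, b)" by (cases l)
  have "(\<lambda>s. lam p d (tdeg s) * Flayer p l v s)
      = (\<lambda>s. lam p d (gdeg g) * Flayer p l (\<lambda>s. lam p d (tdeg s) * v s) s)"
    by (rule ext) (simp only: l Flayer_degree)
  then show ?case by (simp add: Fword_Cons Cons Fword_scale) (simp add: l lam_add_right mult_ac)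
qed simp

end

text \<open>Operators on separate variables of \<open>V\<close> commute with no scalar, by linearity
  alone; the scalar of a disjoint union enters through \<open>Fword_degree\<close>.\<close>

lemma Fword_exchange:
  "Fword p w (\<lambda>s. Fword p w' (\<lambda>s'. V s' s) t') t = Fword p w' (\<lambda>s'. Fword p w (\<lambda>s. V s' s) t) t'"
proof (induction w' arbitrary: V)
  case (Cons l w')
  obtain a g b where l: "l = (a, g, b)" by (cases l)
  have "Fword p w (\<lambda>s. Flayer p l (\<lambda>s''. V s'' s) s') t
      = Flayer p l (\<lambda>s''. Fword p w (\<lambda>s. V s'' s) t) s'" for s'
  proof (cases "length s' = a + gout g + b")
    case True
    then show ?thesis by (simp add: l Flayer_def Fword_sum)
  next
    case False
    \<comment> \<open>A word maps the zero tensor to zero, seen by scaling with 0.\<close>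
    then show ?thesis using Fword_scale[of p w 0 "\<lambda>_. 0"] by (simp add: l Flayer_def)
  qed
  then show ?case by (simp add: Fword_Cons Cons)
qed simp

section \<open>The functor respects the chronological relations\<close>

context chron_params
begin

text \<open>Acting after \<open>w'\<close>, the word \<open>w\<close> passes letters of the degree
  of \<open>y'\<close>; acting before it, \<open>w\<close> passes the inputs \<open>s'\<close>.
  These degrees differ by \<open>cdeg w'\<close>, and the quotient of the two scalars is
  \<lambda>(deg w, deg w').\<close>

lemma Fword_disjoint:
  assumes w: "cob w m n" and w': "cob w' m' n'" and "length t = n' + n"
  shows "Fword p (tubes 0 w' m @ tubes n' w 0) v t
    = lam p (cdeg w) (cdeg w') * Fword p (tubes m' w 0 @ tubes 0 w' n) v t"
proof -
  define y' y where "y' = take n' t" and "y = drop n' t"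
  have t: "t = y' @ y" and len: "length y' = n'" "length y = n"
    using assms(3) by (auto simp: y'_def y_def)
  have in_w': "Fword p (tubes 0 w' m) v (y' @ s) = Fword p w' (\<lambda>s'. v (s' @ s)) y'" if "length s = m" for s
    using Fword_tubes[OF w', of "[]" 0 y' s m v] that len by simp
  have in_w: "Fword p (tubes m' w 0) v (s' @ y) = lam p (cdeg w) (tdeg s') * Fword p w (\<lambda>s. v (s' @ s)) y"
    if "length s' = m'" for s'
    using Fword_tubes[OF w, of s' m' y "[]" 0 v] that len by simp
  have "Fword p (tubes 0 w' m @ tubes n' w 0) v t
      = lam p (cdeg w) (tdeg y') * Fword p w (\<lambda>s. Fword p (tubes 0 w' m) v (y' @ s)) y"
    using Fword_tubes[OF w, of y' n' y "[]" 0] len by (simp add: Fword_append t)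
  also have "Fword p w (\<lambda>s. Fword p (tubes 0 w' m) v (y' @ s)) y
      = Fword p w (\<lambda>s. Fword p w' (\<lambda>s'. v (s' @ s)) y') y"
    by (rule Fword_cong[OF w]) (use len in_w' in auto)
  also have "\<dots> = Fword p w' (\<lambda>s'. Fword p w (\<lambda>s. v (s' @ s)) y) y'"
    by (rule Fword_exchange)
  also have "lam p (cdeg w) (tdeg y') * \<dots> = lam p (cdeg w) (cdeg w') *
      Fword p w' (\<lambda>s'. lam p (cdeg w) (tdeg s') * Fword p w (\<lambda>s. v (s' @ s)) y) y'"
    by (rule Fword_degree)
  also have "Fword p w' (\<lambda>s'. lam p (cdeg w) (tdeg s') * Fword p w (\<lambda>s. v (s' @ s)) y) y'
      = Fword p w' (\<lambda>s'. Fword p (tubes m' w 0) v (s' @ y)) y'"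
    by (rule Fword_cong[OF w']) (use len in_w in auto)
  also have "\<dots> = Fword p (tubes m' w 0 @ tubes 0 w' n) v t"
    using Fword_tubes[OF w', of "[]" 0 y' y n] len by (simp add: Fword_append t)
  finally show ?thesis .
qed

text \<open>Equality of the degrees is what makes the relations stable under tubes on the left: both
  sides acquire the same \<lambda> factor.\<close>

lemma chron_rel_cob: "chron_rel p k l w c w' \<Longrightarrow> cob w k l \<and> cob w' k l \<and> cdeg w = cdeg w'"
proof (induction rule: chron_rel.induct)
  case (twist_natural g)
  then show ?case by (cases g) (auto simp: last_to_front_def eval_nat_numeral)
next
  case (disjoint w m n w' m' n')
  have 1: "cob (tubes a w 0) (a + m) (a + n)" for a
    using cob_tubes[OF disjoint(1), of a 0] by simp
  have 2: "cob (tubes 0 w' b) (m' + b) (n' + b)" for b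
    using cob_tubes[OF disjoint(2), of 0 b] by simp
  have "cob (tubes 0 w' m @ tubes n' w 0) (m' + m) (n' + n)"
    "cob (tubes m' w 0 @ tubes 0 w' n) (m' + m) (n' + n)"
    unfolding cob_append using 1 2 by blast+
  then show ?case by (simp add: add.commute)
qed auto

text \<open>The values of \<lambda> needed for generators and letters. The inverse of Z is a
  variable \<open>zi\<close> with a defining equation, so that the table rewrites over any
  commutative ring.\<close>

lemma lam_generators:
  assumes "pZ p * zi = 1"
  shows "lam p (1, 0) (1, 0) = pX p" "lam p (0, 1) (0, 1) = pY p"
    "lam p (0, - 1) (0, - 1) = pY p" "lam p (- 1, 0) (1, 0) = pX p" "lam p (0, - 1) (0, 1) = pY p"
    "lam p (0, 1) (0, - 1) = pY p" "lam p (1, 0) (- 1, 0) = pX p"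
    "lam p (1, 0) (0, 1) = pZ p" "lam p (0, 1) (1, 0) = zi"
    "lam p (1, 0) (0, - 1) = zi" "lam p (0, - 1) (1, 0) = pZ p"
    "lam p (- 1, 0) (0, - 1) = pZ p"
  by (simp_all add: lam_def upow_involution[OF X_square] upow_involution[OF Y_square]
      upow_minus_1[OF assms])

text \<open>All relations except the disjoint one involve at most three circles, so they are checked
  coefficient by coefficient on all outputs.\<close>

lemma chron_rel_sound:
  assumes "chron_rel p k l w c w'" "length t = l"
  shows "Fword p w v t = c * Fword p w' v t"
proof -
  obtain z where z: "pZ p * z = 1" using Z_dvd_1 by (metis dvdE)
  \<comment> \<open>The dummy argument makes \<open>mult_ac\<close> sort \<open>zi p\<close> right behind \<open>pZ p\<close>.\<close>
  define zi where "zi = (\<lambda>_ :: 'k params. z)"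
  have zi: "pZ p * zi p = 1" by (simp add: zi_def z)
  have XX: "pX p * (pX p * a) = a" and YY: "pY p * (pY p * a) = a" and ZZ: "pZ p * (zi p * a) = a" for a
    using X_square Y_square zi by (simp_all add: mult.assoc[symmetric])
  have all_lists: "(\<forall>t. length (t :: vgen list) = Suc n \<longrightarrow> Q t) \<longleftrightarrow>
      (\<forall>t. length t = n \<longrightarrow> Q (Vp # t)) \<and> (\<forall>t. length t = n \<longrightarrow> Q (Vm # t))" for n Q
    by (auto simp: length_Suc_conv) (metis vgen.exhaust)
  note compute = Fword_def Flayer_def sum_lists_length_Suc eval_nat_numeral basis_def lam_generators[OF zi]
    all_lists X_square Y_square zi XX YY ZZ last_to_front_def
  have "\<forall>t. length t = l \<longrightarrow> Fword p w v t = c * Fword p w' v t" using assms(1)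
  proof (induction rule: chron_rel.induct)
    case twist_twist
    show ?case by (simp add: compute mult_ac distrib_left)
  next
    case twist_braid
    show ?case by (simp add: compute mult_ac distrib_left)
  next
    case (twist_natural g)
    show ?case by (cases g; simp add: compute mult_ac distrib_left)
  next
    case mu_twist
    show ?case by (simp add: compute mult_ac distrib_left)
  next
    case twist_delta
    show ?case by (simp add: compute mult_ac distrib_left)
  next
    case death
    show ?case by (simp add: compute mult_ac distrib_left)
  next
    case unit
    show ?case by (simp add: compute mult_ac distrib_left)
  next
    case counit_right
    show ?case by (simp add: compute mult_ac distrib_left)
  next
    case counit_left
    show ?case by (simp add: compute mult_ac distrib_left)
  next
    case mu_assoc
    show ?case by (simp add: compute mult_ac distrib_left)
  next
    case delta_coassoc
    show ?case by (simp add: compute mult_ac distrib_left)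
  next
    case frobenius_left
    show ?case by (simp add: compute mult_ac distrib_left)
  next
    case frobenius_right
    show ?case by (simp add: compute mult_ac distrib_left)
  next
    case (disjoint w m n w' m' n')
    then show ?case using Fword_disjoint by blast
  qed
  then show ?thesis using assms(2) by blast
qed

end

section \<open>Values of the functor on cosets\<close>

lemma Fcomb_superset:
  assumes "finite S" "Poly_Mapping.keys f \<subseteq> S"
  shows "Fcomb p f v t = (\<Sum>w\<in>S. Poly_Mapping.lookup f w * Fword p w v t)"
  unfolding Fcomb_def using assms
  by (intro sum.mono_neutral_left) (auto simp: in_keys_iff)

lemma Fcomb_add: "Fcomb p (f + g) v t = Fcomb p f v t + Fcomb p g v t"
proof -
  let ?S = "Poly_Mapping.keys f \<union> Poly_Mapping.keys g"
  have "Fcomb p h v t = (\<Sum>w\<in>?S. Poly_Mapping.lookup h w * Fword p w v t)"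
    if "Poly_Mapping.keys h \<subseteq> ?S" for h
    using that by (intro Fcomb_superset) auto
  then show ?thesis
    using Poly_Mapping.keys_add[of f g] by (simp add: lookup_add distrib_right sum.distrib)
qed

lemma Fcomb_single: "Fcomb p (Poly_Mapping.single w c) v t = c * Fword p w v t"
  using Fcomb_superset[of "{w}" "Poly_Mapping.single w c"] by simp

lemma Fcomb_diff: "Fcomb p (f - g) v t = Fcomb p f v t - Fcomb p g v t"
  using Fcomb_add[of p "f - g" g v t] by simp

context chron_params
begin

text \<open>Inside tubes both sides get the factor \<lambda>(deg w, deg x), the same because the
  degrees agree; composition with \<open>u\<close> and \<open>u'\<close> is handled by
  linearity.\<close>

lemma chron_rel_context:
  assumes rel: "chron_rel p k l w c w'" and u: "cob u m (a + k + b)" and u': "cob u' (a + l + b) n"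
    and v: "v \<in> tpow m"
  shows "Fword p (u @ tubes a w b @ u') v t = c * Fword p (u @ tubes a w' b @ u') v t"
proof -
  have cob: "cob w k l" "cob w' k l" "cdeg w = cdeg w'" using chron_rel_cob[OF rel] by auto
  define V where "V = Fword p u v"
  have V: "V \<in> tpow (a + k + b)" using Fword_tpow[OF u v] by (simp add: V_def)
  have out: "Fword p (tubes a w b) V \<in> tpow (a + l + b)" "Fword p (tubes a w' b) V \<in> tpow (a + l + b)"
    using V cob by (auto intro!: Fword_tpow cob_tubes)
  have "Fword p (tubes a w b) V s = c * Fword p (tubes a w' b) V s" for s
  proof (cases "length s = a + l + b")
    case True
    define x y z where "x = take a s" and "y = take l (drop a s)" and "z = drop (a + l) s"
    have s: "s = x @ y @ z" unfolding x_def y_def z_def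
      by (metis append_take_drop_id drop_drop add.commute)
    have len: "length x = a" "length y = l" "length z = b"
      using True by (auto simp: x_def y_def z_def)
    show ?thesis unfolding s Fword_tubes[OF cob(1) len] Fword_tubes[OF cob(2) len]
      using chron_rel_sound[OF rel len(2)] cob(3) by (simp add: mult_ac)
  next
    case False
    then show ?thesis using out by (simp add: tpow_def)
  qed
  then have "Fword p (tubes a w b) V = (\<lambda>s. c * Fword p (tubes a w' b) V s)" by blast
  then show ?thesis by (simp add: Fword_append V_def[symmetric] Fword_scale)
qed

lemma Fcomb_null_combs: "f \<in> null_combs p m n \<Longrightarrow> v \<in> tpow m \<Longrightarrow> Fcomb p f v t = 0"
proof (induction rule: null_combs.induct)
  case zero
  then show ?case by (simp add: Fcomb_def)
next
  case (step f k l w c w' u a b u' r)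
  then show ?case
    using chron_rel_context[OF step(2,3,4,6), of t]
    by (simp add: Fcomb_add Fcomb_diff Fcomb_single mult_ac)
qed

lemma Fcomb_mor: "f \<in> mor p m n c w \<Longrightarrow> v \<in> tpow m \<Longrightarrow> Fcomb p f v = (\<lambda>t. c * Fword p w v t)"
  using Fcomb_null_combs[of "f - Poly_Mapping.single w c" m n v]
  by (auto simp: mor_def Fcomb_diff Fcomb_single)

lemma single_in_mor: "cob w m n \<Longrightarrow> Poly_Mapping.single w c \<in> mor p m n c w"
  by (auto simp: mor_def null_combs.zero)

text \<open>All representatives of the coset take the same value, so \<open>the_elem\<close> is
  applied to a singleton; \<open>cob\<close> provides a representative.\<close>

lemma Fmor_mor:
  assumes "cob w m n" "v \<in> tpow m"
  shows "Fmor p (mor p m n c w) v = (\<lambda>t. c * Fword p w v t)"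
proof -
  have "(\<lambda>f. Fcomb p f v) ` mor p m n c w = {\<lambda>t. c * Fword p w v t}"
    using Fcomb_mor[OF _ assms(2), of _ n c w] single_in_mor[OF assms(1), of c] by force
  then show ?thesis by (simp add: Fmor_def)
qed

text \<open>The representative used is \<open>0\<close>, which also covers the empty word between
  different numbers of circles in the zero entries of the differential.\<close>

lemma Fmor_zero: "v \<in> tpow m \<Longrightarrow> Fmor p (mor p m n 0 w) v = (\<lambda>t. 0)"
proof -
  assume v: "v \<in> tpow m"
  have "0 \<in> mor p m n 0 w" by (simp add: mor_def null_combs.zero)
  then have "(\<lambda>f. Fcomb p f v) ` mor p m n 0 w = {\<lambda>t. 0}"
    using Fcomb_mor[OF _ v, of _ n 0 w] by force
  then show ?thesis by (simp add: Fmor_def)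
qed

text \<open>Equal cosets share the representative \<open>Poly_Mapping.single w c\<close>, at which
  the functor is evaluated in two ways.\<close>

lemma mor_eq_Fword:
  assumes "mor p m n c w = mor p m n c' w'" "cob w m n" "v \<in> tpow m"
  shows "c * Fword p w v t = c' * Fword p w' v t"
proof -
  have "Poly_Mapping.single w c \<in> mor p m n c w" "Poly_Mapping.single w c \<in> mor p m n c' w'"
    using single_in_mor[OF assms(2), of c] assms(1) by auto
  from Fcomb_mor[OF this(1) assms(3)] Fcomb_mor[OF this(2) assms(3)] show ?thesis by metis
qed

end

section \<open>Rescaling the parameters\<close>

lemma involution_power: "c * c = (1 :: 'k::comm_ring_1) \<Longrightarrow> c ^ n * c ^ n = 1"
  by (metis power_mult_distrib power_one)

lemma involution_power_left: "c * c = (1 :: 'k::comm_ring_1) \<Longrightarrow> c ^ n * (c ^ n * a) = a"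
  by (simp add: involution_power mult.assoc[symmetric])

fun rescale :: "'k::comm_ring_1 \<Rightarrow> vgen list \<Rightarrow> 'k" where
  "rescale r [] = 1"
| "rescale r (Vp # s) = rescale r s"
| "rescale r (Vm # s) = r ^ length s * rescale r s"

text \<open>The middle factor counts the pairs with left letter in \<open>x\<close> and right letter
  in \<open>y\<close>.\<close>

lemma rescale_append:
  "rescale r (x @ y) = rescale r x * (r ^ length y) ^ count_list x Vm * rescale r y"
  by (induction r x rule: rescale.induct) (simp_all add: power_add mult_ac)

lemma rescale_square: "r * r = 1 \<Longrightarrow> rescale r s * rescale r s = 1"
proof (induction r s rule: rescale.induct)
  case (3 r s)
  have "rescale r (Vm # s) * rescale r (Vm # s)
      = (r ^ length s * r ^ length s) * (rescale r s * rescale r s)"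
    by (simp add: mult_ac)
  then show ?case using 3 by (simp add: involution_power)
qed auto

text \<open>The ratio between the two functors on one layer. Passing \<open>a\<close> circles, a
  merge gives t^a and a split u^a, in both cases times r per v_- passed, which offsets the change in
  the number of letters to its right. For a split the new pairs, together with the twisted Y Z, give
  r^(b + 1). Births and deaths get a default value and are excluded by
  \<open>saddle_word\<close>.\<close>

fun layer_scalar :: "'k::comm_ring_1 \<Rightarrow> 'k \<Rightarrow> nat \<times> gen \<times> nat \<Rightarrow> 'k" where
  "layer_scalar t u (a, Mu, b) = t ^ a"
| "layer_scalar t u (a, Delta, b) = u ^ a * (t * u) ^ Suc b"
| "layer_scalar t u (a, Twist, b) = t"
| "layer_scalar t u (a, g, b) = 1"

definition word_scalar :: "'k::comm_ring_1 \<Rightarrow> 'k \<Rightarrow> word \<Rightarrow> 'k" where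
  "word_scalar t u w = prod_list (map (layer_scalar t u) w)"

lemma word_scalar_Nil [simp]: "word_scalar t u [] = 1"
  and word_scalar_Cons [simp]: "word_scalar t u (l # w) = layer_scalar t u l * word_scalar t u w"
  and word_scalar_append [simp]: "word_scalar t u (w @ w') = word_scalar t u w * word_scalar t u w'"
  by (simp_all add: word_scalar_def)

definition saddle_word :: "word \<Rightarrow> bool" where
  "saddle_word w \<longleftrightarrow> (\<forall>(a, g, b) \<in> set w. g \<in> {Mu, Delta, Twist})"

text \<open>Besides the parameters coming from the automorphism, the locale is instantiated over the
  integers with t = -1 and u = 1.\<close>

locale twisted_params = chron_params p for p :: "'k::comm_ring_1 params" +
  fixes p' :: "'k params" and t u :: 'k
  assumes t_square: "t * t = 1" and u_square: "u * u = 1"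
    and twist_X: "pX p' = t * pX p" and twist_Y: "pY p' = t * pY p" and twist_Z: "pZ p' = u * pZ p"
begin

lemma chron_params_twist: "chron_params p'"
proof
  have "pX p' * pX p' = (t * t) * (pX p * pX p)" "pY p' * pY p' = (t * t) * (pY p * pY p)"
    by (simp_all add: twist_X twist_Y mult_ac)
  then show "pX p' * pX p' = 1" "pY p' * pY p' = 1"
    by (simp_all add: t_square X_square Y_square)
  show "pZ p' dvd 1" using u_square Z_dvd_1 by (simp add: twist_Z mult_dvd_1 dvdI[of 1 u u])
qed

sublocale twist: chron_params p'
  by (rule chron_params_twist)

abbreviation r :: 'k where "r \<equiv> t * u"

lemma r_square: "r * r = 1"
proof -
  have "r * r = (t * t) * (u * u)" by (simp only: mult_ac)
  then show ?thesis by (simp add: t_square u_square)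
qed

lemma layer_scalar_square: "layer_scalar t u l * layer_scalar t u l = 1"
proof -
  obtain a g b where "l = (a, g, b)" by (cases l)
  then show ?thesis
    using involution_power[OF t_square] involution_power[OF u_square] involution_power[OF r_square, of "Suc b"]
    by (cases g) (simp_all add: t_square mult_ac involution_power_left[OF u_square] del: power_Suc)
qed

lemma word_scalar_square: "word_scalar t u w * word_scalar t u w = 1"
proof (induction w)
  case (Cons l w)
  have "word_scalar t u (l # w) * word_scalar t u (l # w)
      = (layer_scalar t u l * layer_scalar t u l) * (word_scalar t u w * word_scalar t u w)"
    by (simp add: mult_ac)
  then show ?case by (simp add: Cons layer_scalar_square)
qed simp

text \<open>A merge removes and a split adds one letter to the right of every v_- in
  \<open>x\<close>, and the twisted \<lambda> supplies exactly these powers of r. The part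
  \<open>z\<close> enters only through its length, so what remains is a finite check on the letters
  at \<open>g\<close>.\<close>

lemma Flayer_rescale:
  assumes "g \<in> {Mu, Delta, Twist}"
  shows "rescale r s' * Flayer p (a, g, b) v s'
    = layer_scalar t u (a, g, b) * Flayer p' (a, g, b) (\<lambda>s. rescale r s * v s) s'"
proof (cases "length s' = a + gout g + b")
  case True
  obtain z where z: "pZ p * z = 1" using Z_dvd_1 by (metis dvdE)
  define zi where "zi = (\<lambda>_ :: 'k params. z)"
  have zi: "pZ p * zi p = 1" by (simp add: zi_def z)
  have "pZ p' * (u * zi p) = (u * u) * (pZ p * zi p)" by (simp add: twist_Z mult_ac)
  then have zi': "pZ p' * (u * zi p) = 1" by (simp add: zi u_square)
  have inv: "t * (t * c) = c" "u * (u * c) = c" "pX p * (pX p * c) = c" "pY p * (pY p * c) = c"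
    "pZ p * (zi p * c) = c" for c
    by (simp_all add: mult.assoc[symmetric] t_square u_square zi X_square Y_square)
  have inv_power: "t ^ n * t ^ n = 1" "u ^ n * u ^ n = 1"
    "t ^ n * (t ^ n * c) = c" "u ^ n * (u ^ n * c) = c" for n c
    by (simp_all add: involution_power involution_power_left t_square u_square)
  note gens = lam_generators[OF zi] twist.lam_generators[OF zi'] twist_X twist_Y twist_Z
  \<comment> \<open>Passing v_+ costs a merge the inverse of X and passing v_- costs it Z, so the
    twist contributes t and u = t r. For a split the costs are Z and Y, with contributions u and t =
    u r.\<close>
  have lam_Mu: "lam p' (- 1, 0) (tdeg x) = t ^ length x * r ^ count_list x Vm * lam p (- 1, 0) (tdeg x)"
    and lam_Delta: "lam p' (0, - 1) (tdeg x) = u ^ length x * r ^ count_list x Vm * lam p (0, - 1) (tdeg x)"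
    for x
    by (induction r x rule: rescale.induct)
      (simp_all add: lam_add_right twist.lam_add_right gens power_mult_distrib inv mult_ac)
  define x y z where "x = take a s'" and "y = take (gout g) (drop a s')" and "z = drop (a + gout g) s'"
  have s': "s' = x @ y @ z" unfolding x_def y_def z_def
    by (metis append_take_drop_id drop_drop add.commute)
  have len: "length x = a" "length y = gout g" "length z = b"
    using True by (auto simp: x_def y_def z_def)
  have scalar: "rescale r (x @ y @ z) * (lam p (gdeg g) (tdeg x) * Fgen p g s y)
      = layer_scalar t u (a, g, b) * (lam p' (gdeg g) (tdeg x) * Fgen p' g s y) * rescale r (x @ s @ z)"
    if len_s: "length s = gin g" for s
  proof -
    consider "g = Mu" | "g = Delta" | "g = Twist" using assms by blast
    then show ?thesis
    proof cases
      case 1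
      obtain s1 s2 where "s = [s1, s2]" using len_s 1 by (auto simp: length_Suc_conv eval_nat_numeral)
      moreover obtain y1 where "y = [y1]" using len(2) 1 by (auto simp: length_Suc_conv eval_nat_numeral)
      ultimately show ?thesis using 1 len
        by (cases s1; cases s2; cases y1)
          (simp_all add: basis_def rescale_append lam_Mu gens power_mult_distrib inv inv_power mult_ac)
    next
      case 2
      obtain s1 where "s = [s1]" using len_s 2 by (auto simp: length_Suc_conv)
      moreover obtain y1 y2 where "y = [y1, y2]" using len(2) 2 by (auto simp: length_Suc_conv eval_nat_numeral)
      ultimately show ?thesis using 2 len
        by (cases s1; cases y1; cases y2)
          (simp_all add: basis_def rescale_append lam_Delta gens power_mult_distrib inv inv_power mult_ac)
    next
      case 3
      obtain s1 s2 where "s = [s1, s2]" using len_s 3 by (auto simp: length_Suc_conv eval_nat_numeral)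
      moreover obtain y1 y2 where "y = [y1, y2]" using len(2) 3 by (auto simp: length_Suc_conv eval_nat_numeral)
      ultimately show ?thesis using 3 len
        by (cases s1; cases s2; cases y1; cases y2)
          (simp_all add: basis_def rescale_append gens power_mult_distrib inv inv_power mult_ac)
    qed
  qed
  show ?thesis unfolding s' Flayer_append[OF len] sum_distrib_left
  proof (rule sum.cong[OF refl])
    fix s :: "vgen list" assume "s \<in> {s. length s = gin g}"
    then show "rescale r (x @ y @ z) * (lam p (gdeg g) (tdeg x) * Fgen p g s y * v (x @ s @ z))
        = layer_scalar t u (a, g, b) * (lam p' (gdeg g) (tdeg x) * Fgen p' g s y *
            (rescale r (x @ s @ z) * v (x @ s @ z)))"
      using arg_cong[OF scalar, of s "\<lambda>c. c * v (x @ s @ z)"] by (simp add: mult_ac)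
  qed
qed (simp add: Flayer_def)

lemma Fword_rescale:
  "saddle_word w \<Longrightarrow>
    rescale r s * Fword p w v s = word_scalar t u w * Fword p' w (\<lambda>s. rescale r s * v s) s"
proof (induction w arbitrary: v)
  case (Cons l w)
  obtain a g b where l: "l = (a, g, b)" by (cases l)
  have g: "g \<in> {Mu, Delta, Twist}" and w: "saddle_word w"
    using Cons.prems by (auto simp: saddle_word_def l)
  have "(\<lambda>s. rescale r s * Flayer p l v s)
      = (\<lambda>s. layer_scalar t u l * Flayer p' l (\<lambda>s. rescale r s * v s) s)"
    by (rule ext) (simp only: l Flayer_rescale[OF g])
  then show ?case by (simp add: Fword_Cons Cons.IH[OF w] Fword_scale mult_ac)
qed simp

end

section \<open>Permutations of circles on basis tensors\<close>

lemma last_to_front_Suc: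
  "last_to_front (Suc k) = (k, Twist, 0) # tubes 0 (last_to_front k) 1"
  by (auto simp: last_to_front_def tubes_def)

lemma cob_last_to_front: "cob (last_to_front k) (Suc k) (Suc k)"
proof (induction k)
  case (Suc k)
  then show ?case using cob_tubes[OF Suc, of 0 1] by (simp add: last_to_front_Suc)
qed (simp add: last_to_front_def)

lemma split_at_first:
  assumes "y \<in> set xs"
  obtains us vs where "xs = us @ y # vs" "takeWhile (\<lambda>x. x \<noteq> y) xs = us" "remove1 y xs = us @ vs"
proof -
  obtain us vs where "xs = us @ y # vs" "y \<notin> set us" using assms by (metis split_list_first)
  moreover from this have "takeWhile (\<lambda>x. x \<noteq> y) xs = us" by (auto simp: takeWhile_append)
  ultimately show ?thesis using that by (simp add: remove1_append)
qed

lemma cob_permute: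
  assumes "distinct xs" "distinct ys" "set xs = set ys"
  shows "cob (permute a xs ys) (a + length xs) (a + length ys)"
  using assms
proof (induction ys arbitrary: a xs)
  case (Cons y ys)
  then have "y \<in> set xs" by simp
  then obtain us vs where xs: "xs = us @ y # vs" "takeWhile (\<lambda>x. x \<noteq> y) xs = us" "remove1 y xs = us @ vs"
    by (rule split_at_first)
  have "cob (permute (Suc a) (us @ vs) ys) (Suc a + length (us @ vs)) (Suc a + length ys)"
    using Cons.prems xs(1) by (intro Cons.IH) auto
  moreover have "cob (tubes a (last_to_front (length us)) (length vs))
      (a + Suc (length us) + length vs) (a + Suc (length us) + length vs)"
    by (rule cob_tubes) (rule cob_last_to_front)
  moreover have "length xs = Suc (length us + length vs)" by (simp add: xs(1))
  ultimately have "cob (permute a xs (y # ys)) (a + Suc (length us) + length vs) (Suc a + length ys)"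
    by (auto simp: xs(2,3) cob_append add.assoc)
  then show ?case by (simp add: xs(1) add.assoc)
qed simp

lemma twists_last_to_front: "(a, g, b) \<in> set (last_to_front k) \<Longrightarrow> g = Twist"
  by (auto simp: last_to_front_def)

lemma twists_permute: "(a, g, b) \<in> set (permute c xs ys) \<Longrightarrow> g = Twist"
  by (induction c xs ys rule: permute.induct) (auto simp: tubes_def dest: twists_last_to_front)

lemma word_scalar_twists:
  "(\<And>a g b. (a, g, b) \<in> set w \<Longrightarrow> g = Twist) \<Longrightarrow> word_scalar t u w = t ^ length w"
proof (induction w)
  case (Cons l w)
  obtain a g b where l: "l = (a, g, b)" by (cases l)
  have "g = Twist" using Cons.prems[of a g b] by (simp add: l)
  moreover have "word_scalar t u w = t ^ length w"
    by (rule Cons.IH) (metis Cons.prems list.set_intros(2))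
  ultimately show ?case by (simp add: l)
qed simp

lemma word_scalar_permute: "word_scalar t u (permute c xs ys) = t ^ length (permute c xs ys)"
  by (rule word_scalar_twists) (rule twists_permute)

lemma basis_tpow: "length s = n \<Longrightarrow> basis s \<in> tpow n"
  by (auto simp: basis_def tpow_def)

section \<open>Basis tensors under twists, merges and splits\<close>

context chron_params
begin

lemma Flayer_basis:
  assumes "length x = a" "length s = gin g" "length z = b"
    and "length x' = a" "length y = gout g" "length z' = b"
  shows "Flayer p (a, g, b) (basis (x @ s @ z)) (x' @ y @ z')
    = (if x' = x \<and> z' = z then lam p (gdeg g) (tdeg x) * Fgen p g s y else 0)"
proof -
  have "Flayer p (a, g, b) (basis (x @ s @ z)) (x' @ y @ z') = (\<Sum>s0 | length s0 = gin g.
      if s0 = s then (if x' = x \<and> z' = z then lam p (gdeg g) (tdeg x) * Fgen p g s y else 0) else 0)"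
    unfolding Flayer_append[OF assms(4,5,6)] using assms
    by (intro sum.cong) (auto simp: basis_def)
  then show ?thesis using assms(2) by (simp add: sum.delta' finite_lists_length)
qed

lemma Flayer_basis_eqI:
  assumes "length x = a" "length s = gin g" "length z = b"
    and "v \<in> tpow (a + gout g + b)"
    and "\<And>x' y z'. length x' = a \<Longrightarrow> length y = gout g \<Longrightarrow> length z' = b \<Longrightarrow>
      v (x' @ y @ z') = (if x' = x \<and> z' = z then lam p (gdeg g) (tdeg x) * Fgen p g s y else 0)"
  shows "Flayer p (a, g, b) (basis (x @ s @ z)) = v"
proof
  fix t' :: "vgen list"
  show "Flayer p (a, g, b) (basis (x @ s @ z)) t' = v t'"
  proof (cases "length t' = a + gout g + b")
    case True
    define x' y z' where "x' = take a t'" and "y = take (gout g) (drop a t')" and "z' = drop (a + gout g) t'"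
    have t': "t' = x' @ y @ z'" unfolding x'_def y_def z'_def
      by (metis append_take_drop_id drop_drop add.commute)
    have len: "length x' = a" "length y = gout g" "length z' = b"
      using True by (auto simp: x'_def y_def z'_def)
    show ?thesis unfolding t' Flayer_basis[OF assms(1-3) len] assms(5)[OF len] ..
  next
    case False
    then show ?thesis using assms(4) Flayer_tpow[of p a g b] by (simp add: tpow_def)
  qed
qed

lemma Flayer_Twist_basis:
  assumes "length x = a" "length z = b"
  shows "Flayer p (a, Twist, b) (basis (x @ [c, d] @ z))
    = (\<lambda>t. lam p (vdeg c) (vdeg d) * basis (x @ [d, c] @ z) t)"
proof (rule Flayer_basis_eqI)
  show "(\<lambda>t. lam p (vdeg c) (vdeg d) * basis (x @ [d, c] @ z) t) \<in> tpow (a + gout Twist + b)"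
    using assms by (auto simp: tpow_def basis_def)
qed (use assms in \<open>auto simp: basis_def length_Suc_conv eval_nat_numeral\<close>)

text \<open>The unit is forgotten on purpose: later arguments need only its invertibility and the
  basis tensor that is reached.\<close>

definition basis_to_basis :: "word \<Rightarrow> vgen list \<Rightarrow> vgen list \<Rightarrow> bool" where
  "basis_to_basis w s s' \<longleftrightarrow> (\<exists>c \<in> monomials. Fword p w (basis s) = (\<lambda>t. c * basis s' t))"

lemma basis_to_basis_Nil: "basis_to_basis [] s s"
  unfolding basis_to_basis_def by (rule bexI[OF _ one_in_monomials]) simp

lemma basis_to_basis_append:
  assumes "basis_to_basis w s s'" "basis_to_basis w' s' s''"
  shows "basis_to_basis (w @ w') s s''"
proof -
  obtain c d where "c \<in> monomials" "Fword p w (basis s) = (\<lambda>t. c * basis s' t)"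
    "d \<in> monomials" "Fword p w' (basis s') = (\<lambda>t. d * basis s'' t)"
    using assms by (auto simp: basis_to_basis_def)
  then show ?thesis unfolding basis_to_basis_def
    by (intro bexI[of _ "c * d"] mult_in_monomials) (simp_all add: Fword_append Fword_scale mult.assoc)
qed

lemma basis_to_basis_Cons:
  assumes "Flayer p l (basis s) = (\<lambda>t. c * basis s' t)" "c \<in> monomials" "basis_to_basis w s' s''"
  shows "basis_to_basis (l # w) s s''"
proof -
  have "basis_to_basis [l] s s'" using assms(1,2) by (auto simp: basis_to_basis_def Fword_Cons)
  from basis_to_basis_append[OF this assms(3)] show ?thesis by simp
qed

lemma basis_to_basis_last_to_front:
  assumes "length x = a" "length us = k" "length z = b"
  shows "basis_to_basis (tubes a (last_to_front k) b) (x @ us @ [v] @ z) (x @ [v] @ us @ z)"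
  using assms
proof (induction k arbitrary: us z b)
  case 0
  then show ?case by (simp add: last_to_front_def basis_to_basis_Nil)
next
  case (Suc k)
  obtain us' w where us: "us = us' @ [w]" "length us' = k"
    using Suc.prems(2) by (metis length_Suc_conv_rev)
  have "Flayer p (a + k, Twist, b) (basis ((x @ us') @ [w, v] @ z))
      = (\<lambda>t. lam p (vdeg w) (vdeg v) * basis ((x @ us') @ [v, w] @ z) t)"
    using Suc.prems us by (intro Flayer_Twist_basis) auto
  moreover have "basis_to_basis (tubes a (last_to_front k) (Suc b))
      (x @ us' @ [v] @ (w # z)) (x @ [v] @ us' @ (w # z))"
    using Suc.prems us by (intro Suc.IH) auto
  moreover have "tubes a (last_to_front (Suc k)) b
      = (a + k, Twist, b) # tubes a (last_to_front k) (Suc b)"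
    by (simp add: last_to_front_Suc) (simp add: tubes_def split_beta comp_def)
  ultimately show ?case using lam_in_monomials
    by (simp add: us) (rule basis_to_basis_Cons)
qed

text \<open>Letters are given by a labelling \<open>f\<close> of circles read along an ordering; a
  permutation of circles changes the ordering and keeps the labelling. The prefix \<open>x\<close>
  holds the letters already in place.\<close>

lemma basis_to_basis_permute:
  assumes "distinct xs" "distinct ys" "set xs = set ys" "length x = a"
  shows "basis_to_basis (permute a xs ys) (x @ map f xs) (x @ map f ys)"
  using assms
proof (induction ys arbitrary: a xs x)
  case Nil
  then show ?case by (simp add: basis_to_basis_Nil)
next
  case (Cons y ys)
  then have "y \<in> set xs" by simp
  then obtain us vs where xs: "xs = us @ y # vs" "takeWhile (\<lambda>x. x \<noteq> y) xs = us" "remove1 y xs = us @ vs"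
    by (rule split_at_first)
  have "basis_to_basis (permute (Suc a) (us @ vs) ys) ((x @ [f y]) @ map f (us @ vs)) ((x @ [f y]) @ map f ys)"
    using Cons.prems xs(1) by (intro Cons.IH) auto
  moreover have "basis_to_basis (tubes a (last_to_front (length us)) (length vs))
     (x @ map f us @ [f y] @ map f vs) (x @ [f y] @ map f us @ map f vs)"
    using Cons.prems by (intro basis_to_basis_last_to_front) auto
  ultimately have "basis_to_basis (tubes a (last_to_front (length us)) (length vs) @ permute (Suc a) (us @ vs) ys)
      (x @ map f us @ [f y] @ map f vs) ((x @ [f y]) @ map f ys)"
    by (intro basis_to_basis_append) auto
  then show ?case by (simp add: xs(2,3)) (simp add: xs(1))
qed

text \<open>The pair v_-, v_- is excluded since its product is 0.\<close>

lemma Mu_basis: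
  assumes "(c, d) \<noteq> (Vm, Vm)" "length z = b"
  shows "basis_to_basis [(0, Mu, b)] ([c, d] @ z) ([if c = Vp \<and> d = Vp then Vp else Vm] @ z)"
proof -
  have "Flayer p (0, Mu, b) (basis ([] @ [c, d] @ z))
    = (\<lambda>t. (if c = Vm then pX p * pZ p else 1) * basis ([if c = Vp \<and> d = Vp then Vp else Vm] @ z) t)"
    using assms by (cases c; cases d; intro Flayer_basis_eqI) (auto simp: tpow_def basis_def length_Suc_conv eval_nat_numeral)
  then show ?thesis unfolding basis_to_basis_def
    by (intro bexI[of _ "if c = Vm then pX p * pZ p else 1"])
      (auto simp: Fword_Cons intro: mult_in_monomials X_in_monomials Z_in_monomials one_in_monomials)
qed

lemma Delta_basis_Vm: "length z = b \<Longrightarrow> basis_to_basis [(0, Delta, b)] (Vm # z) ([Vm, Vm] @ z)"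
proof -
  assume "length z = b"
  then have "Flayer p (0, Delta, b) (basis ([] @ [Vm] @ z)) = (\<lambda>t. 1 * basis ([Vm, Vm] @ z) t)"
    by (intro Flayer_basis_eqI) (auto simp: tpow_def basis_def length_Suc_conv eval_nat_numeral)
  then show ?thesis unfolding basis_to_basis_def
    by (intro bexI[OF _ one_in_monomials]) (simp add: Fword_Cons)
qed

lemma Delta_basis_Vp:
  assumes "length z = b"
  shows "Fword p [(0, Delta, b)] (basis (Vp # z))
    = (\<lambda>t. basis ([Vm, Vp] @ z) t + pY p * pZ p * basis ([Vp, Vm] @ z) t)"
proof -
  have "Flayer p (0, Delta, b) (basis ([] @ [Vp] @ z))
      = (\<lambda>t. basis ([Vm, Vp] @ z) t + pY p * pZ p * basis ([Vp, Vm] @ z) t)"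
    using assms by (intro Flayer_basis_eqI) (auto simp: tpow_def basis_def length_Suc_conv eval_nat_numeral)
  then show ?thesis by (simp add: Fword_Cons)
qed

end

section \<open>Orbits and planarity\<close>

definition reach :: "('a \<Rightarrow> 'a) \<Rightarrow> 'a \<Rightarrow> 'a set" where
  "reach \<sigma> x = {(y, \<sigma> y) |y. True}\<^sup>* `` {x}"

lemma reach_refl: "x \<in> reach \<sigma> x"
  by (simp add: reach_def)

lemma reach_step: "y \<in> reach \<sigma> x \<Longrightarrow> \<sigma> y \<in> reach \<sigma> x"
  by (auto simp: reach_def intro: rtrancl_into_rtrancl)

lemma reach_subset:
  assumes "x \<in> S" "\<sigma> ` S \<subseteq> S"
  shows "reach \<sigma> x \<subseteq> S"
proof
  fix y assume "y \<in> reach \<sigma> x"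
  then have "(x, y) \<in> {(y, \<sigma> y) |y. True}\<^sup>*" by (simp add: reach_def)
  then show "y \<in> S" by induction (use assms in auto)
qed

lemma reach_trans: "y \<in> reach \<sigma> x \<Longrightarrow> reach \<sigma> y \<subseteq> reach \<sigma> x"
  by (rule reach_subset) (auto intro: reach_step)

text \<open>Otherwise inserting \<open>x\<close> into the orbit of \<open>\<sigma> x\<close> would
  give a finite set injecting into a smaller one.\<close>

lemma reach_step_back:
  assumes "finite S" "inj_on \<sigma> S" "\<sigma> ` S \<subseteq> S" "x \<in> S"
  shows "x \<in> reach \<sigma> (\<sigma> x)"
proof (rule ccontr)
  let ?O = "reach \<sigma> (\<sigma> x)"
  assume "x \<notin> ?O"
  have "?O \<subseteq> S" using assms by (intro reach_subset) auto
  then have fin: "finite ?O" using assms(1) finite_subset by blast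
  have "\<sigma> ` insert x ?O \<subseteq> ?O" using reach_refl reach_step by fast
  then have "card (insert x ?O) \<le> card ?O"
    using assms(2,4) \<open>?O \<subseteq> S\<close> fin by (metis card_image card_mono inj_on_subset insert_subset)
  then show False using fin \<open>x \<notin> ?O\<close> by simp
qed

text \<open>On a finite set injectivity makes reachability symmetric.\<close>

lemma reach_eq:
  assumes "finite S" "inj_on \<sigma> S" "\<sigma> ` S \<subseteq> S" "x \<in> S" "y \<in> reach \<sigma> x"
  shows "reach \<sigma> y = reach \<sigma> x"
proof -
  have "(x, y) \<in> {(y, \<sigma> y) |y. True}\<^sup>*" using assms(5) by (simp add: reach_def)
  then have "y \<in> S \<and> x \<in> reach \<sigma> y"
  proof induction
    case (step y z)
    then have z: "z = \<sigma> y" and y: "y \<in> S" "x \<in> reach \<sigma> y" by auto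
    have "reach \<sigma> y \<subseteq> reach \<sigma> z"
      using reach_trans[OF reach_step_back[OF assms(1-3) y(1)]] by (simp add: z)
    then show ?case using y assms(3) by (auto simp: z)
  qed (simp add: reach_refl assms)
  then show ?thesis using reach_trans[of x \<sigma> y] reach_trans[OF assms(5)] by blast
qed

lemma bij_betw_reach:
  assumes "finite S" "inj_on \<sigma> S" "\<sigma> ` S \<subseteq> S" "x \<in> S"
  shows "bij_betw \<sigma> (reach \<sigma> x) (reach \<sigma> x)"
proof -
  have sub: "reach \<sigma> x \<subseteq> S" using assms by (intro reach_subset) auto
  have "inj_on \<sigma> (reach \<sigma> x)" using assms(2) sub inj_on_subset by blast
  moreover have "\<sigma> ` reach \<sigma> x \<subseteq> reach \<sigma> x" using reach_step by fast
  ultimately show ?thesis using sub assms(1)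
    by (metis bij_betw_def endo_inj_surj finite_subset)
qed

section \<open>Cochains modulo 2\<close>

definition cochains :: "'a set \<Rightarrow> ('a \<Rightarrow> bit) set" where
  "cochains S = {f. \<forall>x. x \<notin> S \<longrightarrow> f x = 0}"

lemma bit_add_self [simp]: "(x :: bit) + x = 0"
  by (cases x) auto

lemma bit_add_self_left [simp]: "(x :: bit) + (x + y) = y"
  by (cases x; cases y) auto

declare add_bit_eq_xor [simp del]

lemma card_cochains:
  assumes "finite S"
  shows "finite (cochains S)" "card (cochains S) = 2 ^ card S"
proof -
  have "bij_betw (\<lambda>f. {x. f x = 1}) (cochains S) (Pow S)"
  proof (rule bij_betw_byWitness[where f' = "\<lambda>T x. if x \<in> T then 1 else 0"])
    show "\<forall>f \<in> cochains S. (\<lambda>x. if x \<in> {x. f x = 1} then 1 else 0) = f" by auto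
  qed (auto simp: cochains_def)
  then show "finite (cochains S)" "card (cochains S) = 2 ^ card S"
    using assms bij_betw_finite bij_betw_same_card card_Pow finite_Pow_iff by metis+
qed

lemma cochains_add: "f \<in> cochains S \<Longrightarrow> g \<in> cochains S \<Longrightarrow> (\<lambda>x. f x + g x) \<in> cochains S"
  by (simp add: cochains_def)

text \<open>Rank-nullity by counting: modulo 2, translation by a preimage \<open>g\<close> is an
  involution carrying the fibre over \<open>L g\<close> to the kernel.\<close>

lemma card_image_kernel:
  fixes L :: "('a \<Rightarrow> bit) \<Rightarrow> 'b \<Rightarrow> bit"
  assumes "finite A" and add: "\<And>f g. f \<in> A \<Longrightarrow> g \<in> A \<Longrightarrow> (\<lambda>x. f x + g x) \<in> A"
    and L: "\<And>f g. f \<in> A \<Longrightarrow> g \<in> A \<Longrightarrow> L (\<lambda>x. f x + g x) = (\<lambda>y. L f y + L g y)"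
  shows "card A = card (L ` A) * card {f \<in> A. L f = (\<lambda>_. 0)}"
proof -
  have "card {f \<in> A. L f = h} = card {f \<in> A. L f = (\<lambda>_. 0)}" if h: "h \<in> L ` A" for h
  proof -
    obtain g where g: "g \<in> A" "h = L g" using h by blast
    have "bij_betw (\<lambda>f x. f x + g x) {f \<in> A. L f = h} {f \<in> A. L f = (\<lambda>_. 0)}"
      by (rule bij_betw_byWitness[where f' = "\<lambda>f x. f x + g x"]) (auto simp: g add L add.commute)
    then show ?thesis by (rule bij_betw_same_card)
  qed
  then have "(\<Sum>h\<in>L ` A. card {f \<in> A. L f = h}) = card (L ` A) * card {f \<in> A. L f = (\<lambda>_. 0)}"
    by simp
  then show ?thesis using sum.image_gen[OF assms(1), of "\<lambda>_. 1 :: nat" L] by simp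
qed

section \<open>The 4-valent graph, its faces and the cellular coboundaries\<close>

locale diagram =
  fixes D :: link_diag
  assumes link_diagram: "link_diagram D"
begin

lemma finite_ends: "finite (ends D)"
  by (simp add: ends_def)

lemma arcs_in_ends: "e \<in> ends D \<Longrightarrow> arcs D e \<in> ends D"
  and arcs_neq: "e \<in> ends D \<Longrightarrow> arcs D e \<noteq> e"
  and arcs_arcs: "e \<in> ends D \<Longrightarrow> arcs D (arcs D e) = e"
  using link_diagram by (auto simp: link_diagram_def)

lemma end_cases:
  assumes "e \<in> ends D"
  obtains "snd e = 0" | "snd e = 1" | "snd e = 2" | "snd e = 3"
  using assms by (force simp: ends_def eval_nat_numeral less_Suc_eq)

lemma rot_in_ends: "e \<in> ends D \<Longrightarrow> rot e \<in> ends D"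
  by (auto simp: ends_def rot_def)

lemma fst_rot [simp]: "fst (rot e) = fst e"
  by (simp add: rot_def split_beta)

lemma inj_on_rot: "inj_on rot (ends D)"
proof (rule inj_onI)
  fix e e' assume "e \<in> ends D" "e' \<in> ends D" "rot e = rot e'"
  then show "e = e'"
    by (elim end_cases) (auto simp: rot_def prod_eq_iff split_beta)
qed

definition parity :: "cend \<Rightarrow> bit" where
  "parity e = of_nat (snd e)"

lemma parity_rot: "e \<in> ends D \<Longrightarrow> parity (rot e) = parity e + 1"
  by (erule end_cases) (auto simp: parity_def rot_def split_beta)

definition face_step :: "cend \<Rightarrow> cend" where
  "face_step e = rot (arcs D e)"

lemma face_step_image: "face_step ` ends D \<subseteq> ends D"
  by (rule image_subsetI) (simp add: face_step_def arcs_in_ends rot_in_ends)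

lemma inj_on_face_step: "inj_on face_step (ends D)"
proof (rule inj_onI)
  fix x y assume xy: "x \<in> ends D" "y \<in> ends D" "face_step x = face_step y"
  then have "arcs D x = arcs D y"
    using inj_on_rot arcs_in_ends by (simp add: face_step_def inj_on_eq_iff)
  then show "x = y" using xy arcs_arcs by metis
qed

lemma faces_eq: "faces D = reach face_step ` ends D"
  by (simp add: faces_def reach_def face_step_def)

lemma reach_face_step_eq: "e \<in> ends D \<Longrightarrow> e' \<in> reach face_step e \<Longrightarrow> reach face_step e' = reach face_step e"
  using reach_eq[OF finite_ends inj_on_face_step face_step_image] .

lemma face_subset: "F \<in> faces D \<Longrightarrow> F \<subseteq> ends D"
  using reach_subset[OF _ face_step_image] by (auto simp: faces_eq)

lemma finite_face: "F \<in> faces D \<Longrightarrow> finite F"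
  using face_subset finite_ends finite_subset by blast

lemma finite_faces: "finite (faces D)"
  by (simp add: faces_eq finite_ends)

text \<open>The step permutes the ends of a face, so the two halves of the sum agree and cancel
  modulo 2.\<close>

lemma face_sum: "F \<in> faces D \<Longrightarrow> (\<Sum>e\<in>F. h e + h (face_step e)) = (0 :: bit)"
proof -
  assume "F \<in> faces D"
  then have "bij_betw face_step F F"
    using bij_betw_reach[OF finite_ends inj_on_face_step face_step_image] by (auto simp: faces_eq)
  then have "(\<Sum>e\<in>F. h (face_step e)) = (\<Sum>e\<in>F. h e)" by (rule sum.reindex_bij_betw)
  then show ?thesis by (simp only: sum.distrib bit_add_self)
qed

definition diagram_arcs :: "cend set set" where
  "diagram_arcs = (\<lambda>e. {e, arcs D e}) ` ends D"

lemma finite_diagram_arcs: "finite diagram_arcs"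
  by (simp add: diagram_arcs_def finite_ends)

lemma card_diagram_arcs: "card diagram_arcs = 2 * crossings D"
proof -
  have "2 * card diagram_arcs = card (\<Union> diagram_arcs)"
  proof (rule card_partition)
    show "finite (\<Union> diagram_arcs)" by (auto simp: diagram_arcs_def finite_ends)
    show "card c = 2" if "c \<in> diagram_arcs" for c
    proof -
      obtain e where "e \<in> ends D" "c = {e, arcs D e}" using \<open>c \<in> diagram_arcs\<close> by (auto simp: diagram_arcs_def)
      then show ?thesis using arcs_neq[of e] by simp
    qed
    have mem: "c = {x, arcs D x}" if "c \<in> diagram_arcs" "x \<in> c" for c x
      using that arcs_arcs by (auto simp: diagram_arcs_def)
    show "c1 \<inter> c2 = {}" if "c1 \<in> diagram_arcs" "c2 \<in> diagram_arcs" "c1 \<noteq> c2" for c1 c2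
    proof (rule ccontr)
      assume "c1 \<inter> c2 \<noteq> {}"
      then obtain x where "x \<in> c1" "x \<in> c2" by auto
      then have "c1 = c2" using mem[OF that(1)] mem[OF that(2)] by metis
      then show False using that(3) by simp
    qed
  qed (rule finite_diagram_arcs)
  moreover have "\<Union> diagram_arcs = ends D" using arcs_in_ends by (auto simp: diagram_arcs_def)
  moreover have "card (ends D) = 4 * crossings D" by (simp add: ends_def card_cartesian_product)
  ultimately show ?thesis by simp
qed

text \<open>Cellular coboundary from crossings to arcs modulo 2; values off the arcs are set to 0 so
  that images are cochains.\<close>

definition delta0 :: "(nat \<Rightarrow> bit) \<Rightarrow> cend set \<Rightarrow> bit" where
  "delta0 s K = (if K \<in> diagram_arcs then \<Sum>e\<in>K. s (fst e) else 0)"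

text \<open>Cellular coboundary from arcs to faces. Summing over ends makes an arc with the same
  face on both sides count twice, hence 0.\<close>

definition delta1 :: "(cend set \<Rightarrow> bit) \<Rightarrow> cend set \<Rightarrow> bit" where
  "delta1 w F = (if F \<in> faces D then \<Sum>e\<in>F. w {e, arcs D e} else 0)"

lemma delta0_arc: "e \<in> ends D \<Longrightarrow> delta0 s {e, arcs D e} = s (fst e) + s (fst (arcs D e))"
  using arcs_neq[of e] by (auto simp: delta0_def diagram_arcs_def)

lemma delta0_in_cochains: "delta0 s \<in> cochains diagram_arcs"
  by (simp add: cochains_def delta0_def)

lemma delta0_add: "delta0 (\<lambda>x. s x + s' x) = (\<lambda>K. delta0 s K + delta0 s' K)"
  by (auto simp: delta0_def sum.distrib)

lemma delta1_add: "delta1 (\<lambda>x. w x + w' x) = (\<lambda>F. delta1 w F + delta1 w' F)"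
  by (auto simp: delta1_def sum.distrib )

lemma delta1_eq_0I:
  assumes "\<And>e. e \<in> ends D \<Longrightarrow> w {e, arcs D e} = h e + h (face_step e)"
  shows "delta1 w = (\<lambda>_. 0)"
proof
  fix F
  show "delta1 w F = 0"
  proof (cases "F \<in> faces D")
    case True
    then have "(\<Sum>e\<in>F. w {e, arcs D e}) = (\<Sum>e\<in>F. h e + h (face_step e))"
      using face_subset assms by (intro sum.cong) auto
    then show ?thesis using face_sum[OF True] True by (simp add: delta1_def)
  qed (simp add: delta1_def)
qed

lemma delta1_delta0: "delta1 (delta0 s) = (\<lambda>_. 0)"
  by (rule delta1_eq_0I[where h = "\<lambda>e. s (fst e)"]) (simp add: delta0_arc face_step_def)

text \<open>Takes the value 1 on the arcs whose two ends have equal parity. A primitive says at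
  which crossings to reverse the parities so that the ends of every arc get opposite signs.\<close>

definition arc_parity :: "cend set \<Rightarrow> bit" where
  "arc_parity K = (if K \<in> diagram_arcs then 1 + (\<Sum>e\<in>K. parity e) else 0)"

lemma arc_parity_arc:
  "e \<in> ends D \<Longrightarrow> arc_parity {e, arcs D e} = 1 + (parity e + parity (arcs D e))"
  using arcs_neq[of e] by (auto simp: arc_parity_def diagram_arcs_def)

lemma delta1_arc_parity: "delta1 arc_parity = (\<lambda>_. 0)"
  by (rule delta1_eq_0I[where h = parity])
    (simp only: arc_parity_arc face_step_def parity_rot arcs_in_ends add_ac)

definition component :: "cend \<Rightarrow> cend set" where
  "component e = ({(x, rot x) |x. True} \<union> {(x, arcs D x) |x. True})\<^sup>* `` {e}"

lemma components_eq: "components D = component ` ends D"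
  by (simp add: components_def component_def)

lemma component_induct [consumes 2, case_names base rot arcs]:
  assumes "x \<in> component e" "e \<in> ends D" "P e"
    and "\<And>x. x \<in> ends D \<Longrightarrow> P x \<Longrightarrow> P (rot x)"
    and "\<And>x. x \<in> ends D \<Longrightarrow> P x \<Longrightarrow> P (arcs D x)"
  shows "P x"
proof -
  have "(e, x) \<in> ({(x, rot x) |x. True} \<union> {(x, arcs D x) |x. True})\<^sup>*"
    using assms(1) by (simp add: component_def)
  then have "x \<in> ends D \<and> P x"
    by induction (use assms rot_in_ends arcs_in_ends in auto)
  then show ?thesis by blast
qed

definition base_end :: "cend set \<Rightarrow> cend" where
  "base_end K = (SOME e. e \<in> ends D \<and> component e = K)"

lemma base_end:
  assumes "K \<in> components D"
  shows "base_end K \<in> ends D" "component (base_end K) = K"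
  using someI_ex[of "\<lambda>e. e \<in> ends D \<and> component e = K"] assms
  by (auto simp: base_end_def components_eq)

lemma in_component: "e \<in> component e"
  by (simp add: component_def)

lemma finite_components: "finite (components D)"
  by (simp add: components_eq finite_ends)

text \<open>A closed 0-cochain is constant on components, hence determined by its values at the base
  ends; this bounds the zeroth cohomology.\<close>

lemma card_kernel_delta0:
  "card {s \<in> cochains {..<crossings D}. delta0 s = (\<lambda>_. 0)} \<le> 2 ^ card (components D)"
proof -
  let ?K = "{s \<in> cochains {..<crossings D}. delta0 s = (\<lambda>_. 0)}"
  let ?f = "\<lambda>s K. if K \<in> components D then s (fst (base_end K)) else (0 :: bit)"
  have const: "s (fst x) = s (fst e)" if s: "s \<in> ?K" and x: "x \<in> component e" "e \<in> ends D" for s x e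
    using x
  proof (induction rule: component_induct)
    case (arcs x)
    have "s (fst x) + s (fst (arcs D x)) = 0" using delta0_arc[OF arcs(1), of s] s by simp
    then have "s (fst (arcs D x)) = s (fst x)" by (metis bit_add_self_left add_0_right)
    then show ?case using arcs by simp
  qed simp_all
  have "inj_on ?f ?K"
  proof (rule inj_onI, rule ext)
    fix s s' c assume s: "s \<in> ?K" "s' \<in> ?K" "?f s = ?f s'"
    show "s c = s' c"
    proof (cases "c < crossings D")
      case True
      let ?b = "base_end (component (c, 0))"
      have "(c, 0) \<in> ends D" using True by (simp add: ends_def)
      then have K: "component (c, 0) \<in> components D" by (simp add: components_eq)
      then have b: "(c, 0) \<in> component ?b" "?b \<in> ends D" using base_end in_component by auto
      show ?thesis using const[OF s(1) b] const[OF s(2) b] fun_cong[OF s(3), of "component (c, 0)"] K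
        by simp
    next
      case False
      then show ?thesis using s by (simp add: cochains_def)
    qed
  qed
  moreover have "?f ` ?K \<subseteq> cochains (components D)" by (auto simp: cochains_def)
  ultimately have "card ?K \<le> card (cochains (components D))"
    using card_cochains(1)[OF finite_components] by (rule card_inj_on_le)
  then show ?thesis by (simp add: card_cochains(2) finite_components)
qed

lemma reach_face_step_rot: "e \<in> ends D \<Longrightarrow> reach face_step (rot e) = reach face_step (arcs D e)"
  using reach_face_step_eq[OF arcs_in_ends reach_step[OF reach_refl]]
  by (simp add: face_step_def arcs_arcs)

definition unit_cochain :: "'a \<Rightarrow> 'a \<Rightarrow> bit" where
  "unit_cochain x y = (if y = x then 1 else 0)"

text \<open>An arc borders the faces through its two ends; when these coincide the two terms
  cancel.\<close>

lemma delta1_unit_cochain: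
  assumes e: "e \<in> ends D"
  shows "delta1 (unit_cochain {e, arcs D e})
    = (\<lambda>F. unit_cochain (reach face_step e) F + unit_cochain (reach face_step (arcs D e)) F)"
proof
  fix F
  have mem: "x \<in> F \<longleftrightarrow> F = reach face_step x" if "x \<in> ends D" "F \<in> faces D" for x
  proof -
    obtain e' where "e' \<in> ends D" "F = reach face_step e'" using \<open>F \<in> faces D\<close> by (auto simp: faces_eq)
    then show ?thesis using reach_face_step_eq[of e' x] reach_refl[of x face_step] by metis
  qed
  show "delta1 (unit_cochain {e, arcs D e}) F
    = unit_cochain (reach face_step e) F + unit_cochain (reach face_step (arcs D e)) F"
  proof (cases "F \<in> faces D")
    case True
    have "(\<Sum>x\<in>F. unit_cochain {e, arcs D e} {x, arcs D x})
        = (\<Sum>x\<in>F. (if x = e then 1 else 0) + (if x = arcs D e then 1 else 0))"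
      using arcs_neq[OF e] arcs_arcs[OF e] by (intro sum.cong) (auto simp: unit_cochain_def doubleton_eq_iff)
    also have "\<dots> = (if e \<in> F then 1 else 0) + (if arcs D e \<in> F then 1 else 0)"
      using finite_face[OF True] by (simp only: sum.distrib sum.delta)
    finally show ?thesis
      using mem[OF e True] mem[OF arcs_in_ends[OF e] True] True
      by (simp only: delta1_def unit_cochain_def if_True)
  next
    case False
    then show ?thesis using e arcs_in_ends[OF e] by (auto simp: delta1_def unit_cochain_def faces_eq)
  qed
qed

text \<open>A bound for the second cohomology: crossing an arc changes the indicator of a face by a
  coboundary, and all faces of a component are linked in this way. So the coboundaries span together
  with one face per component.\<close>

lemma card_cochains_faces:
  "2 ^ card (faces D) \<le> card (delta1 ` cochains diagram_arcs) * 2 ^ card (components D)"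
proof -
  let ?R = "(\<lambda>K. reach face_step (base_end K)) ` components D"
  let ?f = "\<lambda>(g, h) F. g F + h F :: bit"
  let ?S = "?f ` (delta1 ` cochains diagram_arcs \<times> cochains ?R)"
  have fin: "finite (delta1 ` cochains diagram_arcs \<times> cochains ?R)"
    using card_cochains(1)[OF finite_diagram_arcs] card_cochains(1)[of ?R] finite_components by simp
  have delta1: "delta1 w \<in> ?S" if "w \<in> cochains diagram_arcs" for w
    using that by (intro image_eqI[where x = "(delta1 w, \<lambda>_. 0)"]) (auto simp: cochains_def)
  have S_iff: "g \<in> ?S \<longleftrightarrow> (\<exists>w \<in> cochains diagram_arcs. \<exists>a \<in> cochains ?R. g = (\<lambda>F. delta1 w F + a F))" for g
    by auto
  have add: "(\<lambda>F. g F + h F) \<in> ?S" if gh_in: "g \<in> ?S" "h \<in> ?S" for g h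
  proof -
    obtain w a w' a' where gh: "g = (\<lambda>F. delta1 w F + a F)" "h = (\<lambda>F. delta1 w' F + a' F)"
      and *: "w \<in> cochains diagram_arcs" "w' \<in> cochains diagram_arcs" "a \<in> cochains ?R" "a' \<in> cochains ?R"
      using gh_in unfolding S_iff by blast
    show ?thesis unfolding S_iff
      by (intro bexI[where x = "\<lambda>x. w x + w' x"] bexI[where x = "\<lambda>x. a x + a' x"] cochains_add *)
        (simp add: gh delta1_add add_ac)
  qed
  have arcs: "unit_cochain (reach face_step (arcs D x)) \<in> ?S"
    if "x \<in> ends D" "unit_cochain (reach face_step x) \<in> ?S" for x
  proof -
    have "unit_cochain (reach face_step (arcs D x))
        = (\<lambda>F. unit_cochain (reach face_step x) F + delta1 (unit_cochain {x, arcs D x}) F)"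
      by (simp add: delta1_unit_cochain[OF that(1)])
    moreover have "unit_cochain {x, arcs D x} \<in> cochains diagram_arcs"
      using that(1) by (auto simp: cochains_def unit_cochain_def diagram_arcs_def)
    ultimately show ?thesis using add[OF that(2) delta1] by simp
  qed
  have unit: "unit_cochain F \<in> ?S" if F: "F \<in> faces D" for F
  proof -
    obtain e where e: "e \<in> ends D" "F = reach face_step e" using F by (auto simp: faces_eq)
    let ?K = "component e"
    have K: "?K \<in> components D" using e by (simp add: components_eq)
    have "e \<in> component (base_end ?K)" "base_end ?K \<in> ends D" using base_end[OF K] in_component by auto
    then have "unit_cochain (reach face_step e) \<in> ?S"
    proof (induction rule: component_induct)
      case base
      have "unit_cochain (reach face_step (base_end ?K)) \<in> cochains ?R"
        using K by (auto simp: cochains_def unit_cochain_def)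
      then show ?case unfolding S_iff
        by (intro bexI[where x = "\<lambda>_. 0"] bexI[where x = "unit_cochain (reach face_step (base_end ?K))"])
          (auto simp: cochains_def delta1_def)
    next
      \<comment> \<open>Turning at a crossing leads into the face through \<open>arcs D x\<close>,
        so this case is the one of crossing an arc.\<close>
      case (rot x)
      then show ?case using arcs by (simp add: reach_face_step_rot)
    qed (rule arcs)
    then show ?thesis by (simp add: e)
  qed
  have indicator: "(\<lambda>F. if F \<in> T then 1 else 0) \<in> ?S" if "finite T" "T \<subseteq> faces D" for T
    using that
  proof induction
    case empty
    show ?case unfolding S_iff
      by (intro bexI[where x = "\<lambda>_. 0"]) (auto simp: cochains_def delta1_def)
  next
    case (insert F T)
    have "(\<lambda>F'. if F' \<in> insert F T then 1 else 0)
        = (\<lambda>F'. unit_cochain F F' + (if F' \<in> T then 1 else 0))"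
      using insert(2) by (auto simp: unit_cochain_def )
    then show ?case using add[OF unit] insert by simp
  qed
  have "cochains (faces D) \<subseteq> ?S"
  proof
    fix g assume "g \<in> cochains (faces D)"
    then have sub: "{F. g F = 1} \<subseteq> faces D" by (auto simp: cochains_def)
    have "(\<lambda>F. if F \<in> {F. g F = 1} then 1 else 0) = g" by auto
    then show "g \<in> ?S" using indicator[OF finite_subset[OF sub finite_faces] sub] by (simp only:)
  qed
  then have "card (cochains (faces D)) \<le> card ?S"
    by (rule card_mono[OF finite_imageI[OF fin]])
  also have "\<dots> \<le> card (delta1 ` cochains diagram_arcs \<times> cochains ?R)"
    by (rule card_image_le[OF fin])
  also have "\<dots> = card (delta1 ` cochains diagram_arcs) * 2 ^ card ?R"
    using card_cochains(2)[of ?R] finite_components by (simp add: card_cartesian_product)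
  also have "\<dots> \<le> card (delta1 ` cochains diagram_arcs) * 2 ^ card (components D)"
    using card_image_le[OF finite_components] by (intro mult_le_mono2 power_increasing) auto
  finally show ?thesis by (simp add: card_cochains(2) finite_faces)
qed

text \<open>
  The Euler characteristic leaves no room for first cohomology modulo 2, by counting cochains, and
  \<open>arc_parity\<close> is a cocycle because the parity changes whenever a face boundary turns at a crossing.
\<close>

theorem ex_delta0_eq_arc_parity: "\<exists>s. delta0 s = arc_parity"
proof -
  let ?C0 = "cochains {..<crossings D}" and ?C1 = "cochains diagram_arcs"
  let ?K0 = "{s \<in> ?C0. delta0 s = (\<lambda>_. 0)}" and ?K1 = "{w \<in> ?C1. delta1 w = (\<lambda>_. 0)}"
  let ?c = "card (components D)" and ?n = "crossings D"
  have "card ?C0 = card (delta0 ` ?C0) * card ?K0"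
  proof (rule card_image_kernel)
    show "delta0 (\<lambda>x. f x + g x) = (\<lambda>K. delta0 f K + delta0 g K)" for f g
      by (rule delta0_add)
  qed (simp_all add: card_cochains cochains_add)
  then have 0: "2 ^ ?n = card (delta0 ` ?C0) * card ?K0"
    by (simp only: card_cochains(2)[OF finite_lessThan] card_lessThan)
  have "card ?C1 = card (delta1 ` ?C1) * card ?K1"
  proof (rule card_image_kernel)
    show "delta1 (\<lambda>x. f x + g x) = (\<lambda>F. delta1 f F + delta1 g F)" for f g
      by (rule delta1_add)
  qed (simp_all add: card_cochains finite_diagram_arcs cochains_add)
  then have 1: "2 ^ (2 * ?n) = card (delta1 ` ?C1) * card ?K1"
    by (simp only: card_cochains(2)[OF finite_diagram_arcs] card_diagram_arcs)
  have "card (faces D) = ?n + 2 * ?c" using link_diagram by (simp add: link_diagram_def)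
  \<comment> \<open>In dimensions, with n crossings and c components: the image of
    \<open>delta1\<close> has dimension at least n + c, so its kernel has at most n - c, which the
    image of \<open>delta0\<close> already attains.\<close>
  then have "2 ^ (?n + ?c) * 2 ^ ?c \<le> card (delta1 ` ?C1) * 2 ^ ?c"
    using card_cochains_faces by (simp add: power_add mult.assoc mult_2)
  then have "2 ^ (?n + ?c) \<le> card (delta1 ` ?C1)" by simp
  then have "2 ^ (?n + ?c) * card ?K1 \<le> 2 ^ (2 * ?n)" by (simp add: 1)
  then have "2 ^ ?n * (card ?K1 * 2 ^ ?c) \<le> 2 ^ ?n * 2 ^ ?n"
    by (simp only: power_add mult_2 mult_2_right mult_ac)
  then have "card ?K1 * 2 ^ ?c \<le> 2 ^ ?n" by simp
  also have "\<dots> \<le> card (delta0 ` ?C0) * 2 ^ ?c" unfolding 0 using card_kernel_delta0 by simp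
  finally have "card ?K1 \<le> card (delta0 ` ?C0)" by simp
  moreover have "delta0 ` ?C0 \<subseteq> ?K1" using delta0_in_cochains delta1_delta0 by auto
  moreover have "finite ?K1" using card_cochains(1)[OF finite_diagram_arcs] by simp
  ultimately have "delta0 ` ?C0 = ?K1" by (meson card_mono card_subset_eq le_antisym)
  moreover have "arc_parity \<in> ?K1" using delta1_arc_parity by (simp add: cochains_def arc_parity_def)
  ultimately have "arc_parity \<in> delta0 ` ?C0" by (simp only:)
  then show ?thesis by auto
qed

end

section \<open>Circles and crossing changes\<close>

lemma reach_iterate: "y \<in> reach \<sigma> x \<Longrightarrow> \<exists>k. y = (\<sigma> ^^ k) x"
proof -
  have "reach \<sigma> x \<subseteq> {(\<sigma> ^^ k) x |k. True}"
  proof (rule reach_subset)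
    show "x \<in> {(\<sigma> ^^ k) x |k. True}" by (rule CollectI, rule exI[of _ 0]) simp
    show "\<sigma> ` {(\<sigma> ^^ k) x |k. True} \<subseteq> {(\<sigma> ^^ k) x |k. True}"
    proof clarify
      fix k
      show "\<exists>k'. \<sigma> ((\<sigma> ^^ k) x) = (\<sigma> ^^ k') x \<and> True" by (rule exI[of _ "Suc k"]) simp
    qed
  qed
  then show "y \<in> reach \<sigma> x \<Longrightarrow> \<exists>k. y = (\<sigma> ^^ k) x" by auto
qed

lemma iterate_in_reach: "(\<sigma> ^^ k) x \<in> reach \<sigma> x"
  by (induction k) (auto intro: reach_refl reach_step)

text \<open>\<open>\<sigma>'\<close> is \<open>\<sigma>\<close> followed by the transposition of
  \<open>p\<close> and \<open>q\<close>. This models a change of smoothing at one crossing; such a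
  product joins two cycles or cuts one.\<close>

locale swapped_permutation =
  fixes S :: "'a set" and \<sigma> \<sigma>' :: "'a \<Rightarrow> 'a" and p q :: 'a
  assumes finite_S: "finite S"
    and inj_\<sigma>: "inj_on \<sigma> S" and \<sigma>_S: "\<sigma> ` S \<subseteq> S"
    and inj_\<sigma>': "inj_on \<sigma>' S" and \<sigma>'_S: "\<sigma>' ` S \<subseteq> S"
    and p_in: "p \<in> S" and q_in: "q \<in> S" and p_neq_q: "p \<noteq> q"
    and swap: "\<And>x. x \<in> S \<Longrightarrow> \<sigma>' x = (if \<sigma> x = p then q else if \<sigma> x = q then p else \<sigma> x)"
begin

lemma swapped_exchange: "swapped_permutation S \<sigma> \<sigma>' q p"
  using finite_S inj_\<sigma> \<sigma>_S inj_\<sigma>' \<sigma>'_S p_in q_in p_neq_q swap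
  by (simp add: swapped_permutation_def)

lemma swapped_inverse: "swapped_permutation S \<sigma>' \<sigma> p q"
  using finite_S inj_\<sigma> \<sigma>_S inj_\<sigma>' \<sigma>'_S p_in q_in p_neq_q swap
  by (simp add: swapped_permutation_def)

lemma reach_in_S: "x \<in> S \<Longrightarrow> reach \<sigma> x \<subseteq> S"
  using reach_subset \<sigma>_S by metis

lemma reach_avoid:
  assumes "x \<in> S" "p \<notin> reach \<sigma> x" "q \<notin> reach \<sigma> x"
  shows "reach \<sigma>' x = reach \<sigma> x"
proof
  have step: "\<sigma>' y = \<sigma> y" if "y \<in> reach \<sigma> x" for y
  proof -
    have "\<sigma> y \<in> reach \<sigma> x" using reach_step[OF that] .
    then have "\<sigma> y \<noteq> p" "\<sigma> y \<noteq> q" using assms by auto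
    then show ?thesis using swap reach_in_S[OF assms(1)] that by auto
  qed
  show sub: "reach \<sigma>' x \<subseteq> reach \<sigma> x"
    by (rule reach_subset) (auto simp: reach_refl step reach_step)
  show "reach \<sigma> x \<subseteq> reach \<sigma>' x"
  proof (rule reach_subset)
    show "\<sigma> ` reach \<sigma>' x \<subseteq> reach \<sigma>' x"
    proof (rule image_subsetI)
      fix y assume y: "y \<in> reach \<sigma>' x"
      then have "\<sigma>' y = \<sigma> y" using step sub by auto
      then show "\<sigma> y \<in> reach \<sigma>' x" using reach_step[OF y] by simp
    qed
  qed (rule reach_refl)
qed

text \<open>Until it returns to \<open>p\<close>, the walk from \<open>p\<close> is the same for
  both maps; at the return \<open>\<sigma>'\<close> continues at \<open>q\<close> instead.\<close>

lemma reach_merge_aux: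
  assumes "q \<notin> reach \<sigma> p"
  shows "reach \<sigma> p \<subseteq> reach \<sigma>' p" "q \<in> reach \<sigma>' p"
proof -
  have "reach \<sigma> p \<subseteq> reach \<sigma> p \<inter> reach \<sigma>' p"
  proof (rule reach_subset)
    show "p \<in> reach \<sigma> p \<inter> reach \<sigma>' p" by (simp add: reach_refl)
    show "\<sigma> ` (reach \<sigma> p \<inter> reach \<sigma>' p) \<subseteq> reach \<sigma> p \<inter> reach \<sigma>' p"
    proof (rule image_subsetI)
      fix y assume y: "y \<in> reach \<sigma> p \<inter> reach \<sigma>' p"
      then have \<sigma>y: "\<sigma> y \<in> reach \<sigma> p" "\<sigma>' y \<in> reach \<sigma>' p" by (simp_all add: reach_step)
      have "y \<in> S" using y reach_in_S[OF p_in] by auto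
      moreover have "\<sigma> y \<noteq> q" using \<sigma>y(1) assms by auto
      ultimately have "\<sigma> y = p \<or> \<sigma>' y = \<sigma> y" using swap by auto
      then show "\<sigma> y \<in> reach \<sigma> p \<inter> reach \<sigma>' p" using \<sigma>y reach_refl[of p \<sigma>'] by auto
    qed
  qed
  then show sub: "reach \<sigma> p \<subseteq> reach \<sigma>' p" by simp
  have "p \<in> \<sigma> ` reach \<sigma> p"
    using bij_betw_reach[OF finite_S inj_\<sigma> \<sigma>_S p_in] reach_refl[of p \<sigma>] by (simp add: bij_betw_def)
  then obtain y where y: "y \<in> reach \<sigma> p" "\<sigma> y = p" by auto
  then have "\<sigma>' y = q" using swap reach_in_S[OF p_in] by auto
  then show "q \<in> reach \<sigma>' p" using reach_step[of y \<sigma>' p] y(1) sub by auto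
qed

lemma reach_merge:
  assumes "q \<notin> reach \<sigma> p"
  shows "reach \<sigma>' p = reach \<sigma> p \<union> reach \<sigma> q" "reach \<sigma>' q = reach \<sigma> p \<union> reach \<sigma> q"
proof -
  interpret ex: swapped_permutation S \<sigma> \<sigma>' q p by (rule swapped_exchange)
  have "p \<notin> reach \<sigma> q"
  proof
    assume "p \<in> reach \<sigma> q"
    then have "reach \<sigma> p = reach \<sigma> q" by (rule reach_eq[OF finite_S inj_\<sigma> \<sigma>_S q_in])
    then show False using assms reach_refl[of q \<sigma>] by simp
  qed
  note q = ex.reach_merge_aux[OF this] and p = reach_merge_aux[OF assms]
  have eq: "reach \<sigma>' q = reach \<sigma>' p"
    by (rule reach_eq[OF finite_S inj_\<sigma>' \<sigma>'_S p_in p(2)])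
  have "reach \<sigma>' p \<subseteq> reach \<sigma> p \<union> reach \<sigma> q"
  proof (rule reach_subset)
    show "\<sigma>' ` (reach \<sigma> p \<union> reach \<sigma> q) \<subseteq> reach \<sigma> p \<union> reach \<sigma> q"
    proof (rule image_subsetI)
      fix y assume y: "y \<in> reach \<sigma> p \<union> reach \<sigma> q"
      then have "y \<in> S" using reach_in_S[OF p_in] reach_in_S[OF q_in] by auto
      moreover have "\<sigma> y \<in> reach \<sigma> p \<union> reach \<sigma> q" using y by (auto simp: reach_step)
      ultimately show "\<sigma>' y \<in> reach \<sigma> p \<union> reach \<sigma> q"
        using swap reach_refl[of p \<sigma>] reach_refl[of q \<sigma>] by auto
    qed
  qed (simp add: reach_refl)
  then show "reach \<sigma>' p = reach \<sigma> p \<union> reach \<sigma> q" using p(1) q(1) eq by auto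
  then show "reach \<sigma>' q = reach \<sigma> p \<union> reach \<sigma> q" by (simp add: eq)
qed

text \<open>The walk from \<open>p\<close> up to the first visit to \<open>p\<close> or
  \<open>q\<close> closes up under \<open>\<sigma>'\<close> into a cycle missing
  \<open>q\<close>.\<close>

lemma reach_split:
  assumes "q \<in> reach \<sigma> p"
  shows "q \<notin> reach \<sigma>' p"
proof -
  let ?hit = "\<lambda>j. j > 0 \<and> (\<sigma> ^^ j) p \<in> {p, q}"
  obtain k where "q = (\<sigma> ^^ k) p" using reach_iterate[OF assms] by auto
  then have "?hit k" using p_neq_q by (cases k) auto
  define j where "j = (LEAST j. ?hit j)"
  have hit: "?hit j" unfolding j_def by (rule LeastI) (rule \<open>?hit k\<close>)
  have no_hit: "\<not> ?hit i" if "i < j" for i using not_less_Least that unfolding j_def by blast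
  define C where "C = (\<lambda>i. (\<sigma> ^^ i) p) ` {..<j}"
  have p_C: "p \<in> C" unfolding C_def using hit by (intro image_eqI[of _ _ 0]) auto
  have q_C: "q \<notin> C"
  proof
    assume "q \<in> C"
    then obtain i where "i < j" "q = (\<sigma> ^^ i) p" by (auto simp: C_def)
    then show False using no_hit[of i] p_neq_q by (cases i) auto
  qed
  have C_step: "\<sigma> y \<in> C \<and> \<sigma> y \<noteq> p \<or> \<sigma> y = (\<sigma> ^^ j) p" if "y \<in> C" for y
  proof -
    obtain i where i: "i < j" "y = (\<sigma> ^^ i) p" using \<open>y \<in> C\<close> by (auto simp: C_def)
    show ?thesis
    proof (cases "Suc i = j")
      case True
      then show ?thesis using i by auto
    next
      case False
      then have "Suc i < j" using i by simp
      moreover from this have "(\<sigma> ^^ Suc i) p \<noteq> p" using no_hit[of "Suc i"] by simp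
      ultimately show ?thesis using i(2) unfolding C_def by (intro disjI1) (auto intro!: image_eqI[of _ _ "Suc i"])
    qed
  qed
  \<comment> \<open>A first return to \<open>p\<close> would close the orbit before it reaches
    \<open>q\<close>.\<close>
  have "(\<sigma> ^^ j) p \<noteq> p"
  proof
    assume "(\<sigma> ^^ j) p = p"
    then have "reach \<sigma> p \<subseteq> C" using C_step p_C by (intro reach_subset) auto
    then show False using assms q_C by auto
  qed
  then have j: "(\<sigma> ^^ j) p = q" using hit by auto
  have "C \<subseteq> S" unfolding C_def using iterate_in_reach[where \<sigma> = \<sigma> and x = p] reach_in_S[OF p_in] by auto
  have "reach \<sigma>' p \<subseteq> C"
  proof (rule reach_subset[OF p_C], rule image_subsetI)
    fix y assume y: "y \<in> C"
    then have "\<sigma>' y = (if \<sigma> y = p then q else if \<sigma> y = q then p else \<sigma> y)"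
      using swap \<open>C \<subseteq> S\<close> by auto
    then show "\<sigma>' y \<in> C" using C_step[OF y] j p_C p_neq_q by (auto split: if_splits)
  qed
  then show ?thesis using q_C by auto
qed

lemma reach_merge_iff: "q \<in> reach \<sigma>' p \<longleftrightarrow> q \<notin> reach \<sigma> p"
  using reach_merge_aux(2) reach_split by blast

lemma reach_union: "reach \<sigma> p \<union> reach \<sigma> q = reach \<sigma>' p \<union> reach \<sigma>' q"
proof (cases "q \<in> reach \<sigma> p")
  case True
  interpret inv: swapped_permutation S \<sigma>' \<sigma> p q by (rule swapped_inverse)
  show ?thesis using inv.reach_merge[OF reach_split[OF True]] by auto
next
  case False
  show ?thesis using reach_merge[OF False] by auto
qed

end

section \<open>Signs of ends, and circles as orbits\<close>

context diagram
begin

text \<open>Marks the crossings at which the parity of ends is reversed.\<close>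

definition shade :: "nat \<Rightarrow> bit" where
  "shade = (SOME s. delta0 s = arc_parity)"

text \<open>
  Colouring the ends by their sign makes arcs and smoothings of either type join ends of opposite
  sign, whence a saddle within a circle cannot reconnect it to a single circle.
\<close>

definition end_sign :: "cend \<Rightarrow> bit" where
  "end_sign e = shade (fst e) + parity e"

lemma end_sign_arcs: "e \<in> ends D \<Longrightarrow> end_sign (arcs D e) = end_sign e + 1"
proof -
  assume e: "e \<in> ends D"
  have "delta0 shade = arc_parity"
    unfolding shade_def by (rule someI_ex[OF ex_delta0_eq_arc_parity])
  then have "shade (fst e) + shade (fst (arcs D e)) = 1 + (parity e + parity (arcs D e))"
    using delta0_arc[OF e, of shade] arc_parity_arc[OF e] by simp
  then show ?thesis unfolding end_sign_def
    by (cases "shade (fst e)"; cases "shade (fst (arcs D e))"; cases "parity e"; cases "parity (arcs D e)") simp_all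
qed

lemma fst_smooth [simp]: "fst (smooth \<xi> e) = fst e"
  by (simp add: smooth_def split_beta)

lemma smooth_in_ends: "e \<in> ends D \<Longrightarrow> smooth \<xi> e \<in> ends D"
  and smooth_smooth: "e \<in> ends D \<Longrightarrow> smooth \<xi> (smooth \<xi> e) = e"
  and parity_smooth: "e \<in> ends D \<Longrightarrow> parity (smooth \<xi> e) = parity e + 1"
proof -
  assume e: "e \<in> ends D"
  then have "fst e < crossings D" by (auto simp: ends_def)
  with e show "smooth \<xi> e \<in> ends D"
    by (elim end_cases) (auto simp: ends_def smooth_def split_beta)
  show "smooth \<xi> (smooth \<xi> e) = e" using e
    by (elim end_cases) (auto simp: smooth_def split_beta prod_eq_iff)
  show "parity (smooth \<xi> e) = parity e + 1" using e
    by (elim end_cases) (auto simp: smooth_def split_beta parity_def)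
qed

lemma end_sign_smooth: "e \<in> ends D \<Longrightarrow> end_sign (smooth \<xi> e) = end_sign e + 1"
  by (simp add: end_sign_def parity_smooth add.assoc)

text \<open>A circle meets ends of alternating sign. Restricted to positive ends the walk along arcs
  and smoothings has one orbit per circle, whereas on all ends each circle gives two, one for each
  direction.\<close>

definition positive :: "cend set" where
  "positive = {e \<in> ends D. end_sign e = 0}"

lemma positive_in_ends: "e \<in> positive \<Longrightarrow> e \<in> ends D"
  by (simp add: positive_def)

lemma finite_positive: "finite positive"
  by (simp add: positive_def finite_ends)

lemma positive_or_smooth: "e \<in> ends D \<Longrightarrow> e \<in> positive \<or> smooth \<xi> e \<in> positive"
  using end_sign_smooth[of e \<xi>] smooth_in_ends[of e \<xi>] by (cases "end_sign e") (auto simp: positive_def)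

lemma arcs_not_positive: "e \<in> positive \<Longrightarrow> arcs D e \<notin> positive"
  using end_sign_arcs[of e] by (auto simp: positive_def)

definition circle_step :: "nat set \<Rightarrow> cend \<Rightarrow> cend" where
  "circle_step \<xi> e = smooth \<xi> (arcs D e)"

lemma circle_step_positive: "circle_step \<xi> ` positive \<subseteq> positive"
proof (rule image_subsetI)
  fix e assume e: "e \<in> positive"
  then have "end_sign (circle_step \<xi> e) = end_sign e + 1 + 1"
    using positive_in_ends[OF e] by (simp add: circle_step_def end_sign_smooth arcs_in_ends end_sign_arcs)
  then show "circle_step \<xi> e \<in> positive"
    using e by (simp add: positive_def circle_step_def smooth_in_ends arcs_in_ends)
qed

lemma inj_on_circle_step: "inj_on (circle_step \<xi>) positive"
proof (rule inj_onI)
  fix x y assume "x \<in> positive" "y \<in> positive" and eq: "circle_step \<xi> x = circle_step \<xi> y"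
  then have xy: "x \<in> ends D" "y \<in> ends D" by (simp_all add: positive_in_ends)
  have "arcs D x = smooth \<xi> (circle_step \<xi> x)" "arcs D y = smooth \<xi> (circle_step \<xi> y)"
    using xy by (simp_all add: circle_step_def smooth_smooth arcs_in_ends)
  then have "arcs D x = arcs D y" using eq by simp
  then show "x = y" using xy arcs_arcs by metis
qed

definition orbit :: "nat set \<Rightarrow> cend \<Rightarrow> cend set" where
  "orbit \<xi> e = reach (circle_step \<xi>) e"

lemma orbit_refl: "e \<in> orbit \<xi> e"
  by (simp add: orbit_def reach_refl)

lemma orbit_positive: "e \<in> positive \<Longrightarrow> orbit \<xi> e \<subseteq> positive"
  unfolding orbit_def by (rule reach_subset[OF _ circle_step_positive])

lemma orbit_eq: "e \<in> positive \<Longrightarrow> e' \<in> orbit \<xi> e \<Longrightarrow> orbit \<xi> e' = orbit \<xi> e"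
  unfolding orbit_def by (rule reach_eq[OF finite_positive inj_on_circle_step circle_step_positive])

text \<open>Each arc has exactly one positive end, so a circle consists of an orbit and the opposite
  ends of its arcs.\<close>

lemma circle_at_positive:
  assumes e: "e \<in> positive"
  shows "circle_at D \<xi> e = Circle (orbit \<xi> e \<union> arcs D ` orbit \<xi> e)"
proof -
  let ?R = "{(x, arcs D x) |x. True} \<union> {(x, smooth \<xi> x) |x. True}"
  have orbit_ends: "x \<in> ends D" if "x \<in> orbit \<xi> e" for x
    using orbit_positive[OF e] that positive_in_ends by blast
  have "?R\<^sup>* `` {e} = orbit \<xi> e \<union> arcs D ` orbit \<xi> e"
  proof
    show "?R\<^sup>* `` {e} \<subseteq> orbit \<xi> e \<union> arcs D ` orbit \<xi> e"
    proof
      fix x assume "x \<in> ?R\<^sup>* `` {e}"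
      then have "(e, x) \<in> ?R\<^sup>*" by simp
      then show "x \<in> orbit \<xi> e \<union> arcs D ` orbit \<xi> e"
      proof induction
        case base
        then show ?case by (simp add: orbit_refl)
      next
        case (step x y)
        from step(3) consider "x \<in> orbit \<xi> e" | z where "z \<in> orbit \<xi> e" "x = arcs D z" by auto
        then show ?case
        proof cases
          case 1
          have "circle_step \<xi> ` orbit \<xi> e = orbit \<xi> e"
            using bij_betw_reach[OF finite_positive inj_on_circle_step circle_step_positive e]
            by (simp add: bij_betw_def orbit_def)
          then obtain z where z: "z \<in> orbit \<xi> e" "x = circle_step \<xi> z" using 1 by (metis imageE)
          then have "smooth \<xi> x = arcs D z"
            using orbit_ends by (simp add: circle_step_def smooth_smooth arcs_in_ends)
          then show ?thesis using step(2) 1 z by auto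
        next
          case 2
          have "smooth \<xi> x \<in> orbit \<xi> e"
            using reach_step[of z "circle_step \<xi>" e] 2 by (simp add: orbit_def circle_step_def)
          moreover have "arcs D x = z" using 2 orbit_ends by (simp add: arcs_arcs)
          ultimately show ?thesis using step(2) 2 by auto
        qed
      qed
    qed
    have orbit_R: "(e, x) \<in> ?R\<^sup>*" if "x \<in> orbit \<xi> e" for x
    proof -
      have "(e, x) \<in> {(y, circle_step \<xi> y) |y. True}\<^sup>*" using that by (simp add: orbit_def reach_def)
      then show ?thesis
      proof induction
        case (step y z)
        have "(y, arcs D y) \<in> ?R" "(arcs D y, smooth \<xi> (arcs D y)) \<in> ?R" by blast+
        moreover have "z = smooth \<xi> (arcs D y)" using step(2) unfolding circle_step_def by blast
        ultimately show ?case using step(3) by (meson rtrancl.rtrancl_into_rtrancl)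
      qed simp
    qed
    have "(e, arcs D x) \<in> ?R\<^sup>*" if "x \<in> orbit \<xi> e" for x
      using orbit_R[OF that] by (rule rtrancl_into_rtrancl) blast
    with orbit_R show "orbit \<xi> e \<union> arcs D ` orbit \<xi> e \<subseteq> ?R\<^sup>* `` {e}" by blast
  qed
  then show ?thesis by (simp add: circle_at_def)
qed

lemma circle_at_smooth:
  assumes "e \<in> ends D"
  shows "circle_at D \<xi> (smooth \<xi> e) = circle_at D \<xi> e"
proof -
  let ?R = "{(x, arcs D x) |x. True} \<union> {(x, smooth \<xi> x) |x. True}"
  have "(e, smooth \<xi> e) \<in> ?R" by blast
  moreover have "(smooth \<xi> e, smooth \<xi> (smooth \<xi> e)) \<in> ?R" by blast
  then have "(smooth \<xi> e, e) \<in> ?R" by (simp only: smooth_smooth[OF assms])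
  ultimately have "?R\<^sup>* `` {e} = ?R\<^sup>* `` {smooth \<xi> e}"
    by (blast intro: converse_rtrancl_into_rtrancl)
  then show ?thesis by (simp add: circle_at_def)
qed

text \<open>Intersecting a circle with \<open>positive\<close> recovers the orbit.\<close>

lemma circle_at_eq_iff:
  assumes "x \<in> positive" "y \<in> positive"
  shows "circle_at D \<xi> x = circle_at D \<xi> y \<longleftrightarrow> x \<in> orbit \<xi> y"
proof
  have trace: "(orbit \<xi> z \<union> arcs D ` orbit \<xi> z) \<inter> positive = orbit \<xi> z" if "z \<in> positive" for z
    using orbit_positive[OF that] arcs_not_positive by blast
  assume "circle_at D \<xi> x = circle_at D \<xi> y"
  then have "orbit \<xi> x \<union> arcs D ` orbit \<xi> x = orbit \<xi> y \<union> arcs D ` orbit \<xi> y"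
    using assms by (simp add: circle_at_positive)
  then have "orbit \<xi> x = orbit \<xi> y" using trace assms by metis
  then show "x \<in> orbit \<xi> y" using orbit_refl[of x \<xi>] by simp
next
  assume "x \<in> orbit \<xi> y"
  then have "orbit \<xi> x = orbit \<xi> y" by (rule orbit_eq[OF assms(2)])
  then show "circle_at D \<xi> x = circle_at D \<xi> y" using assms by (simp add: circle_at_positive)
qed

text \<open>Together with \<open>end2\<close>, the positive ends at \<open>c\<close>: their parity
  is \<open>shade c\<close>. They lie on different arcs of both smoothings, so they represent the
  two arrow ends before the saddle as well as the two sides after it.\<close>

definition end1 :: "nat \<Rightarrow> cend" where
  "end1 c = (c, if shade c = 0 then 0 else 1)"

definition end2 :: "nat \<Rightarrow> cend" where
  "end2 c = (c, if shade c = 0 then 2 else 3)"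

text \<open>From a negative end at \<open>c\<close> the two smoothings lead to different positive
  ends, so changing the smoothing exchanges the destinations.\<close>

lemma circle_step_insert:
  assumes "c \<notin> \<xi>" "x \<in> positive"
  shows "circle_step (insert c \<xi>) x = (if circle_step \<xi> x = end1 c then end2 c
    else if circle_step \<xi> x = end2 c then end1 c else circle_step \<xi> x)"
proof (cases "fst (arcs D x) = c")
  case True
  have y: "arcs D x \<in> ends D" "end_sign (arcs D x) = 1"
    using assms(2) by (auto simp: positive_def arcs_in_ends end_sign_arcs)
  have "shade c + parity (arcs D x) = 1" using y(2) True by (simp add: end_sign_def)
  with y(1) show ?thesis using True assms(1)
    by (elim end_cases; cases "shade c")
      (auto simp: circle_step_def smooth_def split_beta end1_def end2_def parity_def)
next
  case False
  then have "smooth (insert c \<xi>) (arcs D x) = smooth \<xi> (arcs D x)"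
    by (auto simp: smooth_def split_beta)
  then have "circle_step (insert c \<xi>) x = circle_step \<xi> x" by (simp add: circle_step_def)
  moreover have "fst (circle_step \<xi> x) \<noteq> c" using False by (simp add: circle_step_def)
  then have "circle_step \<xi> x \<noteq> end1 c" "circle_step \<xi> x \<noteq> end2 c" by (auto simp: end1_def end2_def)
  ultimately show ?thesis by simp
qed

lemma end12_positive: "c < crossings D \<Longrightarrow> end1 c \<in> positive \<and> end2 c \<in> positive"
  by (cases "shade c") (auto simp: end1_def end2_def positive_def ends_def end_sign_def parity_def)

lemma swapped_permutation_circle_step:
  assumes "edge D \<xi> c"
  shows "swapped_permutation positive (circle_step \<xi>) (circle_step (insert c \<xi>)) (end1 c) (end2 c)"
proof
  show "circle_step (insert c \<xi>) ` positive \<subseteq> positive" "circle_step \<xi> ` positive \<subseteq> positive"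
    by (rule circle_step_positive)+
  show "end1 c \<in> positive" "end2 c \<in> positive" using end12_positive assms by (simp_all add: edge_def)
  show "end1 c \<noteq> end2 c" by (simp add: end1_def end2_def)
  show "circle_step (insert c \<xi>) x = (if circle_step \<xi> x = end1 c then end2 c
      else if circle_step \<xi> x = end2 c then end1 c else circle_step \<xi> x)" if "x \<in> positive" for x
    using circle_step_insert[OF _ that] assms by (simp add: edge_def)
qed (rule finite_positive inj_on_circle_step)+

text \<open>Only unordered pairs are compared: \<open>end1\<close> and \<open>end2\<close> follow
  the signs, not the arrow.\<close>

lemma tail_head_circles:
  assumes "edge D \<xi> c"
  shows "{circle_at D \<xi> (tail_end D c), circle_at D \<xi> (head_end D c)}
    = {circle_at D \<xi> (end1 c), circle_at D \<xi> (end2 c)}"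
proof -
  have ends: "(c, 0) \<in> ends D" "(c, 2) \<in> ends D" using assms by (auto simp: edge_def ends_def)
  have "smooth \<xi> (c, 0) = (c, 1)" "smooth \<xi> (c, 2) = (c, 3)" using assms by (auto simp: edge_def smooth_def)
  then have "circle_at D \<xi> (c, 1) = circle_at D \<xi> (c, 0)" "circle_at D \<xi> (c, 3) = circle_at D \<xi> (c, 2)"
    using circle_at_smooth[OF ends(1), of \<xi>] circle_at_smooth[OF ends(2), of \<xi>] by simp_all
  then show ?thesis by (auto simp: tail_end_def head_end_def end1_def end2_def)
qed

lemma left_right_circles:
  assumes "edge D \<xi> c"
  shows "{circle_at D (insert c \<xi>) (left_end D c), circle_at D (insert c \<xi>) (right_end D c)}
    = {circle_at D (insert c \<xi>) (end1 c), circle_at D (insert c \<xi>) (end2 c)}"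
proof -
  let ?\<xi> = "insert c \<xi>"
  have ends: "(c, 0) \<in> ends D" "(c, 1) \<in> ends D" using assms by (auto simp: edge_def ends_def)
  have "smooth ?\<xi> (c, 0) = (c, 3)" "smooth ?\<xi> (c, 1) = (c, 2)" by (auto simp: smooth_def)
  then have "circle_at D ?\<xi> (c, 3) = circle_at D ?\<xi> (c, 0)" "circle_at D ?\<xi> (c, 2) = circle_at D ?\<xi> (c, 1)"
    using circle_at_smooth[OF ends(1), of ?\<xi>] circle_at_smooth[OF ends(2), of ?\<xi>] by simp_all
  then show ?thesis by (auto simp: left_end_def right_end_def end1_def end2_def)
qed

definition source_circles :: "nat set \<Rightarrow> nat \<Rightarrow> circle set" where
  "source_circles \<xi> c = {circle_at D \<xi> (tail_end D c), circle_at D \<xi> (head_end D c)}"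

definition target_circles :: "nat set \<Rightarrow> nat \<Rightarrow> circle set" where
  "target_circles \<xi> c = {circle_at D (insert c \<xi>) (left_end D c), circle_at D (insert c \<xi>) (right_end D c)}"

text \<open>Excludes a saddle from one circle to one circle: composing with a transposition always
  changes whether its two points share a cycle.\<close>

lemma is_merge_iff:
  assumes "edge D \<xi> c"
  shows "is_merge D \<xi> c \<longleftrightarrow>
    circle_at D (insert c \<xi>) (left_end D c) = circle_at D (insert c \<xi>) (right_end D c)"
proof -
  interpret swapped_permutation positive "circle_step \<xi>" "circle_step (insert c \<xi>)" "end1 c" "end2 c"
    by (rule swapped_permutation_circle_step[OF assms])
  have "is_merge D \<xi> c \<longleftrightarrow> circle_at D \<xi> (end2 c) \<noteq> circle_at D \<xi> (end1 c)"
    using tail_head_circles[OF assms] by (auto simp: is_merge_def doubleton_eq_iff)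
  also have "\<dots> \<longleftrightarrow> circle_at D (insert c \<xi>) (end2 c) = circle_at D (insert c \<xi>) (end1 c)"
    using reach_merge_iff p_in q_in by (simp add: circle_at_eq_iff orbit_def)
  also have "\<dots> \<longleftrightarrow> circle_at D (insert c \<xi>) (left_end D c) = circle_at D (insert c \<xi>) (right_end D c)"
    using left_right_circles[OF assms] by (auto simp: doubleton_eq_iff)
  finally show ?thesis .
qed

text \<open>Circles away from the saddle keep the same set of ends, so they are literally equal in
  both resolutions; the union of the orbits at the saddle is preserved by
  \<open>reach_union\<close>.\<close>

lemma circle_at_edge:
  assumes "edge D \<xi> c" "x \<in> ends D"
  shows "circle_at D \<xi> x \<in> source_circles \<xi> c \<longleftrightarrow> circle_at D (insert c \<xi>) x \<in> target_circles \<xi> c"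
    and "circle_at D \<xi> x \<notin> source_circles \<xi> c \<Longrightarrow> circle_at D (insert c \<xi>) x = circle_at D \<xi> x"
proof -
  let ?\<xi> = "insert c \<xi>"
  interpret swapped_permutation positive "circle_step \<xi>" "circle_step ?\<xi>" "end1 c" "end2 c"
    by (rule swapped_permutation_circle_step[OF assms(1)])
  have source: "circle_at D \<xi> y \<in> source_circles \<xi> c \<longleftrightarrow> y \<in> orbit \<xi> (end1 c) \<union> orbit \<xi> (end2 c)"
    if "y \<in> positive" for y
    unfolding source_circles_def tail_head_circles[OF assms(1)] using that p_in q_in
    by (simp add: circle_at_eq_iff)
  have target: "circle_at D ?\<xi> y \<in> target_circles \<xi> c \<longleftrightarrow> y \<in> orbit ?\<xi> (end1 c) \<union> orbit ?\<xi> (end2 c)"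
    if "y \<in> positive" for y
    unfolding target_circles_def left_right_circles[OF assms(1)] using that p_in q_in
    by (simp add: circle_at_eq_iff)
  have pos: "circle_at D \<xi> y \<in> source_circles \<xi> c \<longleftrightarrow> circle_at D ?\<xi> y \<in> target_circles \<xi> c"
    if "y \<in> positive" for y
    using source[OF that] target[OF that] reach_union by (simp add: orbit_def)
  have pos_eq: "circle_at D ?\<xi> y = circle_at D \<xi> y"
    if y: "y \<in> positive" "circle_at D \<xi> y \<notin> source_circles \<xi> c" for y
  proof -
    have "end1 c \<notin> orbit \<xi> y" "end2 c \<notin> orbit \<xi> y"
      using y(2) circle_at_eq_iff[OF p_in y(1), of \<xi>] circle_at_eq_iff[OF q_in y(1), of \<xi>]
      unfolding source_circles_def tail_head_circles[OF assms(1)] by (metis insertI1 insertI2)+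
    then have "orbit ?\<xi> y = orbit \<xi> y" using reach_avoid[OF y(1)] by (simp add: orbit_def)
    then show ?thesis using y(1) by (simp add: circle_at_positive)
  qed
  have at_c: "circle_at D \<xi> x \<in> source_circles \<xi> c \<and> circle_at D ?\<xi> x \<in> target_circles \<xi> c" if x_at_c: "fst x = c"
  proof -
    have mem: "e \<in> {end1 c, end2 c}" if "e \<in> positive" "fst e = c" for e
      using that by (cases "shade c"; cases e)
        (auto simp: positive_def ends_def end_sign_def parity_def end1_def end2_def eval_nat_numeral less_Suc_eq)
    obtain e where "e \<in> positive" "circle_at D \<xi> x = circle_at D \<xi> e" "fst e = c"
      using positive_or_smooth[OF assms(2), of \<xi>] circle_at_smooth[OF assms(2), of \<xi>] x_at_c by (metis fst_smooth)
    moreover obtain e' where "e' \<in> positive" "circle_at D ?\<xi> x = circle_at D ?\<xi> e'" "fst e' = c"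
      using positive_or_smooth[OF assms(2), of ?\<xi>] circle_at_smooth[OF assms(2), of ?\<xi>] x_at_c by (metis fst_smooth)
    ultimately show ?thesis using mem[of e] mem[of e']
      unfolding source_circles_def target_circles_def tail_head_circles[OF assms(1)]
        left_right_circles[OF assms(1)] by auto
  qed
  \<comment> \<open>Away from \<open>c\<close> the smoothing is unchanged, so one positive
    representative serves both resolutions; at \<open>c\<close> two different ones may be
    needed.\<close>
  have away: "\<exists>e \<in> positive. circle_at D \<xi> x = circle_at D \<xi> e \<and> circle_at D ?\<xi> x = circle_at D ?\<xi> e"
    if "fst x \<noteq> c"
  proof -
    have "smooth ?\<xi> x = smooth \<xi> x" using that by (auto simp: smooth_def split_beta)
    then show ?thesis
      using positive_or_smooth[OF assms(2), of \<xi>] circle_at_smooth[OF assms(2), of \<xi>]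
        circle_at_smooth[OF assms(2), of ?\<xi>] by metis
  qed
  show "circle_at D \<xi> x \<in> source_circles \<xi> c \<longleftrightarrow> circle_at D ?\<xi> x \<in> target_circles \<xi> c"
    using at_c away pos by (cases "fst x = c") auto
  show "circle_at D \<xi> x \<notin> source_circles \<xi> c \<Longrightarrow> circle_at D ?\<xi> x = circle_at D \<xi> x"
    using at_c away pos_eq by (cases "fst x = c") auto
qed

lemma circles_edge:
  assumes "edge D \<xi> c"
  shows "source_circles \<xi> c \<subseteq> circles D \<xi>" "target_circles \<xi> c \<subseteq> circles D (insert c \<xi>)"
    and "circles D (insert c \<xi>) - target_circles \<xi> c = circles D \<xi> - source_circles \<xi> c"
proof -
  let ?\<xi> = "insert c \<xi>"
  have ends: "tail_end D c \<in> ends D" "head_end D c \<in> ends D" "left_end D c \<in> ends D" "right_end D c \<in> ends D"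
    using assms by (auto simp: edge_def ends_def tail_end_def head_end_def left_end_def right_end_def)
  then show "source_circles \<xi> c \<subseteq> circles D \<xi>" "target_circles \<xi> c \<subseteq> circles D ?\<xi>"
    by (auto simp: source_circles_def target_circles_def circles_def)
  have "Loop k \<notin> source_circles \<xi> c" "Loop k \<notin> target_circles \<xi> c" for k
    by (auto simp: source_circles_def target_circles_def circle_at_def)
  then show "circles D ?\<xi> - target_circles \<xi> c = circles D \<xi> - source_circles \<xi> c"
    using circle_at_edge[OF assms] by (auto simp: circles_def image_iff) metis+
qed

end

section \<open>Saddles\<close>

lemma edge_insert: "edge D \<xi> i \<Longrightarrow> edge D \<xi> j \<Longrightarrow> i \<noteq> j \<Longrightarrow> edge D (insert j \<xi>) i"
  by (auto simp: edge_def vertex_def)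

lemma distinct_length_eq: "distinct xs \<Longrightarrow> distinct ys \<Longrightarrow> set xs = set ys \<Longrightarrow> length xs = length ys"
  by (metis distinct_card)

locale ordered_diagram = diagram +
  fixes ord :: "nat set \<Rightarrow> circle list"
  assumes circle_order: "circle_order D ord"
begin

lemma edge_order:
  assumes "edge D \<xi> c"
  shows "distinct (ord \<xi>)" "set (ord \<xi>) = circles D \<xi>"
    and "distinct (ord (insert c \<xi>))" "set (ord (insert c \<xi>)) = circles D (insert c \<xi>)"
  using assms circle_order by (auto simp: circle_order_def edge_def vertex_def)

text \<open>After a merge both sides of the arrow lie on one circle, so the single name
  \<open>l\<close> describes the output, and \<open>rest\<close> is common to both families.\<close>

lemma merge_cases:
  assumes "edge D \<xi> c" "is_merge D \<xi> c"
  obtains h t l rest where "source_circles \<xi> c = {h, t}" "target_circles \<xi> c = {l}"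
    and "distinct (h # t # rest)" "set (h # t # rest) = set (ord \<xi>)"
    and "distinct (l # rest)" "set (l # rest) = set (ord (insert c \<xi>))"
    and "saddle D ord \<xi> c = permute 0 (ord \<xi>) (h # t # rest) @ [(0, Mu, length rest)]
      @ permute 0 (l # rest) (ord (insert c \<xi>))"
proof -
  define t h l r where "t = circle_at D \<xi> (tail_end D c)" and "h = circle_at D \<xi> (head_end D c)"
    and "l = circle_at D (insert c \<xi>) (left_end D c)" and "r = circle_at D (insert c \<xi>) (right_end D c)"
  define rest where "rest = filter (\<lambda>C. C \<noteq> t \<and> C \<noteq> h) (ord \<xi>)"
  have "t \<noteq> h" using assms(2) by (simp add: is_merge_def t_def h_def)
  have "r = l" using is_merge_iff[OF assms(1)] assms(2) by (simp add: l_def r_def)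
  have source: "source_circles \<xi> c = {h, t}" by (auto simp: source_circles_def t_def h_def)
  have target: "target_circles \<xi> c = {l}" using \<open>r = l\<close> by (simp add: target_circles_def l_def r_def)
  note order = edge_order[OF assms(1)]
  note circles = circles_edge[OF assms(1), unfolded source target]
  show thesis
  proof
    show "source_circles \<xi> c = {h, t}" "target_circles \<xi> c = {l}" by fact+
    have rest: "set rest = circles D (insert c \<xi>) - {l}" "set rest = circles D \<xi> - {h, t}" "distinct rest"
      using circles(3) order by (auto simp: rest_def)
    show "distinct (h # t # rest)" "distinct (l # rest)"
      using rest \<open>t \<noteq> h\<close> by (simp_all add: rest_def) (use rest(1) in \<open>auto simp: rest_def\<close>)
    show "set (h # t # rest) = set (ord \<xi>)" using rest(2) circles(1) order by auto
    show "set (l # rest) = set (ord (insert c \<xi>))" using rest(1) circles(2) order by auto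
    show "saddle D ord \<xi> c = permute 0 (ord \<xi>) (h # t # rest) @ [(0, Mu, length rest)]
        @ permute 0 (l # rest) (ord (insert c \<xi>))"
      using assms(2) by (simp add: saddle_def Let_def rest_def t_def h_def l_def)
  qed
qed

lemma split_cases:
  assumes "edge D \<xi> c" "\<not> is_merge D \<xi> c"
  obtains t l r rest where "source_circles \<xi> c = {t}" "target_circles \<xi> c = {l, r}"
    and "distinct (t # rest)" "set (t # rest) = set (ord \<xi>)"
    and "distinct (l # r # rest)" "set (l # r # rest) = set (ord (insert c \<xi>))"
    and "saddle D ord \<xi> c = permute 0 (ord \<xi>) (t # rest) @ [(0, Delta, length rest)]
      @ permute 0 (l # r # rest) (ord (insert c \<xi>))"
proof -
  define t h l r where "t = circle_at D \<xi> (tail_end D c)" and "h = circle_at D \<xi> (head_end D c)"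
    and "l = circle_at D (insert c \<xi>) (left_end D c)" and "r = circle_at D (insert c \<xi>) (right_end D c)"
  define rest where "rest = filter (\<lambda>C. C \<noteq> t \<and> C \<noteq> h) (ord \<xi>)"
  have "h = t" using assms(2) by (simp add: is_merge_def t_def h_def)
  have "l \<noteq> r" using is_merge_iff[OF assms(1)] assms(2) by (simp add: l_def r_def)
  have source: "source_circles \<xi> c = {t}" using \<open>h = t\<close> by (auto simp: source_circles_def t_def h_def)
  have target: "target_circles \<xi> c = {l, r}" by (simp add: target_circles_def l_def r_def)
  note order = edge_order[OF assms(1)]
  note circles = circles_edge[OF assms(1), unfolded source target]
  show thesis
  proof
    show "source_circles \<xi> c = {t}" "target_circles \<xi> c = {l, r}" by fact+
    have rest: "set rest = circles D (insert c \<xi>) - {l, r}" "set rest = circles D \<xi> - {t}" "distinct rest"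
      using circles(3) order \<open>h = t\<close> by (auto simp: rest_def)
    show "distinct (t # rest)" "distinct (l # r # rest)"
      using rest \<open>l \<noteq> r\<close> by (simp_all add: rest_def) (use rest(1) in \<open>auto simp: rest_def\<close>)
    show "set (t # rest) = set (ord \<xi>)" using rest(2) circles(1) order by auto
    show "set (l # r # rest) = set (ord (insert c \<xi>))" using rest(1) circles(2) order by auto
    show "saddle D ord \<xi> c = permute 0 (ord \<xi>) (t # rest) @ [(0, Delta, length rest)]
        @ permute 0 (l # r # rest) (ord (insert c \<xi>))"
      using assms(2) by (simp add: saddle_def Let_def rest_def t_def h_def l_def r_def)
  qed
qed

lemma length_ord_merge:
  assumes "edge D \<xi> c" "is_merge D \<xi> c"
  shows "length (ord \<xi>) = Suc (length (ord (insert c \<xi>)))"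
proof -
  obtain h t l rest where *: "distinct (h # t # rest)" "set (h # t # rest) = set (ord \<xi>)"
    "distinct (l # rest)" "set (l # rest) = set (ord (insert c \<xi>))"
    using merge_cases[OF assms] by metis
  show ?thesis
    using distinct_length_eq[OF *(1) edge_order(1)[OF assms(1)] *(2)]
      distinct_length_eq[OF *(3) edge_order(3)[OF assms(1)] *(4)] by simp
qed

lemma length_ord_split:
  assumes "edge D \<xi> c" "\<not> is_merge D \<xi> c"
  shows "length (ord (insert c \<xi>)) = Suc (length (ord \<xi>))"
proof -
  obtain t l r rest where *: "distinct (t # rest)" "set (t # rest) = set (ord \<xi>)"
    "distinct (l # r # rest)" "set (l # r # rest) = set (ord (insert c \<xi>))"
    using split_cases[OF assms] by metis
  show ?thesis
    using distinct_length_eq[OF *(1) edge_order(1)[OF assms(1)] *(2)]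
      distinct_length_eq[OF *(3) edge_order(3)[OF assms(1)] *(4)] by simp
qed

lemma cob_saddle:
  assumes "edge D \<xi> c"
  shows "cob (saddle D ord \<xi> c) (length (ord \<xi>)) (length (ord (insert c \<xi>)))"
proof (cases "is_merge D \<xi> c")
  case True
  obtain h t l rest where *: "distinct (h # t # rest)" "set (h # t # rest) = set (ord \<xi>)"
    "distinct (l # rest)" "set (l # rest) = set (ord (insert c \<xi>))"
    and saddle: "saddle D ord \<xi> c = permute 0 (ord \<xi>) (h # t # rest) @ [(0, Mu, length rest)]
      @ permute 0 (l # rest) (ord (insert c \<xi>))"
    using merge_cases[OF assms True] by metis
  have "cob (permute 0 (ord \<xi>) (h # t # rest)) (0 + length (ord \<xi>)) (0 + length (h # t # rest))"
    "cob (permute 0 (l # rest) (ord (insert c \<xi>))) (0 + length (l # rest)) (0 + length (ord (insert c \<xi>)))"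
    using * edge_order[OF assms] by (intro cob_permute; simp)+
  then show ?thesis unfolding saddle cob_append by (auto simp: eval_nat_numeral)
next
  case False
  obtain t l r rest where *: "distinct (t # rest)" "set (t # rest) = set (ord \<xi>)"
    "distinct (l # r # rest)" "set (l # r # rest) = set (ord (insert c \<xi>))"
    and saddle: "saddle D ord \<xi> c = permute 0 (ord \<xi>) (t # rest) @ [(0, Delta, length rest)]
      @ permute 0 (l # r # rest) (ord (insert c \<xi>))"
    using split_cases[OF assms False] by metis
  have "cob (permute 0 (ord \<xi>) (t # rest)) (0 + length (ord \<xi>)) (0 + length (t # rest))"
    "cob (permute 0 (l # r # rest) (ord (insert c \<xi>))) (0 + length (l # r # rest)) (0 + length (ord (insert c \<xi>)))"
    using * edge_order[OF assms] by (intro cob_permute; simp)+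
  then show ?thesis unfolding saddle cob_append by (auto simp: eval_nat_numeral)
qed

lemma saddle_word_saddle: "saddle_word (saddle D ord \<xi> c)"
  by (auto simp: saddle_word_def saddle_def Let_def simp del: permute.simps dest: twists_permute)

text \<open>One layer of a saddle is not a twist, hence the length minus one. It sits at position 0,
  where \<open>Mu\<close> contributes 1 and \<open>Delta\<close>, with \<open>length rest\<close>
  circles to its right, contributes the power \<open>Suc (length rest)\<close>, the number of
  circles before the split.\<close>

lemma word_scalar_saddle:
  assumes "edge D \<xi> c"
  shows "word_scalar t u (saddle D ord \<xi> c) = t ^ (length (saddle D ord \<xi> c) - 1)
    * (if is_merge D \<xi> c then 1 else (t * u) ^ length (ord \<xi>))"
proof (cases "is_merge D \<xi> c")
  case True
  then show ?thesis by (simp add: saddle_def Let_def word_scalar_permute power_add del: permute.simps)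
next
  case False
  obtain t' l r rest where *: "distinct (t' # rest)" "set (t' # rest) = set (ord \<xi>)"
    and saddle: "saddle D ord \<xi> c = permute 0 (ord \<xi>) (t' # rest) @ [(0, Delta, length rest)]
      @ permute 0 (l # r # rest) (ord (insert c \<xi>))"
    using split_cases[OF assms False] by metis
  have "length (ord \<xi>) = Suc (length rest)"
    using distinct_length_eq[OF *(1) edge_order(1)[OF assms] *(2)] by simp
  then show ?thesis using False by (simp add: saddle word_scalar_permute power_add mult_ac del: permute.simps)
qed

text \<open>If the saddle at \<open>i\<close> joins precisely the two circles born at
  \<open>j\<close>, then both ends of its arrow lie on the one circle that \<open>j\<close>
  splits.\<close>

lemma circle_at_both_ends:
  assumes "edge D \<xi> j" "edge D \<xi> i" "\<not> is_merge D \<xi> j"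
    and "source_circles (insert j \<xi>) i = target_circles \<xi> j"
  shows "\<not> is_merge D \<xi> i"
proof -
  have ends: "tail_end D i \<in> ends D" "head_end D i \<in> ends D"
    using assms(2) by (auto simp: edge_def ends_def tail_end_def head_end_def)
  have "circle_at D (insert j \<xi>) (tail_end D i) \<in> target_circles \<xi> j"
    "circle_at D (insert j \<xi>) (head_end D i) \<in> target_circles \<xi> j"
    using assms(4) by (auto simp: source_circles_def)
  then have "circle_at D \<xi> (tail_end D i) \<in> source_circles \<xi> j" "circle_at D \<xi> (head_end D i) \<in> source_circles \<xi> j"
    using circle_at_edge(1)[OF assms(1)] ends by auto
  then show ?thesis using assms(3) by (auto simp: source_circles_def is_merge_def)
qed

text \<open>Both orders end at the same vertex, and the circle counts agree after either first
  split; so the second saddles change the count in the same way.\<close>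

lemma merge_after_split:
  assumes "edge D \<xi> i" "edge D \<xi> j" "i \<noteq> j" "\<not> is_merge D \<xi> i" "\<not> is_merge D \<xi> j"
  shows "is_merge D (insert i \<xi>) j \<longleftrightarrow> is_merge D (insert j \<xi>) i"
proof -
  have edges: "edge D (insert i \<xi>) j" "edge D (insert j \<xi>) i"
    using assms edge_insert by auto
  have eq: "insert i (insert j \<xi>) = insert j (insert i \<xi>)" by (rule insert_commute)
  have len: "length (ord (insert i \<xi>)) = length (ord (insert j \<xi>))"
    using length_ord_split[OF assms(1,4)] length_ord_split[OF assms(2,5)] by simp
  show ?thesis
  proof (rule iffI; rule ccontr)
    assume "is_merge D (insert i \<xi>) j" "\<not> is_merge D (insert j \<xi>) i"
    from length_ord_merge[OF edges(1) this(1)] length_ord_split[OF edges(2) this(2)] len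
    show False by (simp add: eq)
  next
    assume "is_merge D (insert j \<xi>) i" "\<not> is_merge D (insert i \<xi>) j"
    from length_ord_merge[OF edges(2) this(1)] length_ord_split[OF edges(1) this(2)] len
    show False by (simp add: eq)
  qed
qed

end

section \<open>Saddles on labelled circles\<close>

locale cube_functor = ordered_diagram D ord + chron_params p
  for D ord and p :: "'k::comm_ring_1 params"
begin

text \<open>Phrased with labellings, so that consecutive saddles compose without tracking the chosen
  orders; labels away from the saddle persist.\<close>

lemma saddle_merge_basis:
  assumes "edge D \<xi> c" "is_merge D \<xi> c"
  obtains h t l where "source_circles \<xi> c = {h, t}" "h \<noteq> t" "target_circles \<xi> c = {l}"
    and "\<And>f. (f h, f t) \<noteq> (Vm, Vm) \<Longrightarrow> basis_to_basis (saddle D ord \<xi> c) (map f (ord \<xi>))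
      (map (f(l := if f h = Vp \<and> f t = Vp then Vp else Vm)) (ord (insert c \<xi>)))"
proof -
  obtain h t l rest where st: "source_circles \<xi> c = {h, t}" "target_circles \<xi> c = {l}"
    and *: "distinct (h # t # rest)" "set (h # t # rest) = set (ord \<xi>)"
    "distinct (l # rest)" "set (l # rest) = set (ord (insert c \<xi>))"
    and saddle: "saddle D ord \<xi> c = permute 0 (ord \<xi>) (h # t # rest) @ [(0, Mu, length rest)]
      @ permute 0 (l # rest) (ord (insert c \<xi>))"
    using merge_cases[OF assms] by metis
  show thesis
  proof
    fix f :: "circle \<Rightarrow> vgen" assume f: "(f h, f t) \<noteq> (Vm, Vm)"
    let ?f = "f(l := if f h = Vp \<and> f t = Vp then Vp else Vm)"
    have "basis_to_basis (permute 0 (ord \<xi>) (h # t # rest)) ([] @ map f (ord \<xi>)) ([] @ map f (h # t # rest))"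
      using * edge_order[OF assms(1)] by (intro basis_to_basis_permute) auto
    moreover have "basis_to_basis [(0, Mu, length rest)] ([f h, f t] @ map f rest)
        ([if f h = Vp \<and> f t = Vp then Vp else Vm] @ map f rest)"
      using f by (intro Mu_basis) auto
    moreover have "[if f h = Vp \<and> f t = Vp then Vp else Vm] @ map f rest = map ?f (l # rest)"
      using *(3) by auto
    moreover have "basis_to_basis (permute 0 (l # rest) (ord (insert c \<xi>)))
        ([] @ map ?f (l # rest)) ([] @ map ?f (ord (insert c \<xi>)))"
      using * edge_order[OF assms(1)] by (intro basis_to_basis_permute) auto
    ultimately show "basis_to_basis (saddle D ord \<xi> c) (map f (ord \<xi>)) (map ?f (ord (insert c \<xi>)))"
      unfolding saddle by (metis append_Cons append_Nil basis_to_basis_append list.simps(9))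
  qed (use st *(1) in auto)
qed

lemma saddle_split_basis:
  assumes "edge D \<xi> c" "\<not> is_merge D \<xi> c"
  obtains t l r where "target_circles \<xi> c = {l, r}" "l \<noteq> r" "t \<in> set (ord \<xi>)"
    and "\<And>f. f t = Vm \<Longrightarrow> basis_to_basis (saddle D ord \<xi> c) (map f (ord \<xi>))
      (map (f(l := Vm, r := Vm)) (ord (insert c \<xi>)))"
    and "\<And>f. f t = Vp \<Longrightarrow> \<exists>a \<in> monomials. \<exists>b \<in> monomials.
      Fword p (saddle D ord \<xi> c) (basis (map f (ord \<xi>)))
        = (\<lambda>s. a * basis (map (f(l := Vm, r := Vp)) (ord (insert c \<xi>))) s
             + b * basis (map (f(l := Vp, r := Vm)) (ord (insert c \<xi>))) s)"
proof -
  obtain t l r rest where st: "target_circles \<xi> c = {l, r}"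
    and *: "distinct (t # rest)" "set (t # rest) = set (ord \<xi>)"
    "distinct (l # r # rest)" "set (l # r # rest) = set (ord (insert c \<xi>))"
    and saddle: "saddle D ord \<xi> c = permute 0 (ord \<xi>) (t # rest) @ [(0, Delta, length rest)]
      @ permute 0 (l # r # rest) (ord (insert c \<xi>))"
    using split_cases[OF assms] by metis
  have first: "basis_to_basis (permute 0 (ord \<xi>) (t # rest)) (map f (ord \<xi>)) (f t # map f rest)" for f
    using basis_to_basis_permute[of "ord \<xi>" "t # rest" "[]" 0 f] * edge_order[OF assms(1)] by simp
  have last: "basis_to_basis (permute 0 (l # r # rest) (ord (insert c \<xi>)))
      ([x, y] @ map f rest) (map (f(l := x, r := y)) (ord (insert c \<xi>)))" for f x y
  proof -
    have "map (f(l := x, r := y)) (l # r # rest) = [x, y] @ map f rest" using *(3) by auto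
    then show ?thesis
      using basis_to_basis_permute[of "l # r # rest" "ord (insert c \<xi>)" "[]" 0 "f(l := x, r := y)"]
        * edge_order[OF assms(1)] by simp
  qed
  show thesis
  proof
    fix f :: "circle \<Rightarrow> vgen" assume f: "f t = Vm"
    have "basis_to_basis [(0, Delta, length rest)] (f t # map f rest) ([Vm, Vm] @ map f rest)"
      unfolding f by (rule Delta_basis_Vm) simp
    then show "basis_to_basis (saddle D ord \<xi> c) (map f (ord \<xi>)) (map (f(l := Vm, r := Vm)) (ord (insert c \<xi>)))"
      unfolding saddle using first last by (metis basis_to_basis_append)
  next
    fix f :: "circle \<Rightarrow> vgen" assume f: "f t = Vp"
    obtain a where a: "a \<in> monomials"
      "Fword p (permute 0 (ord \<xi>) (t # rest)) (basis (map f (ord \<xi>))) = (\<lambda>s. a * basis (Vp # map f rest) s)"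
      using first[of f] f by (auto simp: basis_to_basis_def)
    obtain b where b: "b \<in> monomials" "Fword p (permute 0 (l # r # rest) (ord (insert c \<xi>)))
        (basis ([Vm, Vp] @ map f rest)) = (\<lambda>s. b * basis (map (f(l := Vm, r := Vp)) (ord (insert c \<xi>))) s)"
      using last[of Vm Vp f] unfolding basis_to_basis_def by blast
    obtain d where d: "d \<in> monomials" "Fword p (permute 0 (l # r # rest) (ord (insert c \<xi>)))
        (basis ([Vp, Vm] @ map f rest)) = (\<lambda>s. d * basis (map (f(l := Vp, r := Vm)) (ord (insert c \<xi>))) s)"
      using last[of Vp Vm f] unfolding basis_to_basis_def by blast
    have "Fword p (saddle D ord \<xi> c) (basis (map f (ord \<xi>)))
        = (\<lambda>s. (a * b) * basis (map (f(l := Vm, r := Vp)) (ord (insert c \<xi>))) s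
             + (a * (pY p * pZ p) * d) * basis (map (f(l := Vp, r := Vm)) (ord (insert c \<xi>))) s)"
      unfolding saddle Fword_append a(2) Fword_scale
      by (subst Delta_basis_Vp, simp)
        (simp only: Fword_add Fword_scale b(2) d(2) distrib_left mult.assoc)
    moreover have "a * b \<in> monomials" "a * (pY p * pZ p) * d \<in> monomials"
      using a(1) b(1) d(1) by (simp_all add: mult_in_monomials Y_in_monomials Z_in_monomials)
    ultimately show "\<exists>a \<in> monomials. \<exists>b \<in> monomials.
        Fword p (saddle D ord \<xi> c) (basis (map f (ord \<xi>)))
          = (\<lambda>s. a * basis (map (f(l := Vm, r := Vp)) (ord (insert c \<xi>))) s
               + b * basis (map (f(l := Vp, r := Vm)) (ord (insert c \<xi>))) s)"
      by blast
  qed (use st * in auto)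
qed

end

section \<open>Faces of the cube\<close>

context cube_functor
begin

text \<open>Splitting v_+ places a single v_- on one of the two new circles, with a monomial
  coefficient each. The merge keeps both terms as basis tensors because its inputs never both carry
  v_-.\<close>

lemma path_split_merge:
  assumes e1: "edge D \<xi> j" and e2: "edge D (insert j \<xi>) i"
    and split: "\<not> is_merge D \<xi> j" and merge: "is_merge D (insert j \<xi>) i"
  obtains s1 s2 a b where "a \<in> monomials" "b \<in> monomials"
    and "Fword p (saddle D ord \<xi> j @ saddle D ord (insert j \<xi>) i) (basis (map (\<lambda>_. Vp) (ord \<xi>)))
      = (\<lambda>s. a * basis s1 s + b * basis s2 s)"
    and "source_circles (insert j \<xi>) i \<noteq> target_circles \<xi> j \<Longrightarrow> s1 \<noteq> s2"
proof -
  let ?\<xi> = "insert i (insert j \<xi>)"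
  obtain t l r where target: "target_circles \<xi> j = {l, r}" and lr: "l \<noteq> r"
    and split_Vp: "\<And>f. f t = Vp \<Longrightarrow> \<exists>a \<in> monomials. \<exists>b \<in> monomials.
      Fword p (saddle D ord \<xi> j) (basis (map f (ord \<xi>)))
        = (\<lambda>s. a * basis (map (f(l := Vm, r := Vp)) (ord (insert j \<xi>))) s
             + b * basis (map (f(l := Vp, r := Vm)) (ord (insert j \<xi>))) s)"
    by (rule saddle_split_basis[OF e1 split]) (rule that; assumption)
  obtain h t' m where source: "source_circles (insert j \<xi>) i = {h, t'}" and ht: "h \<noteq> t'"
    and m: "target_circles (insert j \<xi>) i = {m}"
    and merge_f: "\<And>f. (f h, f t') \<noteq> (Vm, Vm) \<Longrightarrow>
      basis_to_basis (saddle D ord (insert j \<xi>) i) (map f (ord (insert j \<xi>)))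
        (map (f(m := if f h = Vp \<and> f t' = Vp then Vp else Vm)) (ord ?\<xi>))"
    by (rule saddle_merge_basis[OF e2 merge]) (rule that; assumption)
  define f where "f x = (\<lambda>_. Vp)(x := Vm)" for x :: circle
  define g where "g x = (f x)(m := if f x h = Vp \<and> f x t' = Vp then Vp else Vm)" for x
  have f_lr: "(\<lambda>_. Vp)(l := Vm, r := Vp) = f l" "(\<lambda>_. Vp)(l := Vp, r := Vm) = f r"
    using lr by (auto simp: f_def)
  obtain a b where ab: "a \<in> monomials" "b \<in> monomials"
    and F1: "Fword p (saddle D ord \<xi> j) (basis (map (\<lambda>_. Vp) (ord \<xi>)))
      = (\<lambda>s. a * basis (map (f l) (ord (insert j \<xi>))) s + b * basis (map (f r) (ord (insert j \<xi>))) s)"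
    using split_Vp[of "\<lambda>_. Vp"] unfolding f_lr by blast
  have "\<exists>c \<in> monomials. Fword p (saddle D ord (insert j \<xi>) i) (basis (map (f x) (ord (insert j \<xi>))))
      = (\<lambda>s. c * basis (map (g x) (ord ?\<xi>)) s)" for x
  proof -
    have "(f x h, f x t') \<noteq> (Vm, Vm)" using ht by (auto simp: f_def)
    from merge_f[OF this] show ?thesis unfolding basis_to_basis_def g_def .
  qed
  then obtain c where c: "\<And>x. c x \<in> monomials"
    "\<And>x. Fword p (saddle D ord (insert j \<xi>) i) (basis (map (f x) (ord (insert j \<xi>))))
      = (\<lambda>s. c x * basis (map (g x) (ord ?\<xi>)) s)"
    by metis
  show thesis
  proof
    show "a * c l \<in> monomials" "b * c r \<in> monomials" using ab c(1) by (simp_all add: mult_in_monomials)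
    show "Fword p (saddle D ord \<xi> j @ saddle D ord (insert j \<xi>) i) (basis (map (\<lambda>_. Vp) (ord \<xi>)))
      = (\<lambda>s. a * c l * basis (map (g l) (ord ?\<xi>)) s + b * c r * basis (map (g r) (ord ?\<xi>)) s)"
      by (simp add: Fword_append F1 Fword_add Fword_scale c(2) mult.assoc)
    assume "source_circles (insert j \<xi>) i \<noteq> target_circles \<xi> j"
    then have ne: "{h, t'} \<noteq> {l, r}" by (simp add: source target)
    note circles = circles_edge[OF e1, unfolded target] circles_edge[OF e2, unfolded source m]
    have "\<exists>C \<in> circles D ?\<xi>. g l C \<noteq> g r C"
    \<comment> \<open>If the merge absorbs exactly one of the two circles, the label of the merged
      circle distinguishes the terms; if it absorbs neither, the surviving \<open>l\<close>
      does.\<close>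
    proof (cases "l \<in> {h, t'} \<or> r \<in> {h, t'}")
      case True
      then have "g l m \<noteq> g r m" using ne lr ht by (auto simp: g_def f_def)
      then show ?thesis using circles(5) by blast
    next
      case False
      then have "l \<in> circles D ?\<xi> - {m}" using circles(2,6) by auto
      then show ?thesis using lr False by (intro bexI[of _ l]) (auto simp: g_def f_def)
    qed
    then show "map (g l) (ord ?\<xi>) \<noteq> map (g r) (ord ?\<xi>)"
      using edge_order(4)[OF e2] by auto
  qed
qed

lemma saddle_merge_Vp:
  assumes "edge D \<xi> c" "is_merge D \<xi> c"
  shows "basis_to_basis (saddle D ord \<xi> c) (map (\<lambda>_. Vp) (ord \<xi>)) (map (\<lambda>_. Vp) (ord (insert c \<xi>)))"
proof -
  obtain h t l where f: "\<And>f. (f h, f t) \<noteq> (Vm, Vm) \<Longrightarrow> basis_to_basis (saddle D ord \<xi> c) (map f (ord \<xi>))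
      (map (f(l := if f h = Vp \<and> f t = Vp then Vp else Vm)) (ord (insert c \<xi>)))"
    by (rule saddle_merge_basis[OF assms]) (rule that; assumption)
  have "(\<lambda>_. Vp)(l := Vp) = (\<lambda>_. Vp)" by auto
  then show ?thesis using f[of "\<lambda>_. Vp"] by simp
qed

lemma saddle_split_Vm:
  assumes "edge D \<xi> c" "\<not> is_merge D \<xi> c"
  shows "basis_to_basis (saddle D ord \<xi> c) (map (\<lambda>_. Vm) (ord \<xi>)) (map (\<lambda>_. Vm) (ord (insert c \<xi>)))"
proof -
  obtain t l r where f: "\<And>f. f t = Vm \<Longrightarrow> basis_to_basis (saddle D ord \<xi> c) (map f (ord \<xi>))
      (map (f(l := Vm, r := Vm)) (ord (insert c \<xi>)))"
    by (rule saddle_split_basis[OF assms]) (rule that; assumption)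
  have "(\<lambda>_. Vm)(l := Vm, r := Vm) = (\<lambda>_. Vm)" by auto
  then show ?thesis using f[of "\<lambda>_. Vm"] by simp
qed

text \<open>The test vector is all v_+ if a merge occurs and all v_- for two splits. In the
  split-merge case \<open>regular\<close> keeps the two monomials on different basis tensors, so one
  of them is a coefficient by itself.\<close>

lemma path_unit_coefficient:
  assumes e1: "edge D \<xi> j" and e2: "edge D (insert j \<xi>) i"
    and regular: "\<not> is_merge D \<xi> j \<Longrightarrow> is_merge D (insert j \<xi>) i \<Longrightarrow>
      source_circles (insert j \<xi>) i \<noteq> target_circles \<xi> j"
  shows "\<exists>s s'. length s = length (ord \<xi>) \<and>
    Fword p (saddle D ord \<xi> j @ saddle D ord (insert j \<xi>) i) (basis s) s' dvd 1"
proof -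
  let ?\<xi> = "insert i (insert j \<xi>)"
  let ?W = "saddle D ord \<xi> j @ saddle D ord (insert j \<xi>) i"
  have basis_to_basis: ?thesis if bb: "basis_to_basis ?W s s'" "length s = length (ord \<xi>)" for s s'
  proof -
    obtain c where "c \<in> monomials" "Fword p ?W (basis s) = (\<lambda>s. c * basis s' s)"
      using bb unfolding basis_to_basis_def by blast
    then have "Fword p ?W (basis s) s' dvd 1" by (simp add: basis_def monomials_dvd_1)
    then show ?thesis using bb(2) by blast
  qed
  consider "is_merge D \<xi> j" "is_merge D (insert j \<xi>) i" | "is_merge D \<xi> j" "\<not> is_merge D (insert j \<xi>) i"
    | "\<not> is_merge D \<xi> j" "\<not> is_merge D (insert j \<xi>) i" | "\<not> is_merge D \<xi> j" "is_merge D (insert j \<xi>) i"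
    by blast
  then show ?thesis
  proof cases
    case 1
    have "basis_to_basis (saddle D ord \<xi> j) (map (\<lambda>_. Vp) (ord \<xi>)) (map (\<lambda>_. Vp) (ord (insert j \<xi>)))"
      by (rule saddle_merge_Vp[OF e1 1(1)])
    moreover have "basis_to_basis (saddle D ord (insert j \<xi>) i) (map (\<lambda>_. Vp) (ord (insert j \<xi>)))
        (map (\<lambda>_. Vp) (ord ?\<xi>))"
      by (rule saddle_merge_Vp[OF e2 1(2)])
    ultimately show ?thesis by (intro basis_to_basis) (auto intro: basis_to_basis_append)
  next
    case 2
    have "basis_to_basis (saddle D ord \<xi> j) (map (\<lambda>_. Vp) (ord \<xi>)) (map (\<lambda>_. Vp) (ord (insert j \<xi>)))"
      by (rule saddle_merge_Vp[OF e1 2(1)])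
    then obtain c where c: "c \<in> monomials" "Fword p (saddle D ord \<xi> j) (basis (map (\<lambda>_. Vp) (ord \<xi>)))
        = (\<lambda>s. c * basis (map (\<lambda>_. Vp) (ord (insert j \<xi>))) s)"
      unfolding basis_to_basis_def by blast
    obtain t l r where target: "target_circles (insert j \<xi>) i = {l, r}" and lr: "l \<noteq> r"
      and split_Vp: "\<And>f. f t = Vp \<Longrightarrow> \<exists>a \<in> monomials. \<exists>b \<in> monomials.
        Fword p (saddle D ord (insert j \<xi>) i) (basis (map f (ord (insert j \<xi>))))
          = (\<lambda>s. a * basis (map (f(l := Vm, r := Vp)) (ord ?\<xi>)) s
               + b * basis (map (f(l := Vp, r := Vm)) (ord ?\<xi>)) s)"
      by (rule saddle_split_basis[OF e2 2(2)]) (rule that; assumption)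
    obtain a b where ab: "a \<in> monomials"
      "Fword p (saddle D ord (insert j \<xi>) i) (basis (map (\<lambda>_. Vp) (ord (insert j \<xi>))))
          = (\<lambda>s. a * basis (map ((\<lambda>_. Vp)(l := Vm, r := Vp)) (ord ?\<xi>)) s
               + b * basis (map ((\<lambda>_. Vp)(l := Vp, r := Vm)) (ord ?\<xi>)) s)"
      using split_Vp[of "\<lambda>_. Vp"] by blast
    \<comment> \<open>The two labellings give different lists only because \<open>l\<close> occurs
      in the order.\<close>
    have "l \<in> set (ord ?\<xi>)" using edge_order(4)[OF e2] circles_edge(2)[OF e2] target by auto
    then have "map ((\<lambda>_. Vp)(l := Vm, r := Vp)) (ord ?\<xi>) \<noteq> map ((\<lambda>_. Vp)(l := Vp, r := Vm)) (ord ?\<xi>)"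
      using lr by auto
    then have "basis (map ((\<lambda>_. Vp)(l := Vp, r := Vm)) (ord ?\<xi>)) (map ((\<lambda>_. Vp)(l := Vm, r := Vp)) (ord ?\<xi>)) = (0 :: 'k)"
      unfolding basis_def by (rule if_not_P)
    then have "Fword p ?W (basis (map (\<lambda>_. Vp) (ord \<xi>))) (map ((\<lambda>_. Vp)(l := Vm, r := Vp)) (ord ?\<xi>)) = c * a"
      by (simp only: Fword_append c(2) Fword_scale ab(2)) (simp add: basis_def del: fun_upd_apply map_eq_conv)
    moreover have "c * a dvd 1" using c(1) ab(1) by (simp add: monomials_dvd_1 mult_dvd_1)
    ultimately have "length (map (\<lambda>_. Vp) (ord \<xi>)) = length (ord \<xi>) \<and> Fword p ?W
        (basis (map (\<lambda>_. Vp) (ord \<xi>))) (map ((\<lambda>_. Vp)(l := Vm, r := Vp)) (ord ?\<xi>)) dvd 1"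
      by simp
    then show ?thesis by blast
  next
    case 3
    have "basis_to_basis (saddle D ord \<xi> j) (map (\<lambda>_. Vm) (ord \<xi>)) (map (\<lambda>_. Vm) (ord (insert j \<xi>)))"
      by (rule saddle_split_Vm[OF e1 3(1)])
    moreover have "basis_to_basis (saddle D ord (insert j \<xi>) i) (map (\<lambda>_. Vm) (ord (insert j \<xi>)))
        (map (\<lambda>_. Vm) (ord ?\<xi>))"
      by (rule saddle_split_Vm[OF e2 3(2)])
    ultimately show ?thesis by (intro basis_to_basis) (auto intro: basis_to_basis_append)
  next
    case 4
    obtain s1 s2 a b where ab: "a \<in> monomials" "b \<in> monomials"
      and F: "Fword p ?W (basis (map (\<lambda>_. Vp) (ord \<xi>))) = (\<lambda>s. a * basis s1 s + b * basis s2 s)"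
      and ne: "source_circles (insert j \<xi>) i \<noteq> target_circles \<xi> j \<Longrightarrow> s1 \<noteq> s2"
      by (rule path_split_merge[OF e1 e2 4]) (rule that; assumption)
    have "Fword p ?W (basis (map (\<lambda>_. Vp) (ord \<xi>))) s1 dvd 1"
      using F ne[OF regular[OF 4]] monomials_dvd_1[OF ab(1)] by (simp add: basis_def)
    then show ?thesis by (intro exI[of _ "map (\<lambda>_. Vp) (ord \<xi>)"] exI[of _ s1]) simp
  qed
qed

end

text \<open>Used contrapositively: off the faces with the local rule, a split followed by a merge
  never rejoins exactly the two new circles.\<close>

lemma (in ordered_diagram) ladybugI:
  assumes "face D \<xi> i j" "\<not> is_merge D \<xi> j" "is_merge D (insert j \<xi>) i"
    and "source_circles (insert j \<xi>) i = target_circles \<xi> j"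
  shows "ladybug D \<xi> i j"
proof -
  have edges: "edge D \<xi> i" "edge D \<xi> j" "i \<noteq> j" using assms(1) by (auto simp: face_def)
  have i: "\<not> is_merge D \<xi> i" by (rule circle_at_both_ends[OF edges(2,1) assms(2,4)])
  then show ?thesis using merge_after_split[OF edges i assms(2)] assms(2,3) by (simp add: ladybug_def)
qed

section \<open>Parity of twists on a face with the local rule\<close>

lemma unit_cancel: "c dvd (1 :: 'k::comm_ring_1) \<Longrightarrow> c * a = c * b \<Longrightarrow> a = b"
  by (metis dvdE mult.assoc mult.commute mult_1_left)

text \<open>A basis tensor is an eigenvector of the rescaling, so the inner factor leaves the
  functor.\<close>

lemma (in twisted_params) Fword_rescale_basis:
  assumes "saddle_word w"
  shows "rescale r s * Fword p w (basis s0) s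
    = word_scalar t u w * (rescale r s0 * Fword p' w (basis s0) s)"
proof -
  have "(\<lambda>s. rescale r s * basis s0 s) = (\<lambda>s. rescale r s0 * basis s0 s)" by (auto simp: basis_def)
  then show ?thesis
    using Fword_rescale[OF assms, of s "basis s0"] by (simp only: Fword_scale)
qed

section \<open>Change of the coefficient ring\<close>

locale unital_hom =
  fixes \<theta> :: "'k::comm_ring_1 \<Rightarrow> 'l::comm_ring_1"
  assumes hom_one: "\<theta> 1 = 1" and hom_add: "\<theta> (a + b) = \<theta> a + \<theta> b" and hom_mult: "\<theta> (a * b) = \<theta> a * \<theta> b"
begin

lemma hom_zero: "\<theta> 0 = 0"
  using hom_add[of 0 0] by simp

lemma hom_sum: "\<theta> (sum f A) = (\<Sum>x\<in>A. \<theta> (f x))"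
  by (induction A rule: infinite_finite_induct) (simp_all add: hom_zero hom_add)

lemma hom_power: "\<theta> (a ^ n) = \<theta> a ^ n"
  by (induction n) (simp_all add: hom_one hom_mult)

lemma hom_upow:
  assumes "a dvd 1"
  shows "\<theta> (upow a k) = upow (\<theta> a) k"
proof -
  obtain b where b: "a * b = 1" using assms by (metis dvdE)
  have "\<theta> a * \<theta> b = 1" using hom_mult[of a b] by (simp add: b hom_one)
  from upow_inverse[OF this] upow_inverse[OF b] show ?thesis by (simp add: hom_power)
qed

end

text \<open>The matrix entries of the functor are ring expressions in the parameters and their
  inverses, so a unital homomorphism maps them to the entries for the image parameters.\<close>

locale params_hom = unital_hom \<theta> + chron_params p
  for \<theta> :: "'k::comm_ring_1 \<Rightarrow> 'l::comm_ring_1" and p :: "'k params"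
begin

lemma hom_lam: "\<theta> (lam p d e) = lam (map_params \<theta> p) d e"
  by (simp add: lam_def split_beta hom_mult hom_upow X_dvd_1 Y_dvd_1 Z_dvd_1 params.map_sel)

lemma hom_Fgen: "\<theta> (Fgen p g s s') = Fgen (map_params \<theta> p) g s s'"
  by (cases "(p, g, s)" rule: Fgen.cases)
    (auto simp: basis_def hom_one hom_zero hom_add hom_mult hom_lam params.map_sel)

lemma hom_Flayer: "\<theta> (Flayer p l v s) = Flayer (map_params \<theta> p) l (\<lambda>s. \<theta> (v s)) s"
  by (cases l) (simp add: Flayer_def hom_zero hom_sum hom_mult hom_lam hom_Fgen)

lemma hom_Fword: "\<theta> (Fword p w v s) = Fword (map_params \<theta> p) w (\<lambda>s. \<theta> (v s)) s"
  by (induction w arbitrary: v) (simp_all add: Fword_Cons hom_Flayer)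

lemma hom_Fword_basis: "\<theta> (Fword p w (basis s0) s) = Fword (map_params \<theta> p) w (basis s0) s"
proof -
  have "(\<lambda>s. \<theta> (basis s0 s)) = basis s0" by (auto simp: basis_def hom_one hom_zero)
  then show ?thesis by (simp add: hom_Fword)
qed

end

text \<open>\<open>a = b\<close> in \<open>bit\<close> means that a + b is even, so this is e^(a +
  b) when e^2 = 1.\<close>

fun specialize_key :: "int \<Rightarrow> bit \<times> bit \<times> int \<Rightarrow> int" where
  "specialize_key e (a, b, c) = (if a = b then 1 else e)"

text \<open>The ring homomorphism to the integers with \<open>X, Y \<mapsto> e\<close> and \<open>Z \<mapsto> 1\<close>, for \<open>e = 1\<close> or \<open>e = - 1\<close>.\<close>

definition specialize :: "int \<Rightarrow> kring \<Rightarrow> int" where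
  "specialize e f = (\<Sum>m\<in>Poly_Mapping.keys f. Poly_Mapping.lookup f m * specialize_key e m)"

lemma specialize_superset:
  assumes "finite S" "Poly_Mapping.keys f \<subseteq> S"
  shows "specialize e f = (\<Sum>m\<in>S. Poly_Mapping.lookup f m * specialize_key e m)"
  unfolding specialize_def using assms by (intro sum.mono_neutral_left) (auto simp: in_keys_iff)

lemma specialize_add: "specialize e (f + g) = specialize e f + specialize e g"
proof -
  let ?S = "Poly_Mapping.keys f \<union> Poly_Mapping.keys g"
  have "specialize e h = (\<Sum>m\<in>?S. Poly_Mapping.lookup h m * specialize_key e m)"
    if "Poly_Mapping.keys h \<subseteq> ?S" for h
    using that by (intro specialize_superset) auto
  then show ?thesis
    using Poly_Mapping.keys_add[of f g] by (simp add: lookup_add distrib_right sum.distrib)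
qed

lemma specialize_single: "specialize e (Poly_Mapping.single m c) = c * specialize_key e m"
  using specialize_superset[of "{m}" "Poly_Mapping.single m c" e] by simp

lemma specialize_key_add:
  "e * e = 1 \<Longrightarrow> specialize_key e (m + m') = specialize_key e m * specialize_key e m'"
proof -
  assume e: "e * e = 1"
  obtain a b c a' b' c' where m: "m = (a, b, c)" "m' = (a', b', c')" by (metis prod_cases3)
  show ?thesis unfolding m
    by (cases a; cases b; cases a'; cases b') (simp_all add: e)
qed

text \<open>Multiplicativity is reduced to monomials by bilinear expansion; there it holds because
  e^2 = 1 allows exponents modulo 2.\<close>

lemma specialize_unital_hom:
  assumes e: "e * e = 1"
  shows "unital_hom (specialize e)"
proof
  have hom_zero: "specialize e 0 = 0" by (simp add: specialize_def)
  have hom_sum: "specialize e (sum h A) = (\<Sum>x\<in>A. specialize e (h x))" for h :: "'a \<Rightarrow> kring" and A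
    by (induction A rule: infinite_finite_induct) (simp_all add: specialize_add hom_zero)
  have hom_sum2: "specialize e (sum h A) = (\<Sum>x\<in>A. specialize e (h x))"
    for h :: "bit \<times> bit \<times> int \<Rightarrow> kring" and A
    by (induction A rule: infinite_finite_induct) (simp_all add: specialize_add hom_zero)
  have expand: "f = (\<Sum>m\<in>Poly_Mapping.keys f. Poly_Mapping.single m (Poly_Mapping.lookup f m))" for f :: kring
    by (rule poly_mapping_eqI) (simp add: lookup_sum lookup_single when_def in_keys_iff)
  show "specialize e (f * g) = specialize e f * specialize e g" for f g
  proof -
    let ?f = "Poly_Mapping.lookup f" and ?g = "Poly_Mapping.lookup g"
    have "f * g = (\<Sum>m\<in>Poly_Mapping.keys f. Poly_Mapping.single m (?f m))
        * (\<Sum>m'\<in>Poly_Mapping.keys g. Poly_Mapping.single m' (?g m'))"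
      using expand[of f] expand[of g] by simp
    also have "\<dots> = (\<Sum>m\<in>Poly_Mapping.keys f. \<Sum>m'\<in>Poly_Mapping.keys g.
        Poly_Mapping.single (m + m') (?f m * ?g m'))"
      by (simp only: sum_product mult_single)
    finally have "specialize e (f * g) = (\<Sum>m\<in>Poly_Mapping.keys f. \<Sum>m'\<in>Poly_Mapping.keys g.
        (?f m * specialize_key e m) * (?g m' * specialize_key e m'))"
      by (simp only: hom_sum2 specialize_single specialize_key_add[OF e] mult_ac)
    then show ?thesis unfolding specialize_def by (simp only: sum_product)
  qed
  have "specialize e (Poly_Mapping.single 0 1) = 1"
    by (simp only: specialize_single) (simp add: zero_prod_def)
  then show "specialize e 1 = 1" by simp
qed (rule specialize_add)

lemma kX_square: "kX * kX = 1" and kY_square: "kY * kY = 1"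
  and kZ_inverse: "kZ * Poly_Mapping.single (0, 0, -1) 1 = 1"
  by (simp_all add: kX_def kY_def kZ_def mult_single flip: zero_prod_def)

lemma chron_params_generic: "chron_params (Params kX kY kZ)"
  by standard (simp_all add: kX_square kY_square dvdI[OF kZ_inverse[symmetric]])

lemma specialize_generators:
  "specialize e kX = e" "specialize e kY = e" "specialize e kZ = 1"
  by (simp_all add: kX_def kY_def kZ_def specialize_single)

section \<open>Twist counts along the two paths of a face\<close>

context ordered_diagram
begin

definition path_word :: "nat set \<Rightarrow> nat \<Rightarrow> nat \<Rightarrow> word" where
  "path_word \<xi> i j = saddle D ord \<xi> i @ saddle D ord (insert i \<xi>) j"

definition path_twists :: "nat set \<Rightarrow> nat \<Rightarrow> nat \<Rightarrow> nat" where
  "path_twists \<xi> i j = (length (saddle D ord \<xi> i) - 1) + (length (saddle D ord (insert i \<xi>) j) - 1)"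

lemma saddle_word_path_word: "saddle_word (path_word \<xi> i j)"
  using saddle_word_saddle unfolding saddle_word_def path_word_def set_append ball_Un by blast

lemma cob_path_word:
  assumes "edge D \<xi> i" "edge D \<xi> j" "i \<noteq> j"
  shows "cob (path_word \<xi> i j) (length (ord \<xi>)) (length (ord (insert i (insert j \<xi>))))"
  using cob_saddle[OF assms(1)] cob_saddle[OF edge_insert[OF assms(2,1)]] assms(3)
  by (auto simp: path_word_def cob_append insert_commute)

text \<open>The split starts from \<open>length (ord \<xi>)\<close> circles whichever crossing comes
  first, so the scalars of the two paths can differ only through the number of twists.\<close>

lemma word_scalar_path_word:
  assumes "edge D \<xi> i" "edge D \<xi> j" "i \<noteq> j" "\<not> is_merge D \<xi> i" "is_merge D (insert i \<xi>) j"
  shows "word_scalar t u (path_word \<xi> i j) = t ^ path_twists \<xi> i j * (t * u) ^ length (ord \<xi>)"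
  using word_scalar_saddle[OF assms(1), of t u] word_scalar_saddle[OF edge_insert[OF assms(2,1)], of t u] assms(3-5)
  by (simp add: path_word_def path_twists_def power_add mult_ac)

text \<open>With X = Y = e and e^2 = 1 the value \<open>\<psi>\<close> becomes 1, so both paths have
  equal integer coefficients for e = 1 and for e = -1. The rescaling relates the two specialisations
  by a sign depending on the path, and a nonzero coefficient forces the two signs to agree.\<close>

lemma ladybug_path_twists:
  assumes face: "face D \<xi> i j" and ladybug: "ladybug D \<xi> i j" and \<psi>: "\<psi> \<in> {1, kX * kY}"
    and eq: "\<And>s. Fword (Params kX kY kZ) (path_word \<xi> i j) (basis (map (\<lambda>_. Vp) (ord \<xi>))) s
      = \<psi> * Fword (Params kX kY kZ) (path_word \<xi> j i) (basis (map (\<lambda>_. Vp) (ord \<xi>))) s"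
  shows "even (path_twists \<xi> i j) \<longleftrightarrow> even (path_twists \<xi> j i)"
proof -
  let ?b = "map (\<lambda>_. Vp) (ord \<xi>)"
  let ?F = "\<lambda>e. Fword (Params e e (1 :: int))"
  have edges: "edge D \<xi> i" "edge D \<xi> j" "i \<noteq> j" using face by (auto simp: face_def)
  have splits: "\<not> is_merge D \<xi> i" "\<not> is_merge D \<xi> j" and merges: "is_merge D (insert i \<xi>) j" "is_merge D (insert j \<xi>) i"
    using ladybug merge_after_split[OF edges] by (auto simp: ladybug_def)
  have F_eq: "?F e (path_word \<xi> i j) (basis ?b) s = ?F e (path_word \<xi> j i) (basis ?b) s" if e: "e * e = 1" for e s
  proof -
    interpret unital_hom "specialize e" by (rule specialize_unital_hom[OF e])
    interpret chron_params "Params kX kY kZ" by (rule chron_params_generic)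
    interpret params_hom "specialize e" "Params kX kY kZ" ..
    have "specialize e \<psi> = 1" using \<psi> e by (auto simp: hom_one hom_mult specialize_generators)
    then show ?thesis
      using arg_cong[OF eq[of s], of "specialize e"]
      by (simp add: hom_mult hom_Fword_basis specialize_generators)
  qed
  interpret twisted_params "Params 1 1 (1 :: int)" "Params (-1) (-1) 1" "-1" 1
    by standard simp_all
  interpret cube_functor D ord "Params 1 1 (1 :: int)" ..
  \<comment> \<open>With all parameters 1 both coefficients are 1, so their sum is nonzero even when
    the two basis tensors coincide.\<close>
  have monomials: "monomials = {1}" by (auto simp: monomials_def)
  obtain s1 s2 a b where "a \<in> monomials" "b \<in> monomials"
    "?F 1 (path_word \<xi> j i) (basis ?b) = (\<lambda>s. a * basis s1 s + b * basis s2 s)"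
    by (rule path_split_merge[OF edges(2) edge_insert[OF edges] splits(2) merges(2), folded path_word_def])
      (rule that; assumption)
  then have nonzero: "?F 1 (path_word \<xi> j i) (basis ?b) s1 \<noteq> 0"
    by (simp add: monomials basis_def)
  have rescaled: "rescale (- 1) s1 * ?F 1 w (basis ?b) s1
      = word_scalar (- 1) 1 w * (rescale (- 1) ?b * ?F (- 1) w (basis ?b) s1)" if "saddle_word w" for w
    using Fword_rescale_basis[OF that, of s1 ?b] by simp
  have "rescale (- 1) s1 * rescale (- 1) s1 = (1 :: int)" by (rule rescale_square) simp
  then have "rescale (- 1) s1 \<noteq> (0 :: int)" by auto
  then have "word_scalar (- 1) 1 (path_word \<xi> i j) = (word_scalar (- 1) 1 (path_word \<xi> j i) :: int)"
    using rescaled[OF saddle_word_path_word, of \<xi> i j] rescaled[OF saddle_word_path_word, of \<xi> j i]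
      F_eq[of 1 s1] F_eq[of "- 1" s1] nonzero by auto
  then have "(- 1) ^ path_twists \<xi> i j = ((- 1) ^ path_twists \<xi> j i :: int)"
    by (simp add: word_scalar_path_word edges splits merges edges(3)[symmetric])
  then show ?thesis by (metis minus_one_power_iff one_neq_neg_one)
qed

end

section \<open>Isomorphism of the complexes\<close>

text \<open>The cube is contractible: its directions are added one at a time, and \<open>h\<close>
  is extended to the new half along the edges in the new direction.\<close>

lemma ex_coboundary:
  fixes \<eta> :: "nat set \<Rightarrow> nat \<Rightarrow> 'k::comm_ring_1"
  assumes unit: "\<And>\<xi> c. \<xi> \<subseteq> {..<n} \<Longrightarrow> c < n \<Longrightarrow> c \<notin> \<xi> \<Longrightarrow> \<eta> \<xi> c dvd 1"
    and cocycle: "\<And>\<xi> i j. \<xi> \<subseteq> {..<n} \<Longrightarrow> i < j \<Longrightarrow> j < n \<Longrightarrow> i \<notin> \<xi> \<Longrightarrow> j \<notin> \<xi> \<Longrightarrow>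
      \<eta> (insert i \<xi>) j * \<eta> \<xi> i = \<eta> (insert j \<xi>) i * \<eta> \<xi> j"
  obtains h where "\<And>\<xi>. \<xi> \<subseteq> {..<n} \<Longrightarrow> h \<xi> dvd 1"
    and "\<And>\<xi> c. \<xi> \<subseteq> {..<n} \<Longrightarrow> c < n \<Longrightarrow> c \<notin> \<xi> \<Longrightarrow> h (insert c \<xi>) = h \<xi> * \<eta> \<xi> c"
proof -
  have "\<exists>h. (\<forall>\<xi>. \<xi> \<subseteq> {..<m} \<longrightarrow> h \<xi> dvd 1) \<and>
    (\<forall>\<xi> c. \<xi> \<subseteq> {..<m} \<and> c < m \<and> c \<notin> \<xi> \<longrightarrow> h (insert c \<xi>) = h \<xi> * \<eta> \<xi> c)" if "m \<le> n" for m
    using that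
  proof (induction m)
    case 0
    show ?case by (intro exI[of _ "\<lambda>_. 1"]) simp
  next
    case (Suc m)
    have "m \<le> n" using Suc.prems by simp
    from Suc.IH[OF this] obtain h where h_all: "(\<forall>\<xi>. \<xi> \<subseteq> {..<m} \<longrightarrow> h \<xi> dvd 1) \<and>
        (\<forall>\<xi> c. \<xi> \<subseteq> {..<m} \<and> c < m \<and> c \<notin> \<xi> \<longrightarrow> h (insert c \<xi>) = h \<xi> * \<eta> \<xi> c)" ..
    have h_unit: "h \<xi> dvd 1" if "\<xi> \<subseteq> {..<m}" for \<xi> using h_all that by simp
    have h: "h (insert c \<xi>) = h \<xi> * \<eta> \<xi> c" if "\<xi> \<subseteq> {..<m}" "c < m" "c \<notin> \<xi>" for \<xi> c
      using h_all that by simp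
    define h' where "h' \<xi> = (if m \<in> \<xi> then h (\<xi> - {m}) * \<eta> (\<xi> - {m}) m else h \<xi>)" for \<xi>
    have sub: "\<xi> - {m} \<subseteq> {..<m}" if "\<xi> \<subseteq> {..<Suc m}" for \<xi> using that by (auto simp: less_Suc_eq)
    have sub_n: "\<xi> \<subseteq> {..<n}" if "\<xi> \<subseteq> {..<m}" for \<xi> using that Suc.prems by force
    have "h' \<xi> dvd 1" if "\<xi> \<subseteq> {..<Suc m}" for \<xi>
      using h_unit[OF sub[OF that]] unit[OF sub_n[OF sub[OF that]], of m] Suc.prems
      by (auto simp: h'_def intro: mult_dvd_1)
    moreover have "h' (insert c \<xi>) = h' \<xi> * \<eta> \<xi> c" if "\<xi> \<subseteq> {..<Suc m}" "c < Suc m" "c \<notin> \<xi>" for \<xi> c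
    proof (cases "c = m")
      case True
      then show ?thesis using that(3) by (simp add: h'_def)
    next
      case False
      then have c: "c < m" using that(2) by simp
      show ?thesis
      proof (cases "m \<in> \<xi>")
        case True
        let ?\<xi> = "\<xi> - {m}"
        have \<xi>: "insert m ?\<xi> = \<xi>" "insert c \<xi> - {m} = insert c ?\<xi>" using True False by auto
        have "h' (insert c \<xi>) = h ?\<xi> * \<eta> ?\<xi> c * \<eta> (insert c ?\<xi>) m"
          using True c that(3) h[OF sub[OF that(1)] c] by (simp add: h'_def \<xi>)
        also have "\<dots> = h ?\<xi> * (\<eta> (insert c ?\<xi>) m * \<eta> ?\<xi> c)" by (simp add: mult_ac)
        \<comment> \<open>Compatibility with an old direction \<open>c\<close> on the new half is
          the face identity for \<open>c < m\<close>.\<close>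
        also have "\<dots> = h ?\<xi> * (\<eta> (insert m ?\<xi>) c * \<eta> ?\<xi> m)"
          using cocycle[OF sub_n[OF sub[OF that(1)]] c] that(3) Suc.prems by simp
        also have "\<dots> = h' \<xi> * \<eta> \<xi> c" unfolding \<xi>(1) using True by (simp add: h'_def mult_ac)
        finally show ?thesis .
      next
        case False
        then have "\<xi> \<subseteq> {..<m}" using sub[OF that(1)] by simp
        then show ?thesis using False \<open>c \<noteq> m\<close> c that(3) h by (simp add: h'_def)
      qed
    qed
    ultimately show ?case by blast
  qed
  from this[OF order_refl] obtain h where "(\<forall>\<xi>. \<xi> \<subseteq> {..<n} \<longrightarrow> h \<xi> dvd 1) \<and>
      (\<forall>\<xi> c. \<xi> \<subseteq> {..<n} \<and> c < n \<and> c \<notin> \<xi> \<longrightarrow> h (insert c \<xi>) = h \<xi> * \<eta> \<xi> c)" ..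
  then show thesis by (intro that[of h]) simp_all
qed

text \<open>The algebra on one face: \<open>a\<close>, \<open>b\<close> are the products of the
  first sign assignment along the two paths, \<open>c\<close>, \<open>d\<close> their inverses, and
  \<open>a'\<close>, \<open>b'\<close> the products for the second; \<open>x\<close>,
  \<open>x'\<close> are the cocycle values and \<open>v\<close>, \<open>w\<close> the word scalars.
  Because \<open>v\<close> and \<open>w\<close> are involutions, their quotient may be
  inverted.\<close>

lemma sign_quotient_eq:
  fixes a b :: "'k::comm_ring_1"
  assumes "a * c = 1" "b * d = 1" "v * v = 1" "w * w = 1"
    and "a * x = - b" "a' * x' = - b'" "v * x' = w * x"
  shows "a' * c * v = b' * d * w"
proof -
  have "v * x = (w * w) * (v * x)" using assms(4) by simp
  also have "\<dots> = w * v * (w * x)" by (simp add: mult_ac)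
  also have "\<dots> = (v * v) * (w * x')" by (simp add: assms(7)[symmetric] mult_ac)
  finally have *: "v * x = w * x'" using assms(3) by simp
  have "b * (a' * v) = - (a' * a * (v * x))"
    using assms(5) by (metis (no_types, opaque_lifting) minus_minus mult.commute mult.left_commute mult_minus_left)
  also have "\<dots> = - (a' * a * (w * x'))" by (simp add: *)
  also have "\<dots> = a * w * (- (a' * x'))" by (simp add: mult_ac)
  also have "\<dots> = a * (b' * w)" by (simp add: assms(6) mult_ac)
  finally have "c * d * (b * (a' * v)) = c * d * (a * (b' * w))" by simp
  then have "(b * d) * (a' * c * v) = (a * c) * (b' * d * w)" by (simp add: mult_ac)
  then show ?thesis using assms(1,2) by simp
qed

section \<open>Comparison of the two cubes\<close>

locale twisted_cube = ordered_diagram D ord + twisted_params "Params kX kY kZ" p' t u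
  for D ord p' t u +
  fixes \<psi> \<psi>' :: "nat set \<Rightarrow> nat \<Rightarrow> nat \<Rightarrow> kring" and \<epsilon> \<epsilon>' :: "nat set \<Rightarrow> nat \<Rightarrow> kring"
  assumes XY: "pX p' * pY p' = kX * kY"
    and \<psi>: "chron_cocycle (Params kX kY kZ) D ord \<psi>" and \<epsilon>: "sign_assignment D \<psi> \<epsilon>"
    and \<psi>': "chron_cocycle p' D ord \<psi>'" and \<epsilon>': "sign_assignment D \<psi>' \<epsilon>'"
begin

abbreviation p where "p \<equiv> Params kX kY kZ"

text \<open>Turns the face identity between cosets into one between maps; the parameters are left
  general to serve both cubes.\<close>

lemma Fword_path_word:
  assumes q: "chron_params q" and cocycle: "chron_cocycle q D ord \<chi>" and face: "face D \<xi> i j"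
    and v: "v \<in> tpow (length (ord \<xi>))"
  shows "Fword q (path_word \<xi> i j) v s = \<chi> \<xi> i j * Fword q (path_word \<xi> j i) v s"
proof -
  interpret q: chron_params q by (rule q)
  have edges: "edge D \<xi> i" "edge D \<xi> j" "i \<noteq> j" using face by (auto simp: face_def)
  let ?n = "length (ord (insert i (insert j \<xi>)))"
  have "mor q (length (ord \<xi>)) ?n 1 (path_word \<xi> i j) = mor q (length (ord \<xi>)) ?n (\<chi> \<xi> i j) (path_word \<xi> j i)"
    using cocycle face by (simp add: chron_cocycle_def path_word_def Let_def)
  from q.mor_eq_Fword[OF this cob_path_word[OF edges] v] show ?thesis by simp
qed

text \<open>The two face identities are compared through the rescaling. Under the local rule the
  cocycle values agree because X Y is fixed, and only the parity of twists is at stake; elsewhere a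
  unit coefficient of one path is cancelled.\<close>

lemma face_scalars:
  assumes face: "face D \<xi> i j"
  shows "word_scalar t u (path_word \<xi> i j) * \<psi>' \<xi> i j = word_scalar t u (path_word \<xi> j i) * \<psi> \<xi> i j"
proof -
  have edges: "edge D \<xi> i" "edge D \<xi> j" "i \<noteq> j" using face by (auto simp: face_def)
  note F = Fword_path_word[OF chron_params_axioms \<psi> face]
    and F' = Fword_path_word[OF chron_params_twist \<psi>' face]
  show ?thesis
  proof (cases "ladybug D \<xi> i j")
    case True
    have \<psi>_eq: "\<psi>' \<xi> i j = \<psi> \<xi> i j" "\<psi> \<xi> i j \<in> {1, kX * kY}"
      using \<psi> \<psi>' face True XY by (auto simp: chron_cocycle_def)
    have splits: "\<not> is_merge D \<xi> i" "\<not> is_merge D \<xi> j" and merges: "is_merge D (insert i \<xi>) j" "is_merge D (insert j \<xi>) i"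
      using True merge_after_split[OF edges] by (auto simp: ladybug_def)
    have "even (path_twists \<xi> i j) \<longleftrightarrow> even (path_twists \<xi> j i)"
      by (rule ladybug_path_twists[OF face True \<psi>_eq(2)]) (rule F, simp add: basis_tpow)
    moreover have "t ^ k = (if even k then 1 else t)" for k
      using t_square by (induction k) auto
    ultimately have "t ^ path_twists \<xi> i j = t ^ path_twists \<xi> j i" by simp
    then show ?thesis
      using word_scalar_path_word[OF edges splits(1) merges(1), of t u]
        word_scalar_path_word[OF edges(2,1) edges(3)[symmetric] splits(2) merges(2), of t u]
      by (simp add: \<psi>_eq(1))
  next
    case False
    interpret twist: cube_functor D ord p' ..
    obtain s s' where s: "length s = length (ord \<xi>)" "Fword p' (path_word \<xi> j i) (basis s) s' dvd 1"
      using twist.path_unit_coefficient[OF edges(2) edge_insert[OF edges]] ladybugI[OF face] False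
      unfolding path_word_def by blast
    let ?c = "rescale r s * Fword p' (path_word \<xi> j i) (basis s) s'"
    have "?c * (word_scalar t u (path_word \<xi> i j) * \<psi>' \<xi> i j)
        = word_scalar t u (path_word \<xi> i j) * (rescale r s * Fword p' (path_word \<xi> i j) (basis s) s')"
      using F'[OF basis_tpow[OF s(1)], of s'] by (simp add: mult_ac)
    also have "\<dots> = rescale r s' * Fword p (path_word \<xi> i j) (basis s) s'"
      by (rule Fword_rescale_basis[OF saddle_word_path_word, symmetric])
    also have "\<dots> = \<psi> \<xi> i j * (rescale r s' * Fword p (path_word \<xi> j i) (basis s) s')"
      using F[OF basis_tpow[OF s(1)], of s'] by (simp add: mult_ac)
    also have "rescale r s' * Fword p (path_word \<xi> j i) (basis s) s'
        = word_scalar t u (path_word \<xi> j i) * (rescale r s * Fword p' (path_word \<xi> j i) (basis s) s')"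
      by (rule Fword_rescale_basis[OF saddle_word_path_word])
    finally have "?c * (word_scalar t u (path_word \<xi> i j) * \<psi>' \<xi> i j)
        = ?c * (word_scalar t u (path_word \<xi> j i) * \<psi> \<xi> i j)"
      by (simp add: mult_ac)
    moreover have "rescale r s dvd 1" using rescale_square[OF r_square, of s] by (metis dvdI)
    ultimately show ?thesis using s(2) by (auto intro: unit_cancel mult_dvd_1)
  qed
qed

text \<open>The edge equations make \<open>h\<close> a multiplicative primitive of the ratio of the
  two edge maps.\<close>

lemma ex_vertex_scalars:
  obtains h where "\<And>\<xi>. vertex D \<xi> \<Longrightarrow> h \<xi> dvd 1"
    and "\<And>\<xi> c. edge D \<xi> c \<Longrightarrow>
      h (insert c \<xi>) * \<epsilon> \<xi> c * word_scalar t u (saddle D ord \<xi> c) = \<epsilon>' \<xi> c * h \<xi>"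
proof -
  define w where "w \<xi> c = word_scalar t u (saddle D ord \<xi> c)" for \<xi> c
  have w_square: "w \<xi> c * w \<xi> c = 1" for \<xi> c by (simp add: w_def word_scalar_square)
  have "\<exists>b. edge D \<xi> c \<longrightarrow> \<epsilon> \<xi> c * b = 1" for \<xi> c
    using \<epsilon> by (auto simp: sign_assignment_def dvd_def)
  then obtain \<delta> where \<delta>: "\<And>\<xi> c. edge D \<xi> c \<Longrightarrow> \<epsilon> \<xi> c * \<delta> \<xi> c = 1" by metis
  \<comment> \<open>\<open>w\<close> is its own inverse, so it may appear as a factor instead of a
    divisor.\<close>
  define \<eta> where "\<eta> \<xi> c = \<epsilon>' \<xi> c * \<delta> \<xi> c * w \<xi> c" for \<xi> c
  have unit: "\<eta> \<xi> c dvd 1" if "edge D \<xi> c" for \<xi> c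
  proof -
    have "\<epsilon>' \<xi> c dvd 1" using \<epsilon>' that by (simp add: sign_assignment_def)
    moreover have "\<delta> \<xi> c dvd 1" using \<delta>[OF that] by (metis dvd_triv_right)
    moreover have "w \<xi> c dvd 1" using w_square by (metis dvd_triv_right)
    ultimately show ?thesis by (simp add: \<eta>_def mult_dvd_1)
  qed
  have cocycle: "\<eta> (insert i \<xi>) j * \<eta> \<xi> i = \<eta> (insert j \<xi>) i * \<eta> \<xi> j" if face: "face D \<xi> i j" for \<xi> i j
  proof -
    have edges: "edge D \<xi> i" "edge D \<xi> j" "i \<noteq> j" using face by (auto simp: face_def)
    note edges' = edge_insert[OF edges(2,1) edges(3)[symmetric]] edge_insert[OF edges]
    let ?e1 = "\<epsilon> (insert i \<xi>) j * \<epsilon> \<xi> i" and ?e2 = "\<epsilon> (insert j \<xi>) i * \<epsilon> \<xi> j"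
    let ?d1 = "\<delta> (insert i \<xi>) j * \<delta> \<xi> i" and ?d2 = "\<delta> (insert j \<xi>) i * \<delta> \<xi> j"
    let ?e1' = "\<epsilon>' (insert i \<xi>) j * \<epsilon>' \<xi> i" and ?e2' = "\<epsilon>' (insert j \<xi>) i * \<epsilon>' \<xi> j"
    let ?w1 = "w \<xi> i * w (insert i \<xi>) j" and ?w2 = "w \<xi> j * w (insert j \<xi>) i"
    have "?e1 * ?d1 = (\<epsilon> (insert i \<xi>) j * \<delta> (insert i \<xi>) j) * (\<epsilon> \<xi> i * \<delta> \<xi> i)"
      "?e2 * ?d2 = (\<epsilon> (insert j \<xi>) i * \<delta> (insert j \<xi>) i) * (\<epsilon> \<xi> j * \<delta> \<xi> j)"
      by (simp_all only: mult_ac)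
    then have d: "?e1 * ?d1 = 1" "?e2 * ?d2 = 1"
      by (simp_all only: \<delta>[OF edges(1)] \<delta>[OF edges(2)] \<delta>[OF edges'(1)] \<delta>[OF edges'(2)] mult_1_left)
    have "?w1 * ?w1 = (w \<xi> i * w \<xi> i) * (w (insert i \<xi>) j * w (insert i \<xi>) j)"
      "?w2 * ?w2 = (w \<xi> j * w \<xi> j) * (w (insert j \<xi>) i * w (insert j \<xi>) i)"
      by (simp_all only: mult_ac)
    then have ww: "?w1 * ?w1 = 1" "?w2 * ?w2 = 1" by (simp_all only: w_square mult_1_left)
    have e: "?e1 * \<psi> \<xi> i j = - ?e2" "?e1' * \<psi>' \<xi> i j = - ?e2'"
      using \<epsilon> \<epsilon>' face by (simp_all add: sign_assignment_def)
    have w: "?w1 * \<psi>' \<xi> i j = ?w2 * \<psi> \<xi> i j"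
      using face_scalars[OF face] by (simp add: path_word_def w_def)
    have "?e1' * ?d1 * ?w1 = ?e2' * ?d2 * ?w2"
      by (rule sign_quotient_eq[OF d ww e w])
    then show ?thesis by (simp only: \<eta>_def mult_ac)
  qed
  obtain h where h: "\<And>\<xi>. \<xi> \<subseteq> {..<crossings D} \<Longrightarrow> h \<xi> dvd 1"
    "\<And>\<xi> c. \<xi> \<subseteq> {..<crossings D} \<Longrightarrow> c < crossings D \<Longrightarrow> c \<notin> \<xi> \<Longrightarrow> h (insert c \<xi>) = h \<xi> * \<eta> \<xi> c"
  proof (rule ex_coboundary[of "crossings D" \<eta>])
    show "\<eta> \<xi> c dvd 1" if "\<xi> \<subseteq> {..<crossings D}" "c < crossings D" "c \<notin> \<xi>" for \<xi> c
      by (rule unit) (use that in \<open>simp add: edge_def vertex_def\<close>)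
    show "\<eta> (insert i \<xi>) j * \<eta> \<xi> i = \<eta> (insert j \<xi>) i * \<eta> \<xi> j"
      if "\<xi> \<subseteq> {..<crossings D}" "i < j" "j < crossings D" "i \<notin> \<xi>" "j \<notin> \<xi>" for \<xi> i j
      by (rule cocycle) (use that in \<open>simp add: face_def edge_def vertex_def\<close>)
  qed (rule that; assumption)
  show thesis
  proof
    show "h \<xi> dvd 1" if "vertex D \<xi>" for \<xi> using h(1) that by (simp add: vertex_def)
    show "h (insert c \<xi>) * \<epsilon> \<xi> c * word_scalar t u (saddle D ord \<xi> c) = \<epsilon>' \<xi> c * h \<xi>"
      if "edge D \<xi> c" for \<xi> c
    proof -
      have "h (insert c \<xi>) = h \<xi> * \<eta> \<xi> c" using h(2) that by (simp add: edge_def vertex_def)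
      then have "h (insert c \<xi>) * \<epsilon> \<xi> c * w \<xi> c = \<epsilon>' \<xi> c * h \<xi> * (\<epsilon> \<xi> c * \<delta> \<xi> c) * (w \<xi> c * w \<xi> c)"
        by (simp only: \<eta>_def mult_ac)
      then show ?thesis unfolding w_def[symmetric] by (simp only: \<delta>[OF that] w_square mult_1_right)
    qed
  qed
qed

text \<open>On the summand at \<open>\<xi>\<close> the isomorphism is the diagonal rescaling times
  \<open>h \<xi>\<close>, in all degrees alike; its inverse uses \<open>h_inv\<close> because the
  rescaling is an involution.\<close>

lemma complex_iso_twist:
  "complex_iso (Fcomplex p (Kh p D ord \<epsilon>)) (Fcomplex p' (Kh p' D ord \<epsilon>'))"
proof -
  obtain h where h_unit: "\<And>\<xi>. vertex D \<xi> \<Longrightarrow> h \<xi> dvd 1"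
    and h: "\<And>\<xi> c. edge D \<xi> c \<Longrightarrow>
      h (insert c \<xi>) * \<epsilon> \<xi> c * word_scalar t u (saddle D ord \<xi> c) = \<epsilon>' \<xi> c * h \<xi>"
    by (rule ex_vertex_scalars) (rule that; assumption)
  have "\<exists>b. vertex D \<xi> \<longrightarrow> h \<xi> * b = 1" for \<xi> using h_unit[of \<xi>] by (auto simp: dvd_def)
  then obtain h_inv where h_inv: "\<And>\<xi>. vertex D \<xi> \<Longrightarrow> h \<xi> * h_inv \<xi> = 1" by metis
  define I where "I i = {\<xi>. vertex D \<xi> \<and> int (card \<xi>) = i + int (n_minus D)}" for i
  define M where "M i = {v :: nat set \<Rightarrow> kring tensor. (\<forall>\<xi>\<in>I i. v \<xi> \<in> tpow (length (ord \<xi>))) \<and>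
    (\<forall>\<xi>. \<xi> \<notin> I i \<longrightarrow> v \<xi> = (\<lambda>s. 0))}" for i
  define f where "f v = (\<lambda>\<xi> s. h \<xi> * rescale r s * v \<xi> s)" for v :: "nat set \<Rightarrow> kring tensor"
  define g where "g v = (\<lambda>\<xi> s. h_inv \<xi> * rescale r s * v \<xi> s)" for v :: "nat set \<Rightarrow> kring tensor"
  have carrier: "mcarrier (Fcomplex q (Kh q D ord \<delta>)) i = M i" for q :: "kring params" and \<delta> i
    by (simp add: Fcomplex_def Kh_def M_def I_def)
  have scale_tpow: "(\<lambda>s. c s * v s) \<in> tpow k" if "v \<in> tpow k" for c :: "kring tensor" and v k
    using that by (simp add: tpow_def)
  have scale_M: "(\<lambda>\<xi> s. c \<xi> s * v \<xi> s) \<in> M i" if "v \<in> M i" for c v i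
    using that by (auto simp: M_def intro: scale_tpow)
  have inverse: "h_inv \<xi> * rescale r s * (h \<xi> * rescale r s * v \<xi> s) = v \<xi> s"
    "h \<xi> * rescale r s * (h_inv \<xi> * rescale r s * v \<xi> s) = v \<xi> s" if v: "v \<in> M i" for v i \<xi> s
  proof -
    have "(h \<xi> * h_inv \<xi>) * (rescale r s * rescale r s) * v \<xi> s = v \<xi> s"
    proof (cases "\<xi> \<in> I i")
      case True
      then show ?thesis using h_inv[of \<xi>] rescale_square[OF r_square, of s] by (simp add: I_def)
    next
      case False
      then show ?thesis using v by (simp add: M_def)
    qed
    then show "h_inv \<xi> * rescale r s * (h \<xi> * rescale r s * v \<xi> s) = v \<xi> s"
      "h \<xi> * rescale r s * (h_inv \<xi> * rescale r s * v \<xi> s) = v \<xi> s"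
      by (simp_all only: mult_ac)
  qed
  have bij: "bij_betw f (M i) (M i)" for i
  proof (rule bij_betw_byWitness[where f' = g])
    show "\<forall>v\<in>M i. g (f v) = v" "\<forall>v\<in>M i. f (g v) = v"
      using inverse by (auto simp: f_def g_def fun_eq_iff)
    show "f ` M i \<subseteq> M i" "g ` M i \<subseteq> M i" using scale_M by (auto simp: f_def g_def)
  qed
  have entry: "h \<xi>' * rescale r s * Fmor p (cdiff (Kh p D ord \<epsilon>) i \<xi>' \<xi>) (v \<xi>) s
      = Fmor p' (cdiff (Kh p' D ord \<epsilon>') i \<xi>' \<xi>) (f v \<xi>) s"
    if v: "v \<in> M i" and \<xi>: "\<xi> \<in> I i" for v i \<xi>' \<xi> s
  proof -
    have v\<xi>: "v \<xi> \<in> tpow (length (ord \<xi>))" using v \<xi> by (simp add: M_def)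
    then have fv\<xi>: "f v \<xi> \<in> tpow (length (ord \<xi>))" unfolding f_def by (rule scale_tpow)
    show ?thesis
    proof (cases "\<exists>c. edge D \<xi> c \<and> \<xi>' = insert c \<xi>")
      case True
      then obtain c where c: "edge D \<xi> c" "\<xi>' = insert c \<xi>" by blast
      \<comment> \<open>The direction of an edge is the only element added to its first
        vertex.\<close>
      have the_c: "(THE c'. edge D \<xi> c' \<and> insert c \<xi> = insert c' \<xi>) = c"
        using c(1) by (intro the_equality) (auto simp: edge_def)
      have diff: "cdiff (Kh q D ord \<delta>) i \<xi>' \<xi>
          = mor q (length (ord \<xi>)) (length (ord \<xi>')) (\<delta> \<xi> c) (saddle D ord \<xi> c)" for q :: "kring params" and \<delta>
        using True c by (simp add: Kh_def Let_def the_c)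
      have cob: "cob (saddle D ord \<xi> c) (length (ord \<xi>)) (length (ord \<xi>'))"
        using cob_saddle[OF c(1)] by (simp add: c(2))
      have fv: "f v \<xi> = (\<lambda>s. h \<xi> * (rescale r s * v \<xi> s))" by (simp add: f_def mult.assoc)
      let ?F' = "Fword p' (saddle D ord \<xi> c) (\<lambda>s. rescale r s * v \<xi> s) s"
      have "h \<xi>' * rescale r s * (\<epsilon> \<xi> c * Fword p (saddle D ord \<xi> c) (v \<xi>) s)
          = h \<xi>' * \<epsilon> \<xi> c * (rescale r s * Fword p (saddle D ord \<xi> c) (v \<xi>) s)"
        by (simp only: mult_ac)
      also have "\<dots> = h (insert c \<xi>) * \<epsilon> \<xi> c * word_scalar t u (saddle D ord \<xi> c) * ?F'"
        by (simp only: Fword_rescale[OF saddle_word_saddle] c(2) mult.assoc)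
      also have "\<dots> = \<epsilon>' \<xi> c * (h \<xi> * ?F')"
        unfolding h[OF c(1)] by (rule mult.assoc)
      also have "\<dots> = \<epsilon>' \<xi> c * Fword p' (saddle D ord \<xi> c) (f v \<xi>) s"
        by (simp only: fv Fword_scale)
      finally show ?thesis
        unfolding diff Fmor_mor[OF cob v\<xi>] twist.Fmor_mor[OF cob fv\<xi>] .
    next
      case False
      then have "cdiff (Kh q D ord \<delta>) i \<xi>' \<xi> = mor q (length (ord \<xi>)) (length (ord \<xi>')) 0 []" for q :: "kring params" and \<delta>
        using False by (simp only: Kh_def cob_complex.select_convs if_False)
      then show ?thesis using Fmor_zero[OF v\<xi>] twist.Fmor_zero[OF fv\<xi>] by simp
    qed
  qed
  have idx: "cidx (Kh q D ord \<delta>) = I" for q :: "kring params" and \<delta>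
    by (rule ext) (simp add: Kh_def I_def)
  have diff: "mdiff (Fcomplex q (Kh q D ord \<delta>)) i v = (\<lambda>\<xi>' s. if \<xi>' \<in> I (i + 1)
      then \<Sum>\<xi>\<in>I i. Fmor q (cdiff (Kh q D ord \<delta>) i \<xi>' \<xi>) (v \<xi>) s else 0)" for q :: "kring params" and \<delta> i v
    unfolding Fcomplex_def mod_complex.select_convs idx ..
  have chain_map: "f (mdiff (Fcomplex p (Kh p D ord \<epsilon>)) i v) = mdiff (Fcomplex p' (Kh p' D ord \<epsilon>')) i (f v)"
    if v: "v \<in> M i" for v i
  proof (intro ext)
    fix \<xi>' s
    have "h \<xi>' * rescale r s * (\<Sum>\<xi>\<in>I i. Fmor p (cdiff (Kh p D ord \<epsilon>) i \<xi>' \<xi>) (v \<xi>) s)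
        = (\<Sum>\<xi>\<in>I i. Fmor p' (cdiff (Kh p' D ord \<epsilon>') i \<xi>' \<xi>) (f v \<xi>) s)"
      unfolding sum_distrib_left by (rule sum.cong) (simp_all only: entry[OF v])
    then show "f (mdiff (Fcomplex p (Kh p D ord \<epsilon>)) i v) \<xi>' s
        = mdiff (Fcomplex p' (Kh p' D ord \<epsilon>')) i (f v) \<xi>' s"
      unfolding diff by (simp add: f_def[of "\<lambda>\<xi>' s. if _ \<xi>' then _ \<xi>' s else _"])
  qed
  show ?thesis unfolding complex_iso_def carrier
  proof (rule exI[of _ "\<lambda>_. f"], intro allI conjI ballI)
    show "bij_betw f (M i) (M i)" for i by (rule bij)
    show "f (\<lambda>\<xi> s. v \<xi> s + w \<xi> s) = (\<lambda>\<xi> s. f v \<xi> s + f w \<xi> s)" for v w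
      by (simp add: f_def distrib_left)
    show "f (\<lambda>\<xi> s. c * v \<xi> s) = (\<lambda>\<xi> s. c * f v \<xi> s)" for c v
      by (simp add: f_def mult_ac)
  qed (rule chain_map)
qed

end

section \<open>Degree constraints on the automorphism\<close>

lemma homogeneous_sdeg_0:
  assumes "f \<in> homogeneous (0, - c)"
  obtains a b where "f = Poly_Mapping.single (0, 0, c) a + Poly_Mapping.single (1, 1, c) b"
proof
  show "f = Poly_Mapping.single (0, 0, c) (Poly_Mapping.lookup f (0, 0, c))
      + Poly_Mapping.single (1, 1, c) (Poly_Mapping.lookup f (1, 1, c))"
  proof (rule poly_mapping_eqI)
    fix m :: "bit \<times> bit \<times> int"
    obtain i j k where m: "m = (i, j, k)" by (metis prod_cases3)
    show "Poly_Mapping.lookup f m = Poly_Mapping.lookup (Poly_Mapping.single (0, 0, c) (Poly_Mapping.lookup f (0, 0, c))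
      + Poly_Mapping.single (1, 1, c) (Poly_Mapping.lookup f (1, 1, c))) m"
    proof (cases "mono_sdeg m = (0, - c)")
      case True
      \<comment> \<open>Only Z^c and X Y Z^c have this degree, as i + j = 0 in \<open>bit\<close>
        means i = j.\<close>
      then have "i = j" "k = c" unfolding m mono_sdeg_def by (cases i; cases j; simp)+
      then show ?thesis unfolding m by (cases j) (simp_all add: lookup_add lookup_single)
    next
      case False
      then have "Poly_Mapping.lookup f m = 0" using assms by (auto simp: homogeneous_def in_keys_iff)
      moreover have "m \<noteq> (0, 0, c)" "m \<noteq> (1, 1, c)" using False by (auto simp: mono_sdeg_def)
      ultimately show ?thesis by (simp add: lookup_add lookup_single when_def)
    qed
  qed
qed

text \<open>Up to sign, the only units of the group ring of \<open>\<int>\<^sub>2\<close> are the group elements.\<close>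

lemma int_group_ring_unit:
  fixes a b c d :: int
  assumes "a * c + b * d = 1" "a * d + b * c = 0"
  shows "a * a + b * b = 1" "a * b = 0"
proof -
  have "(a + b) * (c + d) = 1" "(a - b) * (c - d) = 1" using assms by (simp_all add: algebra_simps)
  then have "(a + b) * (a + b) = 1" "(a - b) * (a - b) = 1" by (auto simp: zmult_eq_1_iff)
  moreover have "2 * (a * a + b * b) = (a + b) * (a + b) + (a - b) * (a - b)"
    "4 * (a * b) = (a + b) * (a + b) - (a - b) * (a - b)"
    by (simp_all add: algebra_simps)
  ultimately show "a * a + b * b = 1" "a * b = 0" by simp_all
qed

text \<open>\<open>f\<close> is (a + b X Y) Z, and the inverse \<open>g\<close> makes a + b X Y a
  unit of the group ring of the group with elements 1 and X Y; so it is 1 or X Y up to sign and has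
  square 1.\<close>

lemma sdeg_0_unit_square:
  assumes "f \<in> homogeneous (0, - 1)" "g \<in> homogeneous (0, 1)" "f * g = 1"
  shows "(f * Poly_Mapping.single (0, 0, - 1) 1) * (f * Poly_Mapping.single (0, 0, - 1) 1) = 1"
proof -
  obtain a b where f: "f = Poly_Mapping.single (0, 0, 1) a + Poly_Mapping.single (1, 1, 1) b"
    using homogeneous_sdeg_0[of f 1] assms(1) by auto
  obtain c d where g: "g = Poly_Mapping.single (0, 0, - 1) c + Poly_Mapping.single (1, 1, - 1) d"
    using homogeneous_sdeg_0[of g "- 1"] assms(2) by auto
  have "f * g = Poly_Mapping.single (0, 0, 0) (a * c + b * d) + Poly_Mapping.single (1, 1, 0) (a * d + b * c)"
    by (simp add: f g distrib_left distrib_right mult_single single_add add_ac)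
  then have one: "(1 :: kring) = Poly_Mapping.single (0, 0, 0) (a * c + b * d) + Poly_Mapping.single (1, 1, 0) (a * d + b * c)"
    using assms(3) by simp
  have "a * c + b * d = 1" "a * d + b * c = 0"
    using arg_cong[OF one, of "\<lambda>f. Poly_Mapping.lookup f (0, 0, 0)"]
      arg_cong[OF one, of "\<lambda>f. Poly_Mapping.lookup f (1, 1, 0)"]
    by (simp_all add: lookup_add lookup_single lookup_one zero_prod_def)
  note ab = int_group_ring_unit[OF this]
  have u: "f * Poly_Mapping.single (0, 0, - 1) 1 = Poly_Mapping.single (0, 0, 0) a + Poly_Mapping.single (1, 1, 0) b"
    by (simp add: f distrib_right mult_single)
  have "(f * Poly_Mapping.single (0, 0, - 1) 1) * (f * Poly_Mapping.single (0, 0, - 1) 1)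
      = (Poly_Mapping.single (0, 0, 0) (a * a) + Poly_Mapping.single (1, 1, 0) (a * b))
        + (Poly_Mapping.single (1, 1, 0) (a * b) + Poly_Mapping.single (0, 0, 0) (b * b))"
    unfolding u distrib_left distrib_right mult_single by (simp add: mult.commute)
  also have "\<dots> = Poly_Mapping.single (0, 0, 0) (a * a + b * b)"
    unfolding ab(2) single_add by simp
  also have "\<dots> = 1" unfolding ab(1) by (simp flip: zero_prod_def)
  finally show ?thesis .
qed

theorem proposition5p5:
  fixes \<phi> :: "kring \<Rightarrow> kring"
    and D :: link_diag
    and ord :: "nat set \<Rightarrow> circle list"
    and \<psi> \<psi>' :: "nat set \<Rightarrow> nat \<Rightarrow> nat \<Rightarrow> kring"
    and \<epsilon> \<epsilon>' :: "nat set \<Rightarrow> nat \<Rightarrow> kring"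
  assumes "ring_automorphism \<phi>"
    and "grading_preserving \<phi>"
    and "\<phi> (kX * kY) = kX * kY"
    and "link_diagram D"
    and "circle_order D ord"
    and "chron_cocycle (Params kX kY kZ) D ord \<psi>"
    and "sign_assignment D \<psi> \<epsilon>"
    and "chron_cocycle (Params (\<phi> kX) (\<phi> kY) (\<phi> kZ)) D ord \<psi>'"
    and "sign_assignment D \<psi>' \<epsilon>'"
  shows "complex_iso
            (Fcomplex (Params kX kY kZ) (Kh (Params kX kY kZ) D ord \<epsilon>))
            (Fcomplex (Params (\<phi> kX) (\<phi> kY) (\<phi> kZ)) (Kh (Params (\<phi> kX) (\<phi> kY) (\<phi> kZ)) D ord \<epsilon>'))"
proof -
  have hom: "\<phi> (a * b) = \<phi> a * \<phi> b" "\<phi> 1 = 1" for a b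
    using assms(1) by (auto simp: ring_automorphism_def)
  let ?Zi = "Poly_Mapping.single (0, 0, - 1) 1 :: kring"
  \<comment> \<open>X is its own inverse, so \<open>t\<close> is the quotient of \<phi>(X) by X;
    likewise \<open>u\<close> is the quotient of \<phi>(Z) by Z.\<close>
  define t where "t = \<phi> kX * kX"
  define u where "u = \<phi> kZ * ?Zi"
  have X2: "\<phi> kX * \<phi> kX = 1" using hom(1)[of kX kX] by (simp add: kX_square hom(2))
  have XY: "\<phi> kX * \<phi> kY = kX * kY" using assms(3) hom(1)[of kX kY] by simp
  have "t * t = (\<phi> kX * \<phi> kX) * (kX * kX)" by (simp add: t_def mult_ac)
  then have t2: "t * t = 1" by (simp add: X2 kX_square)
  have twist_X: "\<phi> kX = t * kX" by (simp add: t_def mult.assoc kX_square)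
  \<comment> \<open>Y is recovered from \<phi>(X) \<phi>(Y) = X Y, which is why it is scaled by the
    same \<open>t\<close> as X.\<close>
  have "\<phi> kY = (\<phi> kX * \<phi> kX) * \<phi> kY" by (simp add: X2)
  also have "\<dots> = \<phi> kX * (kX * kY)" by (simp only: XY mult.assoc)
  finally have twist_Y: "\<phi> kY = t * kY" by (simp add: t_def mult.assoc)
  have "u * kZ = \<phi> kZ * (kZ * ?Zi)" by (simp only: u_def mult_ac)
  then have twist_Z: "\<phi> kZ = u * kZ" by (simp add: kZ_inverse)
  have "kZ \<in> homogeneous (0, - 1)" "?Zi \<in> homogeneous (0, 1)"
    by (simp_all add: homogeneous_def kZ_def mono_sdeg_def)
  then have "\<phi> kZ \<in> homogeneous (0, - 1)" "\<phi> ?Zi \<in> homogeneous (0, 1)"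
    using assms(2) by (auto simp: grading_preserving_def)
  moreover have "\<phi> kZ * \<phi> ?Zi = 1" using hom(1)[of kZ ?Zi] by (simp add: kZ_inverse hom(2))
  ultimately have u2: "u * u = 1" unfolding u_def by (rule sdeg_0_unit_square)
  interpret twisted_cube D ord "Params (\<phi> kX) (\<phi> kY) (\<phi> kZ)" t u \<psi> \<psi>' \<epsilon> \<epsilon>'
  proof intro_locales
    show "diagram D" by (rule diagram.intro) (rule assms(4))
    show "ordered_diagram_axioms D ord" by (rule ordered_diagram_axioms.intro) (rule assms(5))
    show "chron_params (Params kX kY kZ)" by (rule chron_params_generic)
    show "twisted_params_axioms (Params kX kY kZ) (Params (\<phi> kX) (\<phi> kY) (\<phi> kZ)) t u"
      by (rule twisted_params_axioms.intro) (simp_all add: t2 u2 twist_X[symmetric] twist_Y[symmetric] twist_Z[symmetric])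
    show "twisted_cube_axioms D ord (Params (\<phi> kX) (\<phi> kY) (\<phi> kZ)) \<psi> \<psi>' \<epsilon> \<epsilon>'"
      by (rule twisted_cube_axioms.intro) (simp_all add: XY assms)
  qed
  show ?thesis by (rule complex_iso_twist)
qed

end
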